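(* Let $\Gamma\subset\mathbb{C}$ be a lattice, let $\beta_0\in\Gamma^*$ be such that $\Gamma^*_{\beta_0}\neq\emptyset$, and let $N=\#\Gamma^*_{\beta_0}$. With the notation of the context: (1) The map $\Phi:\mathcal{S}(\Gamma,\beta_0)\to\mathbb{CP}^{N-1}$ is an isomorphism (here $\mathcal{S}(\Gamma,\beta_0)$ carries the structure of the space of effective divisors of degree $N-1$ on $\hat{\mathbb{C}}$, i.e. of $\mathbb{P}\{h\in\mathbb{C}[\lambda]:\deg h\le N-1\}$, via $(X_\Delta,\lambda,\mathcal{L}(E))\mapsto E+\sum_{s_j\notin\mathfrak{S}_\Delta}s_j$). (2) Assigning to $f$ its spectral data induces a bijection from the set of based weakly conformal HSL immersions $f:\mathbb{C}/\Gamma\to\mathbb{R}^4$ with Maslov class $\beta_0$, modulo dilations and the action of the maximal torus $T_0\simeq S^1$ of $G_0$, onto $\mathcal{S}(\Gamma,\beta_0)$. (3) Varying the base point of $f$ induces an action of the real Lie group $\mathbb{C}/\Gamma$ on $\mathcal{S}(\Gamma,\beta_0)$, in which $p\in\mathbb{C}/\Gamma$ sends the spectral data of $f$ to the spectral data $\Sigma_p(f)$ of the rebased map $f_p$. (4) $f$ has a branch point at $p\in\mathbb{C}/\Gamma$ if and only if $\Phi(\Sigma_p(f))$ lies on the intersection $\Theta_\infty\cap\Theta_0$ of the two hyperplanes $\Theta_\infty,\Theta_0\subset\mathbb{CP}^{N-1}$.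
   Context: **HSL tori.** $\mathbb{R}^4$ has its standard inner product and orthonormal basis $\varepsilon_1,\dots,\varepsilon_4$. $J,L\in SO(4)$ are given by $J\varepsilon_1=\varepsilon_2$, $J\varepsilon_2=-\varepsilon_1$, $J\varepsilon_3=\varepsilon_4$, $J\varepsilon_4=-\varepsilon_3$; $L\varepsilon_1=\varepsilon_3$, $L\varepsilon_3=-\varepsilon_1$, $L\varepsilon_2=-\varepsilon_4$, $L\varepsilon_4=\varepsilon_2$, so $J^2=L^2=-1$, $LJ=-JL$. All are extended complex linearly to $\mathbb{C}^4$. $G_0=\{g\in SO(4):gJ=Jg,\ gL=Lg\}\simeq SU(2)$. On $\mathbb{C}$, $\langle z,w\rangle=\mathrm{Re}(z\bar w)$; $\Gamma^*=\{\gamma\in\mathbb{C}:\langle\gamma,z\rangle\in\mathbb{Z}\ \forall z\in\Gamma\}$; $e_\gamma(z)=\exp(2\pi i\langle\gamma,z\rangle)$. For $\beta_0\in\Gamma^*$ put $\beta(z)=2\pi\langle\beta_0,z\rangle$. A based weakly conformal Hamiltonian stationary Lagrangian (HSL) immersion with Maslov class $\beta_0$ is a non-constant smooth $f:\mathbb{C}/\Gamma\to\mathbb{R}^4$ with $f(0)=0$ and $e^{J\beta}L f_z=i f_z$ ($f_z=\partial f/\partial z$). A branch point is a point where $f_z=0$. Put $v_1=\frac1{\sqrt2}(\varepsilon_1-i\varepsilon_2)$, $v_2=\frac1{\sqrt2}(\varepsilon_3-i\varepsilon_4)$, $v_3=\bar v_1$, $v_4=\bar v_2$. $T_0=\{g\in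 G_0: g\,\mathbb{C}v_1=\mathbb{C}v_1\}\simeq S^1$. For $p\in\mathbb{C}/\Gamma$ the rebased map is $f_p(z)=e^{-J\beta(p)/2}(f(z+p)-f(p))$ (for a lift of $p$ to $\mathbb{C}$; well defined up to sign, hence modulo $T_0$). **Frequencies.** $\Gamma^*_{\beta_0}=\{\gamma\in\Gamma^*+\frac{\beta_0}{2}:|\gamma|=\frac{|\beta_0|}2,\ \gamma\ne\pm\frac{\beta_0}2\}=\{\gamma_1,\dots,\gamma_N\}$ ($N$ even, labelled with $\gamma_{j+N/2}=-\gamma_j$), and $s_j=2\gamma_j/\beta_0$, which are distinct points of the unit circle. $N$ is the maximal number of non-trivial Fourier modes of $u=e^{-J\beta/2}f_z$ for such $f$. $\Delta_f\subset\Gamma^*_{\beta_0}$ is the set of frequencies $\gamma$ whose Fourier coefficient in $u$ is non-zero. **Spectral triples.** For non-empty $\Delta\subseteq\Gamma^*_{\beta_0}$ with $-\Delta=\Delta$ let $N_\Delta=\#\Delta$, $\mathfrak{S}_\Delta=\{2\gamma/\beta_0:\gamma\in\Delta\}$, $p_\Delta(\lambda)=\prod_{s\in\mathfrak{S}_\Delta}(\lambda-s)$. $X_\Delta$ is the completion by smooth points of the affine curve in $\mathbb{C}^5\setminus\{Z_5=0\}$ with equations $Z_j(Z_j-p_\Delta(Z_5))=0$, $Z_jZ_k=0$ ($1\le j\ne k\le4$), and $\lambda=Z_5$. Its components are $C_1,\dots,C_5$, where for $j\le4$ $C_j$ has affine part $Z_j=p_\Delta(Z_5)$, $Z_k=0$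 ($k\ne j$, $k\le 4$) and $C_5$ has affine part $Z_1=\dots=Z_4=0$; $\lambda$ identifies each with $\hat{\mathbb{C}}=\mathbb{C}\cup\{\infty\}$, and all meet over each point of $\mathfrak{S}_\Delta$. $P_j\in C_j$ is the point over $\lambda=0$. The antiholomorphic involution $\rho$ swaps $C_1\leftrightarrow C_3$, $C_2\leftrightarrow C_4$, preserves $C_5$, with $\lambda\circ\rho=\bar\lambda^{-1}$; the holomorphic involution $\tau$ swaps $C_1\leftrightarrow C_4$, $C_2\leftrightarrow C_3$, preserves $C_5$, with $\lambda\circ\tau=-\lambda$. $\mathcal{E}_\Delta$ is the set of effective divisors $E$ of degree $N_\Delta-1$ on $C_1\simeq\hat{\mathbb{C}}$ such that if $s\in\mathfrak{S}_\Delta$ lies in the support of $E$ then $-s$ does not. For $E\in\mathcal{E}_\Delta$ let $E'=E-\sum_{s\in\mathfrak{S}_\Delta\cap\mathrm{Supp}E}s$, $D_E=E'+\rho^*E'+\tau^*E'+(\rho\tau)^*E'+\sum_{k=1}^4P_k$, $\mathfrak{S}_1=\mathfrak{S}_\Delta\setminus\mathrm{Supp}E$, $\mathfrak{S}_2=-\mathfrak{S}_1$. Let $X_E$ be the completion by smooth points of the curve $Z_j(Z_j-p_j(Z_5))=0$, $Z_jZ_k=0$ ($1\le j\neq k\le4$) in $\mathbb{C}^5\setminus\{Z_5=0\}$ with $p_1=p_3=\prod_{s\in\mathfrak{S}_1}(\lambda-s)$, $p_2=p_4=\prod_{s\in\mathfrak{S}_2}(\lambda-s)$; it is a partial desingularisation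 of $X_\Delta$ with the same five components. $\mathcal{L}(E)$ is the direct image on $X_\Delta$ of the line bundle $\mathcal{O}_{X_E}(D_E)$ (so $\mathcal{L}(E)=\mathcal{O}_{X_\Delta}(D_E)$ if $E$ avoids $\mathfrak{S}_\Delta$). $\mathcal{S}(\Gamma,\beta_0)$ is the set of all triples $(X_\Delta,\lambda,\mathcal{L}(E))$, $E\in\mathcal{E}_\Delta$, over all such $\Delta$. **Spectral data of $f$.** With $\Delta=\Delta_f$, there is a unique $\mathbb{C}^4$-valued $x(\lambda,z)$, polynomial in $\lambda$ with coefficients smooth in $z\in\mathbb{C}$, satisfying $dx+\frac\pi2(\lambda^{-1}\bar\beta_0dz+\lambda\beta_0d\bar z)Jx=p_\Delta(\lambda)e^{-J\beta/2}(f_zdz+\lambda f_{\bar z}d\bar z)$; it has degree at most $N_\Delta$ in $\lambda$ and vanishes at $\lambda=0$. Write $x=\sum_k\chi_kv_k$. Let $E$ be the degree $N_\Delta-1$ divisor on $\hat{\mathbb{C}}\simeq C_1$ of zeroes of $\lambda^{-1}\chi_1(\lambda,0)$, regarded as a polynomial of formal degree $N_\Delta-1$ (so $\infty$ is counted with multiplicity $N_\Delta-1$ minus its degree). The spectral data of $f$ is $(X_{\Delta_f},\lambda,\mathcal{L}(E))$. **Coordinates and hyperplanes.** $\Phi(X_\Delta,\lambda,\mathcal{L}(E))=[h(s_1),\dots,h(s_N)]$, where $h$ is the polynomial (unique up to scale) of formal degree $N-1$ with zero divisor $E+\sum_{s_j\notin\mathfrak{S}_\Delta}s_j$ on $\hat{\mathbb{C}}$.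 $\Theta_\infty=\{[t]:\sum_{j=1}^N(\prod_{m\ne j}\frac1{s_m-s_j})t_j=0\}$ and $\Theta_0=\{[t]:\sum_{j=1}^N(\prod_{m\ne j}\frac1{s_m-s_j})\frac{t_j}{s_j}=0\}$. *)

theory Defs
  imports
    "HOL-Analysis.Analysis"
    "HOL-Computational_Algebra.Polynomial_Factorial"
    "HOL-Library.Multiset"
begin

section \<open>Linear algebra on R^4 and C^4\<close>

text \<open>
  \<open>J\<close> and \<open>L\<close> are polymorphic in the scalars, so that the instance at \<^typ>\<open>complex\<close> is the complex
  linear extension of the instance at \<^typ>\<open>real\<close>.
\<close>

definition Jop :: "'a::ring_1 ^ 4 \<Rightarrow> 'a ^ 4"
  where "Jop w = vector [- w$2, w$1, - w$4, w$3]"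

definition Lop :: "'a::ring_1 ^ 4 \<Rightarrow> 'a ^ 4"
  where "Lop w = vector [- w$3, w$4, w$1, - w$2]"

text \<open>The exponential \<open>e\<^bsup>tJ\<^esup> w\<close>, as a power series.\<close>

definition expJ :: "real \<Rightarrow> 'a::real_normed_field ^ 4 \<Rightarrow> 'a ^ 4"
  where "expJ t w = (\<Sum>n. (t ^ n / fact n) *\<^sub>R (Jop ^^ n) w)"

definition eps :: "4 \<Rightarrow> complex ^ 4"
  where "eps k = axis k 1"

definition v1 :: "complex ^ 4" where "v1 = complex_of_real (1 / sqrt 2) *s (eps 1 - \<i> *s eps 2)"
definition v2 :: "complex ^ 4" where "v2 = complex_of_real (1 / sqrt 2) *s (eps 3 - \<i> *s eps 4)"
definition v3 :: "complex ^ 4" where "v3 = (\<chi> i. cnj (v1 $ i))"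
definition v4 :: "complex ^ 4" where "v4 = (\<chi> i. cnj (v2 $ i))"

text \<open>The line spanned by \<open>v\<close>, for an arbitrary scalar multiplication.\<close>

definition line :: "(complex \<Rightarrow> 'v \<Rightarrow> 'v) \<Rightarrow> 'v \<Rightarrow> 'v set"
  where "line sc v = range (\<lambda>c. sc c v)"

definition G0 :: "(real ^ 4 ^ 4) set"
  where "G0 = {g. rotation_matrix g \<and> (\<forall>w. g *v Jop w = Jop (g *v w))
                  \<and> (\<forall>w. g *v Lop w = Lop (g *v w))}"

definition complexify_matrix :: "real ^ 4 ^ 4 \<Rightarrow> complex ^ 4 ^ 4"
  where "complexify_matrix g = (\<chi> i j. complex_of_real (g $ i $ j))"

definition T0 :: "(real ^ 4 ^ 4) set"
  where "T0 = {g \<in> G0. (\<lambda>w. complexify_matrix g *v w) ` line (*s) v1 = line (*s) v1}"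


section \<open>Smooth maps and Wirtinger derivatives\<close>

primrec Ck_on :: "nat \<Rightarrow> 'a::euclidean_space set \<Rightarrow> ('a \<Rightarrow> 'b::euclidean_space) \<Rightarrow> bool"
  where
    "Ck_on 0 U f \<longleftrightarrow> continuous_on U f"
  | "Ck_on (Suc n) U f \<longleftrightarrow>
       (\<forall>x\<in>U. f differentiable at x) \<and> (\<forall>v. Ck_on n U (\<lambda>x. frechet_derivative f (at x) v))"

definition smooth_on :: "'a::euclidean_space set \<Rightarrow> ('a \<Rightarrow> 'b::euclidean_space) \<Rightarrow> bool"
  where "smooth_on U f \<longleftrightarrow> open U \<and> (\<forall>n. Ck_on n U f)"

definition complexify :: "(complex \<Rightarrow> real ^ 4) \<Rightarrow> complex \<Rightarrow> complex ^ 4"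
  where "complexify f z = (\<chi> i. complex_of_real (f z $ i))"

definition d_z :: "(complex \<Rightarrow> real ^ 4) \<Rightarrow> complex \<Rightarrow> complex ^ 4"
  where "d_z f z = (1/2) *s (frechet_derivative (complexify f) (at z) 1
                             - \<i> *s frechet_derivative (complexify f) (at z) \<i>)"

definition d_zbar :: "(complex \<Rightarrow> real ^ 4) \<Rightarrow> complex \<Rightarrow> complex ^ 4"
  where "d_zbar f z = (1/2) *s (frechet_derivative (complexify f) (at z) 1
                                + \<i> *s frechet_derivative (complexify f) (at z) \<i>)"


section \<open>Lattices and frequencies\<close>

definition lattice_basis :: "complex set \<Rightarrow> complex \<Rightarrow> complex \<Rightarrow> bool"
  where "lattice_basis \<Gamma> w1 w2 \<longleftrightarrow> w1 \<noteq> w2 \<and> independent {w1, w2}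
           \<and> \<Gamma> = {of_int m * w1 + of_int n * w2 | m n. True}"

definition is_lattice :: "complex set \<Rightarrow> bool"
  where "is_lattice \<Gamma> \<longleftrightarrow> (\<exists>w1 w2. lattice_basis \<Gamma> w1 w2)"

text \<open>The inner product of \<^typ>\<open>complex\<close> as a real inner product space is \<open>Re (z * cnj w)\<close>.\<close>

definition dual_lattice :: "complex set \<Rightarrow> complex set"
  where "dual_lattice \<Gamma> = {\<gamma>. \<forall>z\<in>\<Gamma>. \<gamma> \<bullet> z \<in> \<int>}"

definition echar :: "complex \<Rightarrow> complex \<Rightarrow> complex"
  where "echar \<gamma> z = exp (2 * pi * \<i> * complex_of_real (\<gamma> \<bullet> z))"

definition beta :: "complex \<Rightarrow> complex \<Rightarrow> real"
  where "beta \<beta>0 z = 2 * pi * (\<beta>0 \<bullet> z)"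

definition freqs :: "complex set \<Rightarrow> complex \<Rightarrow> complex set"
  where "freqs \<Gamma> \<beta>0 = {\<gamma>. (\<exists>\<delta>\<in>dual_lattice \<Gamma>. \<gamma> = \<delta> + \<beta>0 / 2) \<and> cmod \<gamma> = cmod \<beta>0 / 2
                        \<and> \<gamma> \<noteq> \<beta>0 / 2 \<and> \<gamma> \<noteq> - (\<beta>0 / 2)}"

definition node :: "complex \<Rightarrow> complex \<Rightarrow> complex"
  where "node \<beta>0 \<gamma> = 2 * \<gamma> / \<beta>0"


section \<open>Hamiltonian stationary Lagrangian tori\<close>

text \<open>Maps on the torus \<open>\<complex>/\<Gamma>\<close> are represented by their \<open>\<Gamma>\<close>-periodic lifts to \<open>\<complex>\<close>.\<close>

definition HSL :: "complex set \<Rightarrow> complex \<Rightarrow> (complex \<Rightarrow> real ^ 4) set"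
  where "HSL \<Gamma> \<beta>0 = {f. smooth_on UNIV f \<and> (\<forall>z. \<forall>\<omega>\<in>\<Gamma>. f (z + \<omega>) = f z)
            \<and> \<not> (\<exists>c. \<forall>z. f z = c) \<and> f 0 = 0
            \<and> (\<forall>z. expJ (beta \<beta>0 z) (Lop (d_z f z)) = \<i> *s d_z f z)}"

definition rebase :: "complex \<Rightarrow> complex \<Rightarrow> (complex \<Rightarrow> real ^ 4) \<Rightarrow> complex \<Rightarrow> real ^ 4"
  where "rebase \<beta>0 p f z = expJ (- beta \<beta>0 p / 2) (f (z + p) - f p)"

definition HSL_equiv :: "complex set \<Rightarrow> complex \<Rightarrow> ((complex \<Rightarrow> real ^ 4) \<times> (complex \<Rightarrow> real ^ 4)) set"
  where "HSL_equiv \<Gamma> \<beta>0 = {(f, g). f \<in> HSL \<Gamma> \<beta>0 \<and> g \<in> HSL \<Gamma> \<beta>0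
            \<and> (\<exists>c>0. \<exists>T\<in>T0. \<forall>z. g z = c *\<^sub>R (T *v f z))}"

definition u_of :: "complex \<Rightarrow> (complex \<Rightarrow> real ^ 4) \<Rightarrow> complex \<Rightarrow> complex ^ 4"
  where "u_of \<beta>0 f z = expJ (- beta \<beta>0 z / 2) (d_z f z)"

text \<open>
  The mean of \<open>u e\<^sub>-\<^sub>\<gamma>\<close> over a period parallelogram. For \<open>\<gamma> \<in> \<Gamma>\<^sup>* + \<beta>\<^sub>0/2\<close> this product is
  \<open>\<Gamma>\<close>-periodic when \<open>u\<close> is as above (each factor only up to a common sign), so the chosen basis
  is irrelevant.
\<close>

definition fourier_coeff :: "complex set \<Rightarrow> (complex \<Rightarrow> complex ^ 4) \<Rightarrow> complex \<Rightarrow> complex ^ 4"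
  where "fourier_coeff \<Gamma> u \<gamma> =
    (let (w1, w2) = (SOME w. lattice_basis \<Gamma> (fst w) (snd w))
     in integral (cbox (0, 0) (1, 1))
          (\<lambda>(a, b). let z = complex_of_real a * w1 + complex_of_real b * w2
                    in echar (- \<gamma>) z *s u z))"

definition Delta_of :: "complex set \<Rightarrow> complex \<Rightarrow> (complex \<Rightarrow> real ^ 4) \<Rightarrow> complex set"
  where "Delta_of \<Gamma> \<beta>0 f = {\<gamma> \<in> freqs \<Gamma> \<beta>0. fourier_coeff \<Gamma> (u_of \<beta>0 f) \<gamma> \<noteq> 0}"


section \<open>The Riemann sphere, effective divisors\<close>

datatype csphere = Fin complex | Infty

text \<open>
  Effective divisors are multisets: the degree is \<^const>\<open>size\<close> and the support is \<^const>\<open>set_mset\<close>.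
  \<open>div_of d h\<close> is the zero divisor of a non-zero polynomial \<open>h\<close> of formal degree \<open>d\<close>.
\<close>

definition div_of :: "nat \<Rightarrow> complex poly \<Rightarrow> csphere multiset"
  where "div_of d h = (\<Sum>a\<in>{a. poly h a = 0}. replicate_mset (order a h) (Fin a))
                      + replicate_mset (d - degree h) Infty"

primrec reflect :: "csphere \<Rightarrow> csphere"
  where
    "reflect (Fin a) = (if a = 0 then Infty else Fin (inverse (cnj a)))"
  | "reflect Infty = Fin 0"

primrec neg :: "csphere \<Rightarrow> csphere"
  where
    "neg (Fin a) = Fin (- a)"
  | "neg Infty = Infty"


section \<open>The curves\<close>

text \<open>
  \<open>Aff Z\<close> is a point of the affine part; \<open>PtZero k\<close> and \<open>PtInf k\<close> are the smooth points of the
  component \<open>C\<^sub>k\<close> added over \<open>\<lambda> = 0\<close> and \<open>\<lambda> = \<infinity>\<close>. Note that the index type \<^typ>\<open>5\<close> has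
  exactly the elements \<open>1, 2, 3, 4, 5\<close> (with \<open>5 = 0\<close>).
\<close>

datatype curve_pt = Aff "complex ^ 5" | PtZero 5 | PtInf 5

text \<open>
  A family \<open>q\<close> of four polynomials (\<open>q 5\<close> is not used) gives the curve
  \<open>Z\<^sub>j (Z\<^sub>j - q\<^sub>j(Z\<^sub>5)) = 0\<close>, \<open>Z\<^sub>j Z\<^sub>k = 0\<close>, completed by smooth points.
\<close>

definition affine_curve :: "(5 \<Rightarrow> complex poly) \<Rightarrow> (complex ^ 5) set"
  where "affine_curve q = {Z. Z$5 \<noteq> 0
            \<and> (\<forall>j. j \<noteq> 5 \<longrightarrow> Z$j * (Z$j - poly (q j) (Z$5)) = 0)
            \<and> (\<forall>j k. j \<noteq> 5 \<and> k \<noteq> 5 \<and> j \<noteq> k \<longrightarrow> Z$j * Z$k = 0)}"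

definition curve :: "(5 \<Rightarrow> complex poly) \<Rightarrow> curve_pt set"
  where "curve q = Aff ` affine_curve q \<union> range PtZero \<union> range PtInf"

primrec lambda :: "curve_pt \<Rightarrow> csphere"
  where
    "lambda (Aff Z) = Fin (Z$5)"
  | "lambda (PtZero k) = Fin 0"
  | "lambda (PtInf k) = Infty"

definition param :: "(5 \<Rightarrow> complex poly) \<Rightarrow> 5 \<Rightarrow> complex \<Rightarrow> complex ^ 5"
  where "param q k a = (\<chi> j. if j = 5 then a else if j = k then poly (q k) a else 0)"

text \<open>\<open>on_comp q k a\<close> is the point of the component \<open>C\<^sub>k\<close> over \<open>\<lambda> = a\<close>.\<close>

primrec on_comp :: "(5 \<Rightarrow> complex poly) \<Rightarrow> 5 \<Rightarrow> csphere \<Rightarrow> curve_pt"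
  where
    "on_comp q k (Fin a) = (if a = 0 then PtZero k else Aff (param q k a))"
  | "on_comp q k Infty = PtInf k"

definition curve_comp :: "(5 \<Rightarrow> complex poly) \<Rightarrow> 5 \<Rightarrow> curve_pt set"
  where "curve_comp q k = range (on_comp q k)"

text \<open>Zariski topology: a set is closed iff it meets each component in a finite set or contains it.\<close>

definition zopen :: "(5 \<Rightarrow> complex poly) \<Rightarrow> curve_pt set \<Rightarrow> bool"
  where "zopen q U \<longleftrightarrow> U \<subseteq> curve q \<and> (\<forall>k. curve_comp q k \<inter> U = {} \<or> finite (curve_comp q k - U))"


section \<open>Sheaves on the curves\<close>

text \<open>
  As \<open>\<lambda>\<close> identifies each component with the Riemann sphere, a rational function on the curve is a
  5-tuple of elements of \<open>\<complex>(\<lambda>)\<close>.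
\<close>

type_synonym ratfun = "(complex poly fract) ^ 5"
type_synonym sheaf = "curve_pt set \<Rightarrow> ratfun set"

text \<open>
  The restrictions to the components (parametrised by \<open>\<lambda>\<close>) of the polynomials in
  \<open>Z\<^sub>1, \<dots>, Z\<^sub>5\<close>.
\<close>

inductive_set coord_ring :: "(5 \<Rightarrow> complex poly) \<Rightarrow> ((complex poly) ^ 5) set"
  for q :: "5 \<Rightarrow> complex poly"
  where
    const: "(\<chi> k. [:c:]) \<in> coord_ring q"
  | coord5: "(\<chi> k. [:0, 1:]) \<in> coord_ring q"
  | coord: "j \<noteq> 5 \<Longrightarrow> (\<chi> k. if k = j then q j else 0) \<in> coord_ring q"
  | add: "P \<in> coord_ring q \<Longrightarrow> Q \<in> coord_ring q \<Longrightarrow> P + Q \<in> coord_ring q"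
  | mult: "P \<in> coord_ring q \<Longrightarrow> Q \<in> coord_ring q \<Longrightarrow> P * Q \<in> coord_ring q"

text \<open>
  \<open>regular_at q y\<close> is the set of rational functions which are regular at \<open>y\<close>. At an affine point
  these are the fractions \<open>P/Q\<close> with \<open>Q(y) \<noteq> 0\<close>. Components not passing through \<open>y\<close> impose
  no condition: multiply \<open>P\<close> and \<open>Q\<close> by a polynomial vanishing on them and not at \<open>y\<close>.
\<close>

primrec regular_at :: "(5 \<Rightarrow> complex poly) \<Rightarrow> curve_pt \<Rightarrow> ratfun set"
  where
    "regular_at q (Aff Z) = {g. \<exists>P\<in>coord_ring q. \<exists>Q\<in>coord_ring q.
        (\<forall>k a. param q k a = Z \<longrightarrow> poly (Q$k) a \<noteq> 0)
        \<and> (\<forall>k. to_fract (Q$k) * g$k = to_fract (P$k))}"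
  | "regular_at q (PtZero k) = {g. \<exists>n d. poly d 0 \<noteq> 0 \<and> to_fract d * g$k = to_fract n}"
  | "regular_at q (PtInf k) =
       {g. \<exists>n d. d \<noteq> 0 \<and> degree n \<le> degree d \<and> to_fract d * g$k = to_fract n}"

primrec unif :: "csphere \<Rightarrow> complex poly fract"
  where
    "unif (Fin a) = to_fract [:- a, 1:]"
  | "unif Infty = inverse (to_fract [:0, 1:])"

text \<open>
  Sections over \<open>U\<close> of the line bundle \<open>O(D)\<close>, for an effective divisor \<open>D\<close> supported in smooth
  points; \<open>\<lambda>\<close> is a local parameter at every smooth point, so a section at \<open>y\<close> is a rational function
  which becomes regular on multiplication by the power \<open>D(y)\<close> of the parameter. Components which
  do not meet \<open>U\<close> are set to zero.
\<close>

definition sections :: "(5 \<Rightarrow> complex poly) \<Rightarrow> curve_pt multiset \<Rightarrow> sheaf"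
  where "sections q D U = {g. (\<forall>k. curve_comp q k \<inter> U = {} \<longrightarrow> g$k = 0)
            \<and> (\<forall>y\<in>U. (\<chi> k. unif (lambda y) ^ count D y * g$k) \<in> regular_at q y)}"

definition structure_sheaf :: "(5 \<Rightarrow> complex poly) \<Rightarrow> sheaf"
  where "structure_sheaf q = sections q {#}"

definition restr :: "(5 \<Rightarrow> complex poly) \<Rightarrow> curve_pt set \<Rightarrow> ratfun \<Rightarrow> ratfun"
  where "restr q V g = (\<chi> k. if curve_comp q k \<inter> V = {} then 0 else g$k)"

text \<open>Isomorphism of sheaves of modules over the structure sheaf of the curve of \<open>q\<close>.\<close>

definition sheaf_iso :: "(5 \<Rightarrow> complex poly) \<Rightarrow> sheaf \<Rightarrow> sheaf \<Rightarrow> bool"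
  where "sheaf_iso q F G \<longleftrightarrow> (\<exists>\<phi> :: curve_pt set \<Rightarrow> ratfun \<Rightarrow> ratfun. \<forall>U. zopen q U \<longrightarrow>
            bij_betw (\<phi> U) (F U) (G U)
            \<and> (\<forall>g\<in>F U. \<forall>h\<in>F U. \<phi> U (g + h) = \<phi> U g + \<phi> U h)
            \<and> (\<forall>r\<in>structure_sheaf q U. \<forall>g\<in>F U. \<phi> U (r * g) = r * \<phi> U g)
            \<and> (\<forall>V. zopen q V \<and> V \<subseteq> U \<longrightarrow> (\<forall>g\<in>F U. \<phi> V (restr q V g) = restr q V (\<phi> U g))))"

definition iso_class :: "(5 \<Rightarrow> complex poly) \<Rightarrow> sheaf \<Rightarrow> sheaf set"
  where "iso_class q F = {G. sheaf_iso q F G}"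

text \<open>
  Direct image under the partial desingularisation from the curve of \<open>q'\<close> to the curve of \<open>q\<close>
  which is the identity, in terms of \<open>\<lambda>\<close>, on each of the five components.
\<close>

definition direct_image ::
    "(5 \<Rightarrow> complex poly) \<Rightarrow> (5 \<Rightarrow> complex poly) \<Rightarrow> sheaf \<Rightarrow> sheaf"
  where "direct_image q q' F U = F {on_comp q' k a | k a. on_comp q k a \<in> U}"


section \<open>Spectral triples\<close>

definition nodes :: "complex \<Rightarrow> complex set \<Rightarrow> complex set"
  where "nodes \<beta>0 \<Delta> = node \<beta>0 ` \<Delta>"

definition node_poly :: "complex set \<Rightarrow> complex poly"
  where "node_poly S = (\<Prod>s\<in>S. [:- s, 1:])"

definition admissible :: "complex set \<Rightarrow> complex \<Rightarrow> complex set \<Rightarrow> bool"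
  where "admissible \<Gamma> \<beta>0 \<Delta> \<longleftrightarrow> \<Delta> \<noteq> {} \<and> \<Delta> \<subseteq> freqs \<Gamma> \<beta>0 \<and> uminus ` \<Delta> = \<Delta>"

definition X_fam :: "complex \<Rightarrow> complex set \<Rightarrow> 5 \<Rightarrow> complex poly"
  where "X_fam \<beta>0 \<Delta> = (\<lambda>k. node_poly (nodes \<beta>0 \<Delta>))"

definition eff_divs :: "complex \<Rightarrow> complex set \<Rightarrow> csphere multiset set"
  where "eff_divs \<beta>0 \<Delta> = {E. size E = card \<Delta> - 1
            \<and> (\<forall>s\<in>nodes \<beta>0 \<Delta>. Fin s \<in># E \<longrightarrow> Fin (- s) \<notin># E)}"

definition S1 :: "complex \<Rightarrow> complex set \<Rightarrow> csphere multiset \<Rightarrow> complex set"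
  where "S1 \<beta>0 \<Delta> E = {s \<in> nodes \<beta>0 \<Delta>. Fin s \<notin># E}"

definition XE_fam :: "complex \<Rightarrow> complex set \<Rightarrow> csphere multiset \<Rightarrow> 5 \<Rightarrow> complex poly"
  where "XE_fam \<beta>0 \<Delta> E = (\<lambda>k. if k = 1 \<or> k = 3 then node_poly (S1 \<beta>0 \<Delta> E)
                               else node_poly (uminus ` S1 \<beta>0 \<Delta> E))"

text \<open>
  \<open>\<rho>\<close> and \<open>\<tau>\<close> as maps of pairs (component, value of \<open>\<lambda>\<close>). They are commuting involutions, hence
  pulling back a divisor along them is the same as taking the image.
\<close>

definition rho :: "5 \<times> csphere \<Rightarrow> 5 \<times> csphere"
  where "rho = map_prod
    (\<lambda>k. if k = 1 then 3 else if k = 3 then 1 else if k = 2 then 4 else if k = 4 then 2 else 5)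
    reflect"

definition tau :: "5 \<times> csphere \<Rightarrow> 5 \<times> csphere"
  where "tau = map_prod
    (\<lambda>k. if k = 1 then 4 else if k = 4 then 1 else if k = 2 then 3 else if k = 3 then 2 else 5)
    neg"

definition E_prime :: "complex \<Rightarrow> complex set \<Rightarrow> csphere multiset \<Rightarrow> csphere multiset"
  where "E_prime \<beta>0 \<Delta> E = E - mset_set (Fin ` {s \<in> nodes \<beta>0 \<Delta>. Fin s \<in># E})"

definition D_div :: "complex \<Rightarrow> complex set \<Rightarrow> csphere multiset \<Rightarrow> curve_pt multiset"
  where "D_div \<beta>0 \<Delta> E =
    (let E' = image_mset (Pair 1) (E_prime \<beta>0 \<Delta> E)
     in image_mset (\<lambda>(k, a). on_comp (XE_fam \<beta>0 \<Delta> E) k a)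
          (E' + image_mset rho E' + image_mset tau E' + image_mset (rho \<circ> tau) E')
        + mset_set (PtZero ` {1, 2, 3, 4}))"

definition L_sheaf :: "complex \<Rightarrow> complex set \<Rightarrow> csphere multiset \<Rightarrow> sheaf"
  where "L_sheaf \<beta>0 \<Delta> E =
    direct_image (X_fam \<beta>0 \<Delta>) (XE_fam \<beta>0 \<Delta> E) (sections (XE_fam \<beta>0 \<Delta> E) (D_div \<beta>0 \<Delta> E))"

text \<open>
  A triple consists of the curve (points and structure sheaf), the function \<open>\<lambda>\<close> on it and
  the isomorphism class of a sheaf on it.
\<close>

type_synonym spectral_triple =
  "(curve_pt set \<times> sheaf) \<times> (curve_pt \<Rightarrow> csphere) \<times> sheaf set"

definition triple :: "complex \<Rightarrow> complex set \<Rightarrow> csphere multiset \<Rightarrow> spectral_triple"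
  where "triple \<beta>0 \<Delta> E =
    (let q = X_fam \<beta>0 \<Delta>
     in ((curve q, structure_sheaf q), restrict lambda (curve q), iso_class q (L_sheaf \<beta>0 \<Delta> E)))"

definition spectral_triples :: "complex set \<Rightarrow> complex \<Rightarrow> spectral_triple set"
  where "spectral_triples \<Gamma> \<beta>0 = {triple \<beta>0 \<Delta> E | \<Delta> E. admissible \<Gamma> \<beta>0 \<Delta> \<and> E \<in> eff_divs \<beta>0 \<Delta>}"


section \<open>Spectral data of an immersion\<close>

text \<open>The equation between one-forms is evaluated on an arbitrary tangent vector \<open>v\<close>: \<open>dz(v) = v\<close>.\<close>

definition is_x ::
    "complex set \<Rightarrow> complex \<Rightarrow> (complex \<Rightarrow> real ^ 4) \<Rightarrow> (complex \<Rightarrow> complex \<Rightarrow> complex ^ 4) \<Rightarrow> bool"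
  where "is_x \<Gamma> \<beta>0 f x \<longleftrightarrow>
    (\<exists>d. \<exists>c :: nat \<Rightarrow> complex \<Rightarrow> complex ^ 4. (\<forall>k\<le>d. smooth_on UNIV (c k))
        \<and> (\<forall>l z. x l z = (\<Sum>k\<le>d. l ^ k *s c k z)))
    \<and> (\<forall>l z. l \<noteq> 0 \<longrightarrow> (\<exists>x'. (x l has_derivative x') (at z)
        \<and> (\<forall>v. x' v + (pi / 2 * (inverse l * cnj \<beta>0 * v + l * \<beta>0 * cnj v)) *s Jop (x l z)
               = poly (node_poly (nodes \<beta>0 (Delta_of \<Gamma> \<beta>0 f))) l
                   *s expJ (- beta \<beta>0 z / 2) (v *s d_z f z + (l * cnj v) *s d_zbar f z))))"

definition x_of :: "complex set \<Rightarrow> complex \<Rightarrow> (complex \<Rightarrow> real ^ 4) \<Rightarrow> complex \<Rightarrow> complex \<Rightarrow> complex ^ 4"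
  where "x_of \<Gamma> \<beta>0 f = (THE x. is_x \<Gamma> \<beta>0 f x)"

text \<open>The polynomial \<open>\<lambda>\<^sup>-\<^sup>1 \<chi>\<^sub>1(\<lambda>, 0)\<close>.\<close>

definition chi1_poly :: "complex set \<Rightarrow> complex \<Rightarrow> (complex \<Rightarrow> real ^ 4) \<Rightarrow> complex poly"
  where "chi1_poly \<Gamma> \<beta>0 f = (THE h. \<forall>l. \<exists>c2 c3 c4.
            x_of \<Gamma> \<beta>0 f l 0 = (l * poly h l) *s v1 + c2 *s v2 + c3 *s v3 + c4 *s v4)"

definition spectral_data :: "complex set \<Rightarrow> complex \<Rightarrow> (complex \<Rightarrow> real ^ 4) \<Rightarrow> spectral_triple"
  where "spectral_data \<Gamma> \<beta>0 f =
    (let \<Delta> = Delta_of \<Gamma> \<beta>0 f in triple \<beta>0 \<Delta> (div_of (card \<Delta> - 1) (chi1_poly \<Gamma> \<beta>0 f)))"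


section \<open>Projective spaces and the map Phi\<close>

text \<open>The projective space of a complex vector space \<open>V\<close> is its set of lines.\<close>

definition proj_space :: "(complex \<Rightarrow> 'v \<Rightarrow> 'v) \<Rightarrow> 'v::zero set \<Rightarrow> 'v set set"
  where "proj_space sc V = line sc ` (V - {0})"

abbreviation CP :: "(complex ^ 'n) set set"
  where "CP \<equiv> proj_space (*s) UNIV"

text \<open>
  Isomorphisms between projective spaces are the maps induced by linear isomorphisms (the algebraic
  isomorphisms are of this form).
\<close>

definition proj_isomorphism ::
    "(complex \<Rightarrow> 'v::ab_group_add \<Rightarrow> 'v) \<Rightarrow> 'v set \<Rightarrow> (complex \<Rightarrow> 'w::ab_group_add \<Rightarrow> 'w) \<Rightarrow> 'w set
       \<Rightarrow> ('v set \<Rightarrow> 'w set) \<Rightarrow> bool"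
  where "proj_isomorphism scV V scW W F \<longleftrightarrow> (\<exists>A. bij_betw A V W
            \<and> (\<forall>v\<in>V. \<forall>w\<in>V. A (v + w) = A v + A w) \<and> (\<forall>c. \<forall>v\<in>V. A (scV c v) = scW c (A v))
            \<and> (\<forall>v\<in>V - {0}. F (line scV v) = line scW (A v)))"

text \<open>The divisor \<open>E + \<Sum> s\<^sub>j\<close>, sum over the \<open>s\<^sub>j \<notin> \<SS>\<^sub>\<Delta>\<close>, of a spectral triple.\<close>

definition total_div :: "complex set \<Rightarrow> complex \<Rightarrow> spectral_triple \<Rightarrow> csphere multiset"
  where "total_div \<Gamma> \<beta>0 \<sigma> = (THE D. \<exists>\<Delta> E. admissible \<Gamma> \<beta>0 \<Delta> \<and> E \<in> eff_divs \<beta>0 \<Delta>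
            \<and> \<sigma> = triple \<beta>0 \<Delta> E
            \<and> D = E + mset_set (Fin ` (nodes \<beta>0 (freqs \<Gamma> \<beta>0) - nodes \<beta>0 \<Delta>)))"

text \<open>
  Polynomials of formal degree \<open>N - 1\<close>, and the line in this space which consists of zero and the
  polynomials with zero divisor \<^term>\<open>total_div \<Gamma> \<beta>0 \<sigma>\<close>.
\<close>

definition polys :: "complex set \<Rightarrow> complex \<Rightarrow> complex poly set"
  where "polys \<Gamma> \<beta>0 = {h. degree h \<le> card (freqs \<Gamma> \<beta>0) - 1}"

definition poly_line :: "complex set \<Rightarrow> complex \<Rightarrow> spectral_triple \<Rightarrow> complex poly set"
  where "poly_line \<Gamma> \<beta>0 \<sigma> = {h \<in> polys \<Gamma> \<beta>0. h = 0
            \<or> div_of (card (freqs \<Gamma> \<beta>0) - 1) h = total_div \<Gamma> \<beta>0 \<sigma>}"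

text \<open>
  From here on \<open>\<gamma>\<close> is an enumeration of the set of frequencies by a finite index type \<open>'n\<close>, and
  \<open>s\<^sub>j\<close> is \<^term>\<open>node \<beta>0 (\<gamma> j)\<close>.
\<close>

definition Phi ::
    "complex set \<Rightarrow> complex \<Rightarrow> ('n \<Rightarrow> complex) \<Rightarrow> spectral_triple \<Rightarrow> (complex ^ 'n) set"
  where "Phi \<Gamma> \<beta>0 \<gamma> \<sigma> = (THE P. \<exists>h\<in>poly_line \<Gamma> \<beta>0 \<sigma> - {0}.
            P = line (*s) (\<chi> j. poly h (node \<beta>0 (\<gamma> j))))"

definition Theta_inf :: "complex \<Rightarrow> ('n::finite \<Rightarrow> complex) \<Rightarrow> (complex ^ 'n) set set"
  where "Theta_inf \<beta>0 \<gamma> = {line (*s) t | t. t \<noteq> 0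
            \<and> (\<Sum>j\<in>UNIV. (\<Prod>m\<in>UNIV - {j}. 1 / (node \<beta>0 (\<gamma> m) - node \<beta>0 (\<gamma> j))) * t$j) = 0}"

definition Theta_zero :: "complex \<Rightarrow> ('n::finite \<Rightarrow> complex) \<Rightarrow> (complex ^ 'n) set set"
  where "Theta_zero \<beta>0 \<gamma> = {line (*s) t | t. t \<noteq> 0
            \<and> (\<Sum>j\<in>UNIV. (\<Prod>m\<in>UNIV - {j}. 1 / (node \<beta>0 (\<gamma> m) - node \<beta>0 (\<gamma> j)))
                          * (t$j / node \<beta>0 (\<gamma> j))) = 0}"

text \<open>
  Smoothness of a map from \<open>\<complex> \<times> CP\<close> to \<open>CP\<close>, by way of smooth local lifts to homogeneous coordinates
  (the projection to \<open>CP\<close> from the space of non-zero vectors is a surjective submersion).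
\<close>

definition smooth_proj_family :: "(complex \<Rightarrow> (complex ^ 'n) set \<Rightarrow> (complex ^ 'n) set) \<Rightarrow> bool"
  where "smooth_proj_family F \<longleftrightarrow> (\<forall>p t. t \<noteq> 0 \<longrightarrow>
            (\<exists>U. \<exists>H :: complex \<times> (complex ^ 'n) \<Rightarrow> complex ^ 'n. (p, t) \<in> U \<and> smooth_on U H
               \<and> (\<forall>(p', t')\<in>U. t' \<noteq> 0 \<and> H (p', t') \<noteq> 0
                     \<and> F p' (line (*s) t') = line (*s) (H (p', t')))))"

end

theory Submission
  imports
    Defs
    "HOL-Computational_Algebra.Fundamental_Theorem_Algebra"
begin

text \<open>
  Identify \<open>\<real>\<^sup>4\<close> with \<open>\<complex>\<^sup>2\<close> and write \<open>f = (P, Q)\<close>. The HSL condition becomes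
  \<open>Q\<^bsub>zbar\<^esub> = i e\<^bsub>\<beta>0\<^esub> cnj P\<^sub>z\<close>, \<open>Q\<^sub>z = - i e\<^bsub>\<beta>0\<^esub> cnj P\<^bsub>zbar\<^esub>\<close>. Comparing Fourier coefficients, only the modes
  \<open>g + \<beta>0/2\<close> of \<open>P\<close> with \<open>g \<in> \<Gamma>\<^sup>*\<^bsub>\<beta>0\<^esub>\<close> survive, their coefficients \<open>a g\<close> are arbitrary, and they determine
  \<open>Q\<close> and the frequencies \<open>\<Delta>\<^sub>f = {g. a g \<noteq> 0 \<or> a (- g) \<noteq> 0}\<close>. Dilations and \<open>T\<^sub>0\<close> rescale \<open>a\<close> by a
  complex number, and moving the base point to \<open>p\<close> multiplies \<open>a g\<close> by \<open>e\<^sub>g(p)\<close>.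

  The equation for \<open>x\<close> is solved mode by mode, and \<open>\<lambda>\<^sup>-\<^sup>1 \<chi>\<^sub>1(\<lambda>, 0)\<close> is a combination of the polynomials
  \<open>\<Prod>\<^bsub>s' \<noteq> - s\<^esub> (\<lambda> - s')\<close> with coefficients proportional to \<open>s a g\<close>, where \<open>s\<close> is the node of \<open>g\<close>. Its
  value at the node \<open>s\<^sub>j\<close>, hence the \<open>j\<close>-th coordinate of \<open>\<Phi>\<close>, is up to a common factor
  \<open>s\<^sub>j \<Prod>\<^bsub>m \<noteq> j\<^esub> (s\<^sub>j - s\<^sub>m) a (- \<gamma>\<^sub>j)\<close>. So \<open>\<Phi>\<close> of the spectral data is a diagonal rescaling of the Fourier
  coefficients, the base point acts by diagonal matrices, and \<open>\<Theta>\<^sub>\<infinity>\<close>, \<open>\<Theta>\<^sub>0\<close> express the vanishing at the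
  base point of \<open>P\<^bsub>zbar\<^esub>\<close> and \<open>P\<^sub>z\<close>.

  The divisor is recovered from the spectral triple as follows. An isomorphism between two of the
  sheaves is multiplication by a tuple of rational functions, read off from the image of the section 1
  over the complement of finitely many fibres of \<open>\<lambda>\<close>. Its component on \<open>C\<^sub>5\<close> is constant, its component
  on \<open>C\<^sub>1\<close> is a quotient of the polynomials of the two divisors, and both agree at the nodes. The degrees
  are less than the number of nodes, so the two polynomials are proportional.
\<close>

section \<open>Isomorphisms of sheaves on the spectral curves\<close>

text \<open>The data are defined by definite descriptions (\<open>x_of\<close>,
  \<open>chi1_poly\<close>, \<open>total_div\<close>, \<open>Phi\<close>), so much of the work is
  uniqueness. The hardest case is \<open>total_div\<close>: a triple holds only an isomorphism class
  of sheaves on X_\<Delta>, and E enters it twice, through D_E and through the partially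
  desingularised curve X_E. The crossings left on X_E must therefore be recovered before divisors
  can be compared. C_5 serves as reference component because D_E has no point on it. Fibres over
  infinity can be discarded: multiplicities there follow from the degree.

  The mode g, with node s, is tied to the node -s because v_1 has J-eigenvalue i, and on that
  eigenspace the equation for x divides by \<lambda> + s; on the other one it divides by \<lambda> -
  s, and p_\<Delta> contains both factors. Hence the j-th coordinate of \<Phi> sees the coefficient
  at -\<gamma>_j. The circle |g| = |\<beta>0|/2 appears because P determines Q twice, through Q_z
  and through Q_zbar, and the two must be compatible.\<close>

lemma coord_ring_iff: "P \<in> coord_ring q \<longleftrightarrow> (\<forall>k. k \<noteq> 5 \<longrightarrow> q k dvd P$k - P$5)"
proof
  assume "P \<in> coord_ring q"
  then show "\<forall>k. k \<noteq> 5 \<longrightarrow> q k dvd P$k - P$5"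
  proof induction
    case (add P Q)
    have "(P + Q)$k - (P + Q)$5 = (P$k - P$5) + (Q$k - Q$5)" for k
      by simp
    with add show ?case by (metis dvd_add)
  next
    case (mult P Q)
    have "(P * Q)$k - (P * Q)$5 = (P$k - P$5) * Q$k + P$5 * (Q$k - Q$5)" for k
      by (simp add: algebra_simps)
    with mult show ?case by (metis dvd_add dvd_mult dvd_mult2)
  qed auto
next
  assume *: "\<forall>k. k \<noteq> 5 \<longrightarrow> q k dvd P$k - P$5"
  then obtain h where h: "\<And>k. k \<noteq> 5 \<Longrightarrow> P$k - P$5 = q k * h k"
    unfolding dvd_def by metis
  have diag: "(\<chi> k. p) \<in> coord_ring q" for p
  proof (induction p)
    case 0 then show ?case using coord_ring.const[of 0 q] by simp
  next
    case (pCons a p)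
    have "(\<chi> k. pCons a p) = (\<chi> k. [:a:]) + (\<chi> k. [:0, 1:]) * (\<chi> k::5. p)"
      by (simp add: vec_eq_iff)
    then show ?case using pCons by (simp add: coord_ring.const coord_ring.coord5
      coord_ring.add coord_ring.mult)
  qed
  have sums: "(\<Sum>j\<in>A. (\<chi> k. if k = j then q j else 0) * (\<chi> k. h j)) \<in> coord_ring q"
    if "5 \<notin> A" "finite A" for A
    using that(2,1)
  proof (induction A)
    case empty then show ?case using diag[of 0] by (simp add: zero_vec_def)
  next
    case (insert j A)
    then show ?case by (auto intro!: coord_ring.add coord_ring.mult coord_ring.coord diag)
  qed
  \<comment> \<open>The diagonal tuple accounts for \<open>P$5\<close>. What remains on C_k is a
    multiple of \<open>q k\<close>, hence of the coordinate Z_k, which vanishes on all other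
    components.\<close>
  have "P = (\<chi> k. P$5) + (\<Sum>j\<in>UNIV - {5}. (\<chi> k. if k = j then q j else 0) * (\<chi> k. h j))"
  proof (subst vec_eq_iff, rule allI)
    fix k :: 5
    have "(\<Sum>j\<in>UNIV - {5}. (if k = j then q j else 0) * h j) = (\<Sum>j\<in>UNIV - {5}. if k = j then q j * h j else 0)"
      by (rule sum.cong) auto
    also have "\<dots> = (if k \<noteq> 5 then q k * h k else 0)"
      by (subst sum.delta') auto
    finally show "P$k = ((\<chi> k. P$5) + (\<Sum>j\<in>UNIV - {5}. (\<chi> k. if k = j then q j else 0) * (\<chi> k. h j)))$k"
      using h[of k] by (auto simp: algebra_simps)
  qed
  then show "P \<in> coord_ring q"
    by (rule ssubst) (intro coord_ring.add diag sums; simp)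
qed

section \<open>Values of rational functions at a point\<close>

text \<open>A relation instead of a function, so that the existence of a value doubles as
  regularity: a rational function with a pole at \<open>a\<close> has none.\<close>

definition value_at :: "complex \<Rightarrow> complex poly fract \<Rightarrow> complex \<Rightarrow> bool"
  where "value_at a r c \<longleftrightarrow> (\<exists>n d. poly d a \<noteq> 0 \<and> to_fract d * r = to_fract n \<and> poly n a = c * poly d a)"

lemma value_at_unique:
  assumes "value_at a r c" "value_at a r c'"
  shows "c = c'"
proof -
  obtain n d n' d' where *: "poly d a \<noteq> 0" "to_fract d * r = to_fract n" "poly n a = c * poly d a"
     "poly d' a \<noteq> 0" "to_fract d' * r = to_fract n'" "poly n' a = c' * poly d' a"
    using assms unfolding value_at_def by blast
  have "to_fract (d' * n) = to_fract (d * n')"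
    unfolding to_fract_mult *(2,5)[symmetric] by (simp add: algebra_simps)
  then have "d' * n = d * n'" by (simp only: to_fract_eq_iff)
  then have "poly (d' * n) a = poly (d * n') a" by simp
  with * show ?thesis by (simp add: algebra_simps)
qed

lemma value_at_mult:
  assumes "value_at a r c" "value_at a r' c'"
  shows "value_at a (r * r') (c * c')"
proof -
  obtain n d n' d' where *: "poly d a \<noteq> 0" "to_fract d * r = to_fract n" "poly n a = c * poly d a"
     "poly d' a \<noteq> 0" "to_fract d' * r' = to_fract n'" "poly n' a = c' * poly d' a"
    using assms unfolding value_at_def by blast
  then show ?thesis unfolding value_at_def
    by (intro exI[of _ "n * n'"] exI[of _ "d * d'"])
       (simp add: to_fract_mult *(2,5)[symmetric] algebra_simps)
qed

lemma value_at_to_fract: "value_at a (to_fract p) (poly p a)"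
  unfolding value_at_def by (intro exI[of _ p] exI[of _ 1]) simp

lemma value_at_inverse:
  assumes "value_at a r c" "c \<noteq> 0"
  shows "value_at a (inverse r) (inverse c)"
proof -
  obtain n d where *: "poly d a \<noteq> 0" "to_fract d * r = to_fract n" "poly n a = c * poly d a"
    using assms unfolding value_at_def by blast
  with assms have "r \<noteq> 0" by (metis mult_eq_0_iff mult_zero_right poly_0 to_fract_eq_0_iff)
  with * assms show ?thesis unfolding value_at_def
    by (intro exI[of _ d] exI[of _ n]) (simp add: *(2)[symmetric] field_simps)
qed

text \<open>Take a denominator of least degree. At a root of it, regularity makes the numerator
  vanish too, and cancelling the common factor would lower the degree; so the denominator has no
  root and is constant.\<close>

lemma regular_everywhere_imp_poly:
  assumes "\<And>a. \<exists>c. value_at a r c"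
  obtains p where "r = to_fract p"
proof -
  obtain x y where "r = Fraction_Field.Fract x y" "y \<noteq> 0" by (cases r)
  then have "to_fract y * r = to_fract x" "y \<noteq> 0" by (simp_all add: Fract_conv_to_fract)
  then have "\<exists>d. d \<noteq> 0 \<and> (\<exists>n. to_fract d * r = to_fract n)" by blast
  then obtain d where d: "d \<noteq> 0 \<and> (\<exists>n. to_fract d * r = to_fract n)"
     and least: "\<And>d'. d' \<noteq> 0 \<and> (\<exists>n. to_fract d' * r = to_fract n) \<Longrightarrow> degree d \<le> degree d'"
    using exists_least_lemma ex_has_least_nat[of "\<lambda>d. d \<noteq> 0 \<and> (\<exists>n. to_fract d * r = to_fract n)" _ degree]
    by metis
  obtain n where n: "to_fract d * r = to_fract n" using d by blast
  have "degree d = 0"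
  proof (rule ccontr)
    assume "degree d \<noteq> 0"
    then obtain a where a: "poly d a = 0"
      using fundamental_theorem_of_algebra[of d] constant_degree[of d] by metis
    obtain c n' d' where *: "poly d' a \<noteq> 0" "to_fract d' * r = to_fract n'"
      using assms[of a] unfolding value_at_def by blast
    have "to_fract (d' * n) = to_fract (d * n')"
      unfolding to_fract_mult n[symmetric] *(2)[symmetric] by (simp add: algebra_simps)
    then have "d' * n = d * n'" by (simp only: to_fract_eq_iff)
    then have "poly (d' * n) a = poly (d * n') a" by simp
    then have "poly n a = 0" using a * by simp
    then obtain n1 where n1: "n = [:- a, 1:] * n1" unfolding poly_eq_0_iff_dvd by (rule dvdE)
    from a obtain d1 where d1: "d = [:- a, 1:] * d1" unfolding poly_eq_0_iff_dvd by (rule dvdE)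
    note nd = n1 d1
    have "to_fract [:- a, 1:] * (to_fract d1 * r) = to_fract [:- a, 1:] * to_fract n1"
      using n unfolding nd to_fract_mult by (simp only: mult.assoc)
    then have "to_fract d1 * r = to_fract n1" by simp
    moreover have "d1 \<noteq> 0" using d nd by auto
    ultimately have "degree d \<le> degree d1" using least by blast
    then show False using \<open>d1 \<noteq> 0\<close> unfolding nd by (subst (asm) degree_mult_eq) auto
  qed
  then obtain c where c: "d = [:c:]" by (metis degree_eq_zeroE)
  with d have "c \<noteq> 0" by auto
  have "to_fract [:c:] * r = to_fract [:c:] * to_fract (smult (inverse c) n)"
    unfolding to_fract_mult[symmetric] using n c \<open>c \<noteq> 0\<close> by simp
  then have "r = to_fract (smult (inverse c) n)" using \<open>c \<noteq> 0\<close> by simp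
  then show ?thesis using that by blast
qed

section \<open>Points of the curves and regular functions\<close>

lemma lambda_on_comp [simp]: "lambda (on_comp q k a) = a"
  by (cases a) (auto simp: param_def)

lemma param_eq_iff: "param q j a' = param q k a \<longleftrightarrow> a' = a \<and> (j = k \<or>
    (j = 5 \<or> poly (q j) a = 0) \<and> (k = 5 \<or> poly (q k) a = 0))"
proof
  assume "param q j a' = param q k a"
  then have *: "\<And>i. param q j a' $ i = param q k a $ i" by simp
  show "a' = a \<and> (j = k \<or> (j = 5 \<or> poly (q j) a = 0) \<and> (k = 5 \<or> poly (q k) a = 0))"
    using *[of 5] *[of j] *[of k] by (auto simp: param_def split: if_splits)
qed (auto simp: param_def vec_eq_iff)

lemma on_comp_in_curve: "on_comp q k a \<in> curve q"
  by (cases a) (auto simp: curve_def affine_curve_def param_def)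

text \<open>Over a zero of \<open>q k\<close> the components C_k and C_5 pass through one point, and
  elements of \<open>coord_ring\<close> agree there. The fibre over 0 is excepted because the
  completion puts separate smooth points \<open>PtZero k\<close> on the components.\<close>

lemma regular_at_value_at:
  assumes "r \<in> regular_at q (on_comp q k (Fin a))"
  shows "\<exists>c. value_at a (r$k) c \<and> (a \<noteq> 0 \<longrightarrow> k \<noteq> 5 \<longrightarrow> poly (q k) a = 0 \<longrightarrow> value_at a (r$5) c)"
proof (cases "a = 0")
  case True
  then obtain n d where "poly d 0 \<noteq> 0" "to_fract d * r$k = to_fract n"
    using assms by auto
  then have "value_at a (r$k) (poly n 0 / poly d 0)" unfolding value_at_def True
    by (intro exI[of _ n] exI[of _ d]) simp
  then show ?thesis using True by blast
next
  case False
  then obtain P Q where PQ: "P \<in> coord_ring q" "Q \<in> coord_ring q"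
      "\<And>j a'. param q j a' = param q k a \<Longrightarrow> poly (Q$j) a' \<noteq> 0" "\<And>j. to_fract (Q$j) * r$j = to_fract (P$j)"
    using assms by auto
  have 1: "value_at a (r$k) (poly (P$k) a / poly (Q$k) a)"
    unfolding value_at_def using PQ(3,4)[of k] by (intro exI[of _ "P$k"] exI[of _ "Q$k"]) simp
  have "value_at a (r$5) (poly (P$k) a / poly (Q$k) a)" if "k \<noteq> 5" "poly (q k) a = 0"
  proof -
    have "poly (P$k) a = poly (P$5) a" "poly (Q$k) a = poly (Q$5) a"
      using PQ(1,2) that unfolding coord_ring_iff dvd_def
      by (metis diff_eq_diff_eq eq_iff_diff_eq_0 mult_zero_left poly_diff poly_mult)+
    moreover have "poly (Q$5) a \<noteq> 0" using PQ(3)[of 5 a] that by (auto simp: param_eq_iff)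
    ultimately show ?thesis unfolding value_at_def using PQ(4)[of 5]
      by (intro exI[of _ "P$5"] exI[of _ "Q$5"]) simp
  qed
  with 1 show ?thesis by blast
qed

lemma regular_atI:
  assumes d: "poly d a \<noteq> 0"
    and r: "\<And>j. on_comp q j (Fin a) = on_comp q k (Fin a) \<Longrightarrow> to_fract d * r$j = to_fract n"
  shows "r \<in> regular_at q (on_comp q k (Fin a))"
proof (cases "a = 0")
  case True
  then show ?thesis using d r[of k] by auto
next
  case False
  define I where "I = {j. param q j a = param q k a}"
  have rI: "to_fract d * r$j = to_fract n" if "j \<in> I" for j
    using r[of j] that False by (auto simp: I_def)
  \<comment> \<open>\<open>W\<close> cuts off the branches that miss the point. If C_5 passes
    through it, the product of the equations of those branches does this; otherwise C_k is the only
    branch there, and \<open>q k\<close> is what \<open>coord_ring\<close> demands of a tuple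
    supported on C_k.\<close>
  define W where "W = (if 5 \<in> I then (\<Prod>j\<in>UNIV - I. q j) else q k)"
  have I5: "5 \<in> I \<longleftrightarrow> k = 5 \<or> poly (q k) a = 0" by (auto simp: I_def param_eq_iff)
  have I1: "I = {k}" if "5 \<notin> I" using that by (auto simp: I5) (auto simp: I_def param_eq_iff)
  have W: "poly W a \<noteq> 0"
    by (cases "5 \<in> I") (auto simp: W_def poly_prod I5, auto simp: I_def param_eq_iff)
  have R: "(\<chi> j. if j \<in> I then e * W else 0) \<in> coord_ring q" for e
  proof (cases "5 \<in> I")
    case True
    then have "q j dvd W" if "j \<notin> I" for j using that unfolding W_def by (auto intro: dvd_prodI)
    with True show ?thesis by (auto simp: coord_ring_iff)
  next
    case False
    with I1 show ?thesis by (auto simp: coord_ring_iff W_def)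
  qed
  define Q where "Q = (\<chi> j. if j \<in> I then d * W else 0)"
  define P where "P = (\<chi> j. if j \<in> I then n * W else 0)"
  have "P \<in> coord_ring q" "Q \<in> coord_ring q" unfolding P_def Q_def by (fact R)+
  moreover have "to_fract (Q$j) * r$j = to_fract (P$j)" for j
    using rI[of j] by (simp add: P_def Q_def to_fract_mult algebra_simps)
  moreover have "poly (Q$j) a' \<noteq> 0" if "param q j a' = param q k a" for j a'
    using that d W by (auto simp: I_def Q_def param_eq_iff)
  ultimately have "r \<in> regular_at q (Aff (param q k a))" by auto
  then show ?thesis using False by simp
qed

lemma infinite_csphere: "infinite (UNIV :: csphere set)"
proof -
  have "inj Fin" by (auto intro: injI)
  then have "infinite (range Fin)" using infinite_UNIV_char_0 by (metis finite_imageD)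
  then show ?thesis by (metis finite_subset subset_UNIV)
qed

section \<open>Sections over complements of finitely many fibres\<close>

text \<open>Open sets of this kind suffice for the whole argument. They correspond to each other
  under partial desingularisation, so direct images need no thought, and for finite \<open>B\<close>
  they meet every component, so restriction does not change the tuple that represents a
  section.\<close>

definition points_off :: "(5 \<Rightarrow> complex poly) \<Rightarrow> csphere set \<Rightarrow> curve_pt set"
  where "points_off q B = {on_comp q k a | k a. a \<notin> B}"

lemma curve_comp_meets_points_off:
  assumes "finite B"
  shows "curve_comp q k \<inter> points_off q B \<noteq> {}"
proof -
  obtain a where "a \<notin> B" using assms infinite_csphere by (metis UNIV_I ex_new_if_finite)
  then show ?thesis by (auto simp: points_off_def curve_comp_def)
qed

lemma zopen_points_off:
  assumes "finite B"
  shows "zopen q (points_off q B)"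
proof -
  have "curve_comp q k - points_off q B \<subseteq> on_comp q k ` B" for k
    by (auto simp: curve_comp_def points_off_def)
  then have "finite (curve_comp q k - points_off q B)" for k
    using assms by (meson finite_imageI finite_subset)
  then show ?thesis by (auto simp: zopen_def points_off_def on_comp_in_curve)
qed

lemma direct_image_points_off: "direct_image q q' F (points_off q B) = F (points_off q' B)"
proof -
  have "on_comp q k a \<in> points_off q B \<longleftrightarrow> a \<notin> B" for k a
    unfolding points_off_def by (auto dest: arg_cong[of _ _ lambda])
  then show ?thesis by (simp add: direct_image_def points_off_def)
qed

lemma restr_points_off: "finite B \<Longrightarrow> restr q (points_off q B) g = g"
  using curve_comp_meets_points_off[of B q] by (simp add: restr_def vec_eq_iff)

text \<open>With \<open>Infty\<close> in \<open>B\<close> only points with finite \<lambda> have to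
  be tested. This is enough later on, since a rational function without finite zeros and poles is
  already constant.\<close>

lemma sections_points_off:
  assumes "finite B" "Infty \<in> B"
  shows "g \<in> sections q D (points_off q B) \<longleftrightarrow>
    (\<forall>k a. Fin a \<notin> B \<longrightarrow>
      (\<chi> j. to_fract [:- a, 1:] ^ count D (on_comp q k (Fin a)) * g$j) \<in> regular_at q (on_comp q k (Fin a)))"
proof -
  have "g \<in> sections q D (points_off q B) \<longleftrightarrow>
     (\<forall>k a. a \<notin> B \<longrightarrow> (\<chi> j. unif a ^ count D (on_comp q k a) * g$j) \<in> regular_at q (on_comp q k a))"
  proof -
    have "(\<forall>k. curve_comp q k \<inter> points_off q B = {} \<longrightarrow> g$k = 0)"
      using curve_comp_meets_points_off[OF assms(1), of q] by blast
    moreover have "(\<forall>y\<in>points_off q B. P y) \<longleftrightarrow> (\<forall>k a. a \<notin> B \<longrightarrow> P (on_comp q k a))" for P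
      unfolding points_off_def by blast
    ultimately show ?thesis by (simp add: sections_def)
  qed
  also have "\<dots> \<longleftrightarrow> (\<forall>k a. Fin a \<notin> B \<longrightarrow>
      (\<chi> j. to_fract [:- a, 1:] ^ count D (on_comp q k (Fin a)) * g$j) \<in> regular_at q (on_comp q k (Fin a)))"
  proof -
    have "(\<forall>a. a \<notin> B \<longrightarrow> P a) \<longleftrightarrow> (\<forall>a. Fin a \<notin> B \<longrightarrow> P (Fin a))" for P
      using assms(2) by (metis csphere.exhaust)
    then show ?thesis by simp
  qed
  finally show ?thesis .
qed

lemma to_fract_power: "to_fract p ^ n = to_fract (p ^ n)"
  by (induction n) (auto simp: to_fract_mult)

lemma coord_ring_regular_at:
  assumes "n \<in> coord_ring q"
  shows "(\<chi> k. to_fract (n$k)) \<in> regular_at q (on_comp q k (Fin a))"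
proof (cases "a = 0")
  case True
  then show ?thesis by (simp, intro exI[of _ "n$k"] exI[of _ 1]) simp
next
  case False
  moreover have "(\<chi> k. 1) \<in> coord_ring q" by (simp add: coord_ring_iff)
  ultimately show ?thesis using assms
    by (simp, intro bexI[of _ n] bexI[of _ "\<chi> k. 1"]) auto
qed

text \<open>The divisor is effective, so it only permits poles, and functions regular on the affine
  curve are sections whatever \<open>D\<close> is.\<close>

lemma coord_ring_sections:
  assumes "n \<in> coord_ring q" "finite B" "Infty \<in> B"
  shows "(\<chi> k. to_fract (n$k)) \<in> sections q D (points_off q B)"
proof -
  have "(\<chi> j. to_fract [:- a, 1:] ^ e * (\<chi> k. to_fract (n$k))$j) \<in> regular_at q (on_comp q k (Fin a))"
    for k a e
  proof -
    have "(\<chi> k. [:- a, 1:] ^ e) * n \<in> coord_ring q"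
      by (rule coord_ring.mult[OF _ assms(1)]) (simp add: coord_ring_iff)
    from coord_ring_regular_at[OF this] show ?thesis
      by (simp add: to_fract_mult to_fract_power)
  qed
  then show ?thesis using assms by (simp add: sections_points_off)
qed

lemma fract_tuple_common_denominator:
  fixes g :: ratfun
  obtains d n where "d \<noteq> 0" "\<And>k. to_fract d * g$k = to_fract (n k)"
proof -
  have "\<exists>y x. y \<noteq> 0 \<and> to_fract y * g$k = to_fract x" for k
    by (cases "g$k") (auto simp: Fract_conv_to_fract)
  then obtain y x where y: "\<And>k. y k \<noteq> 0" "\<And>k. to_fract (y k) * g$k = to_fract (x k)" by metis
  have "to_fract (\<Prod>k\<in>UNIV. y k) * g$k = to_fract (x k * (\<Prod>j\<in>UNIV-{k}. y j))" for k
    by (subst prod.remove[of _ k]) (auto simp: to_fract_mult y(2)[symmetric] algebra_simps)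
  then show ?thesis using y(1) by (intro that[of "\<Prod>k\<in>UNIV. y k" "\<lambda>k. x k * (\<Prod>j\<in>UNIV-{k}. y j)"]) auto
qed

text \<open>A section becomes regular on multiplication by a regular tuple, so linearity over the
  structure sheaf forces its image to be the product with the image of 1. Compatibility with
  restriction makes the latter independent of the fibres removed.\<close>

lemma sheaf_iso_multiplier:
  assumes iso: "sheaf_iso q (direct_image q q1 (sections q1 D1)) (direct_image q q2 (sections q2 D2))"
    and dvd: "\<And>k. q1 k dvd q k" and nz: "\<And>k. q k \<noteq> 0"
  obtains m where "\<And>k. m$k \<noteq> 0"
    "\<And>B. finite B \<Longrightarrow> Infty \<in> B \<Longrightarrow>
      sections q2 D2 (points_off q2 B) = (*) m ` sections q1 D1 (points_off q1 B)"
proof -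
  define F where "F B = sections q1 D1 (points_off q1 B)" for B
  define G where "G B = sections q2 D2 (points_off q2 B)" for B
  define F' where "F' = direct_image q q1 (sections q1 D1)"
  define G' where "G' = direct_image q q2 (sections q2 D2)"
  have FG: "F' (points_off q B) = F B" "G' (points_off q B) = G B" for B
    by (simp_all add: F'_def G'_def F_def G_def direct_image_points_off)
  obtain \<phi> where \<phi>: "\<forall>U. zopen q U \<longrightarrow>
            bij_betw (\<phi> U) (F' U) (G' U)
            \<and> (\<forall>g\<in>F' U. \<forall>h\<in>F' U. \<phi> U (g + h) = \<phi> U g + \<phi> U h)
            \<and> (\<forall>r\<in>structure_sheaf q U. \<forall>g\<in>F' U. \<phi> U (r * g) = r * \<phi> U g)
            \<and> (\<forall>V. zopen q V \<and> V \<subseteq> U \<longrightarrow> (\<forall>g\<in>F' U. \<phi> V (restr q V g) = restr q V (\<phi> U g)))"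
    using iso unfolding sheaf_iso_def F'_def[symmetric] G'_def[symmetric] by (rule exE)
  define \<psi> where "\<psi> B = \<phi> (points_off q B)" for B
  have bij: "bij_betw (\<psi> B) (F B) (G B)"
    and lin: "\<And>r g. r \<in> sections q {#} (points_off q B) \<Longrightarrow> g \<in> F B \<Longrightarrow> \<psi> B (r * g) = r * \<psi> B g"
    and res: "\<And>g B'. finite B' \<Longrightarrow> B \<subseteq> B' \<Longrightarrow> g \<in> F B \<Longrightarrow> \<psi> B' g = \<psi> B g" if "finite B" for B
  proof -
    note P = \<phi>[rule_format, OF zopen_points_off[OF that, of q]]
    show "bij_betw (\<psi> B) (F B) (G B)"
      using conjunct1[OF P] unfolding \<psi>_def FG .
    note P = conjunct2[OF conjunct2[OF P]]
    show "\<psi> B (r * g) = r * \<psi> B g" if "r \<in> sections q {#} (points_off q B)" "g \<in> F B" for r g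
      using bspec[OF bspec[OF conjunct1[OF P]], of r g] that unfolding \<psi>_def FG structure_sheaf_def by simp
    show "\<psi> B' g = \<psi> B g" if "finite B'" "B \<subseteq> B'" "g \<in> F B" for g B'
    proof -
      have "points_off q B' \<subseteq> points_off q B" using that by (auto simp: points_off_def)
      with conjunct2[OF P] zopen_points_off[OF that(1), of q]
      have "\<forall>g\<in>F' (points_off q B). \<phi> (points_off q B') (restr q (points_off q B') g)
         = restr q (points_off q B') (\<phi> (points_off q B) g)"
        by simp
      then show ?thesis using restr_points_off[OF that(1), of q] that(3) by (simp add: \<psi>_def FG)
    qed
  qed
  have one: "1 \<in> F B" if "finite B" "Infty \<in> B" for B
    using coord_ring_sections[of "\<chi> k. 1" q1 B D1] that by (simp add: coord_ring_iff F_def one_vec_def)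
  define m where "m = \<psi> {Infty} 1"
  have m: "\<psi> B 1 = m" if "finite B" "Infty \<in> B" for B
    unfolding m_def using that by (intro res) (auto intro: one)
  \<comment> \<open>A multiple of \<open>p\<close> is divisible by every \<open>q k\<close>, so
    \<open>p\<close> times any tuple of polynomials lies in \<open>coord_ring q\<close>, however
    little its entries have to do with each other.\<close>
  define p where "p = (\<Prod>k\<in>UNIV. q k)"
  have p: "p \<noteq> 0" "\<And>k. q k dvd p" unfolding p_def using nz by auto
  have mult: "\<psi> B g = m * g" if "g \<in> F B" and B: "finite B" "Infty \<in> B" for g B
  proof -
    obtain d n where d: "d \<noteq> 0" "\<And>k. to_fract d * g$k = to_fract (n k)"
      by (rule fract_tuple_common_denominator[of g]) blast
    define r where "r = (\<chi> k::5. to_fract ((\<chi> k::5. p * d)$k))"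
    define r' where "r' = (\<chi> k::5. to_fract ((\<chi> k::5. p * n k)$k))"
    have "r \<in> sections q {#} (points_off q B)" "r' \<in> sections q {#} (points_off q B)"
      unfolding r_def r'_def using p(2)
      by (intro coord_ring_sections[OF _ B]; simp add: coord_ring_iff dvd_diff)+
    moreover have "r * g = r' * 1"
      by (auto simp: r_def r'_def vec_eq_iff to_fract_mult d(2)[symmetric])
    ultimately have *: "r * \<psi> B g = r' * m"
      using lin[OF B(1)] that one[OF B] m[OF B] by metis
    show ?thesis
    proof (subst vec_eq_iff, rule allI)
      fix k
      have "to_fract p * to_fract d * \<psi> B g $ k = to_fract p * to_fract d * (g$k * m$k)"
        using arg_cong[OF *, of "\<lambda>v. v$k"]
        by (simp add: r_def r'_def to_fract_mult d(2)[symmetric])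
      then show "\<psi> B g $ k = (m * g) $ k" using p(1) d(1) by (simp add: mult.commute)
    qed
  qed
  have "m$k \<noteq> 0" for k
  proof
    assume mk: "m$k = 0"
    define B where "B = {Infty}"
    \<comment> \<open>A section supported on the single component C_k; were \<open>m$k\<close> zero,
      it would have the same image as 0, against injectivity.\<close>
    define g where "g = (\<chi> j. to_fract ((\<chi> j. if j = k then p else 0)$j))"
    have B: "finite B" "Infty \<in> B" by (auto simp: B_def)
    have "(\<chi> j. if j = k then p else 0) \<in> coord_ring q1"
      using p(2) dvd by (auto simp: coord_ring_iff intro: dvd_trans)
    then have "g \<in> F B" unfolding g_def F_def by (rule coord_ring_sections[OF _ B])
    moreover have "0 \<in> F B"
      using coord_ring_sections[of 0 q1 B D1] B by (simp add: coord_ring_iff F_def zero_vec_def)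
    moreover have "\<psi> B g = \<psi> B 0"
      using mk \<open>0 \<in> F B\<close> \<open>g \<in> F B\<close> B by (auto simp: mult vec_eq_iff g_def)
    ultimately have "g = 0" using bij[OF B(1)] by (metis bij_betw_def inj_onD)
    then have "g$k = 0" by simp
    then show False using p(1) by (simp add: g_def)
  qed
  moreover have "G B = (*) m ` F B" if "finite B" "Infty \<in> B" for B
    using bij[OF that(1)] mult that by (auto simp: bij_betw_def)
  ultimately show ?thesis using that unfolding F_def G_def by blast
qed

text \<open>The test section has, on each component, the largest pole over \<open>b\<close> that
  \<open>D1\<close> allows, with leading constants \<open>c\<close> that agree wherever components
  meet. Regularity of its image at \<open>b\<close> then bounds the multiplier and couples its
  values on C_k and C_5.\<close>

lemma sheaf_multiplier_test:
  assumes q1: "\<And>k. q1 k \<noteq> 0"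
    and T: "\<And>B g. finite B \<Longrightarrow> Infty \<in> B \<Longrightarrow> g \<in> sections q1 D1 (points_off q1 B)
       \<Longrightarrow> m * g \<in> sections q2 D2 (points_off q2 B)"
    and c: "\<And>j k. on_comp q1 j (Fin b) = on_comp q1 k (Fin b) \<Longrightarrow> c j = c k"
  defines "w \<equiv> \<lambda>k. m$k * (to_fract [:c k:] * inverse (to_fract [:- b, 1:] ^ count D1 (on_comp q1 k (Fin b))))"
  shows "\<exists>u. value_at b (to_fract [:- b, 1:] ^ count D2 (on_comp q2 k (Fin b)) * w k) u \<and>
    (b \<noteq> 0 \<longrightarrow> k \<noteq> 5 \<longrightarrow> poly (q2 k) b = 0 \<longrightarrow>
      value_at b (to_fract [:- b, 1:] ^ count D2 (on_comp q2 k (Fin b)) * w 5) u)"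
proof -
  define t where "t = [:- b, 1:]"
  define e where "e = (\<lambda>k. count D1 (on_comp q1 k (Fin b)))"
  have t: "t \<noteq> 0" "to_fract t \<noteq> 0" by (auto simp: t_def)
  \<comment> \<open>All fibres other than that of \<open>b\<close> at which components cross or
    \<open>D1\<close> has points are removed, so the test section meets a condition only over
    \<open>b\<close>.\<close>
  define B where "B = (({Infty, Fin 0} \<union> (\<Union>k. Fin ` {a. poly (q1 k) a =
    0})) \<union> lambda ` set_mset D1) - {Fin b}"
  have B: "finite B" "Infty \<in> B" using q1 by (auto simp: B_def intro: poly_roots_finite)
  have Ba: "a = b \<or> (a \<noteq> 0 \<and> (\<forall>k. poly (q1 k) a \<noteq> 0) \<and> (\<forall>k. count D1 (on_comp q1 k (Fin a)) = 0))"
    if "Fin a \<notin> B" for a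
  proof (cases "a = b")
    case False
    then have "Fin a \<notin> lambda ` set_mset D1" using that by (auto simp: B_def)
    then have "count D1 (on_comp q1 k (Fin a)) = 0" for k
      by (metis count_eq_zero_iff image_eqI lambda_on_comp)
    then show ?thesis using that False by (auto simp: B_def)
  qed auto
  define g where "g = (\<chi> k. to_fract [:c k:] * inverse (to_fract t ^ e k))"
  have "g \<in> sections q1 D1 (points_off q1 B)"
    unfolding sections_points_off[OF B]
  proof (intro allI impI)
    fix k a assume "Fin a \<notin> B"
    from Ba[OF this]
    show "(\<chi> j. to_fract [:- a, 1:] ^ count D1 (on_comp q1 k (Fin a)) *
      g$j) \<in> regular_at q1 (on_comp q1 k (Fin a))"
    proof
      assume [simp]: "a = b"
      show ?thesis
      proof (rule regular_atI[of 1 _ _ _ _ "[:c k:]"])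
        fix j assume j: "on_comp q1 j (Fin a) = on_comp q1 k (Fin a)"
        then have "c j = c k" "e j = count D1 (on_comp q1 k (Fin b))" using c[of j k] by (auto simp: e_def)
        then show "to_fract 1 * (\<chi> j. to_fract [:- a, 1:] ^ count D1 (on_comp q1 k (Fin a)) * g$j) $ j =
          to_fract [:c k:]"
          using t by (simp add: g_def t_def[symmetric])
      qed simp
    next
      assume a: "a \<noteq> 0 \<and> (\<forall>k. poly (q1 k) a \<noteq> 0) \<and> (\<forall>k. count D1 (on_comp q1 k (Fin a)) = 0)"
      show ?thesis
      proof (cases "a = b")
        case False
        show ?thesis
        proof (rule regular_atI[of "t ^ e k" _ _ _ _ "[:c k:]"])
          show "poly (t ^ e k) a \<noteq> 0" using False by (simp add: t_def)
          fix j assume "on_comp q1 j (Fin a) = on_comp q1 k (Fin a)"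
          then have "j = k" using a by (auto simp: param_eq_iff)
          then show "to_fract (t ^ e k) *
            (\<chi> j. to_fract [:- a, 1:] ^ count D1 (on_comp q1 k (Fin a)) * g$j) $ j = to_fract [:c k:]"
            using conjunct2[OF conjunct2[OF a]] t
            by (simp add: g_def to_fract_power[symmetric] del: on_comp.simps)
        qed
      next
        case [simp]: True
        show ?thesis
        proof (rule regular_atI[of 1 _ _ _ _ "[:c k:]"])
          fix j assume "on_comp q1 j (Fin a) = on_comp q1 k (Fin a)"
          then have "j = k" using a by (auto simp: param_eq_iff)
          then show "to_fract 1 * (\<chi> j. to_fract [:- a, 1:] ^ count D1 (on_comp q1 k (Fin a)) * g$j) $ j =
            to_fract [:c k:]"
            using t by (simp add: g_def e_def t_def)
        qed simp
      qed
    qed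
  qed
  then have "m * g \<in> sections q2 D2 (points_off q2 B)" by (rule T[OF B])
  moreover have "Fin b \<notin> B" by (simp add: B_def)
  ultimately have "(\<chi> j. to_fract [:- b, 1:] ^ count D2 (on_comp q2 k (Fin b)) *
    (m * g)$j) \<in> regular_at q2 (on_comp q2 k (Fin b))"
    unfolding sections_points_off[OF B] by blast
  from regular_at_value_at[OF this] show ?thesis
    by (simp add: w_def g_def t_def e_def)
qed

text \<open>The multiplier has order exactly \<open>D1 - D2\<close> at each point: the test with
  constant 1, applied to it and to its inverse, gives values whose product is 1. The second claim
  says that crossings of the second curve persist on the first one.\<close>

lemma sheaf_multiplier_local:
  assumes q: "\<And>k. q1 k \<noteq> 0" "\<And>k. q2 k \<noteq> 0" and m: "\<And>k. m$k \<noteq> 0"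
    and T: "\<And>B. finite B \<Longrightarrow> Infty \<in> B \<Longrightarrow>
      sections q2 D2 (points_off q2 B) = (*) m ` sections q1 D1 (points_off q1 B)"
  defines "w \<equiv> \<lambda>b k. to_fract [:- b, 1:] ^ count D2 (on_comp q2 k (Fin b)) * m$k *
      inverse (to_fract [:- b, 1:] ^ count D1 (on_comp q1 k (Fin b)))"
  shows "\<exists>u. u \<noteq> 0 \<and> value_at b (w b k) u"
    and "b \<noteq> 0 \<Longrightarrow> k \<noteq> 5 \<Longrightarrow> poly (q2 k) b = 0 \<Longrightarrow>
      poly (q1 k) b = 0 \<and> (\<exists>u. value_at b (w b k) u \<and> value_at b (w b 5) u)"
proof -
  define m' where "m' = (\<chi> k. inverse (m$k))"
  have m'm: "m' * (m * g) = g" for g using m by (simp add: m'_def vec_eq_iff)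
  have T1: "m * g \<in> sections q2 D2 (points_off q2 B)"
    if "finite B" "Infty \<in> B" "g \<in> sections q1 D1 (points_off q1 B)" for B g
    using T[OF that(1,2)] that(3) by blast
  have T2: "m' * g \<in> sections q1 D1 (points_off q1 B)"
    if "finite B" "Infty \<in> B" "g \<in> sections q2 D2 (points_off q2 B)" for B g
    using T[OF that(1,2)] that(3) m'm by auto
  define t where "t = to_fract [:- b, 1:]"
  have t: "t \<noteq> 0" by (simp add: t_def)
  have one: "to_fract [:1:] = 1" by (metis one_pCons to_fract_1)
  show nz: "\<exists>u. u \<noteq> 0 \<and> value_at b (w b k) u" for k
  proof -
    obtain u where u: "value_at b (w b k) u"
      using sheaf_multiplier_test[of q1 D1 m q2 D2 b "\<lambda>_. 1" k, OF q(1) T1]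
      unfolding w_def one by (auto simp: mult.assoc)
    obtain u' where u': "value_at b (inverse (w b k)) u'"
      using sheaf_multiplier_test[of q2 D2 m' q1 D1 b "\<lambda>_. 1" k, OF q(2) T2]
      unfolding w_def m'_def one by (auto simp: field_simps)
    have "w b k \<noteq> 0" using m t by (auto simp: w_def t_def)
    then have "value_at b 1 (u * u')" using value_at_mult[OF u u'] by simp
    moreover have "value_at b 1 1" using value_at_to_fract[of b 1] by simp
    ultimately have "u * u' = 1" by (rule value_at_unique)
    then have "u \<noteq> 0" by auto
    with u show ?thesis by blast
  qed
  assume b: "b \<noteq> 0" and k: "k \<noteq> 5" "poly (q2 k) b = 0"
  then have same: "on_comp q2 5 (Fin b) = on_comp q2 k (Fin b)" by (auto simp: param_eq_iff)
  obtain v where v: "value_at b (w b k) v" "value_at b (w b 5) v"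
    using sheaf_multiplier_test[of q1 D1 m q2 D2 b "\<lambda>_. 1" k, OF q(1) T1]
    b k unfolding w_def one same by (auto simp: mult.assoc)
  have "v \<noteq> 0" using nz[of k] v(1) value_at_unique by blast
  have "poly (q1 k) b = 0"
  proof (rule ccontr)
    assume *: "poly (q1 k) b \<noteq> 0"
    \<comment> \<open>If C_k were separate from C_5 over \<open>b\<close> on the first curve, the
      constants 2 on C_k and 1 elsewhere would be admissible. The image would then double its value
      on C_k only, while both branches of the second curve must give the same value.\<close>
    have cc: "(if i = k then 2 else 1) = (if j = k then 2 else (1::complex))"
      if "on_comp q1 i (Fin b) = on_comp q1 j (Fin b)" for i j
      using that * b k by (auto simp: param_eq_iff)
    have "\<exists>u. value_at b (to_fract [:2:] * w b k) u \<and> value_at b (w b 5) u"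
      using sheaf_multiplier_test[of q1 D1 m q2 D2 b "\<lambda>j. if j = k then 2 else 1" k, OF q(1) T1 cc] * b k
      unfolding w_def same by (simp add: param_eq_iff one mult_ac)
    then obtain u where u: "value_at b (to_fract [:2:] * w b k) u" "value_at b (w b 5) u" by blast
    have "u = v" by (rule value_at_unique[OF u(2) v(2)])
    moreover have "u = 2 * v"
      using value_at_unique[OF u(1) value_at_mult[OF value_at_to_fract[of b "[:2:]"] v(1)]] by simp
    ultimately show False using \<open>v \<noteq> 0\<close> by simp
  qed
  with v show "poly (q1 k) b = 0 \<and> (\<exists>u. value_at b (w b k) u \<and> value_at b (w b 5) u)" by blast
qed

text \<open>Both \<open>r\<close> and its inverse are regular on the whole plane, hence polynomials,
  so \<open>r\<close> is a unit of the polynomial ring.\<close>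

lemma value_at_everywhere_nonzero_imp_const:
  assumes "\<And>b. \<exists>u. u \<noteq> 0 \<and> value_at b r u"
  obtains c where "c \<noteq> 0" "r = to_fract [:c:]"
proof -
  obtain p where p: "r = to_fract p" using regular_everywhere_imp_poly assms by metis
  obtain p' where p': "inverse r = to_fract p'"
    using regular_everywhere_imp_poly[of "inverse r"] assms value_at_inverse by metis
  have "r \<noteq> 0"
    using assms[of 0] value_at_to_fract[of 0 0] value_at_unique by fastforce
  then have "to_fract (p * p') = to_fract 1" by (simp add: to_fract_mult p'[symmetric] p[symmetric])
  then have "p * p' = 1" by (simp only: to_fract_eq_iff)
  then have "is_unit p" by (metis dvd_triv_left)
  then obtain c where c: "p = [:c:]" by (auto simp: is_unit_poly_iff)
  with p \<open>r \<noteq> 0\<close> have "c \<noteq> 0" by auto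
  with p c that show ?thesis by blast
qed

section \<open>Divisors and projective coordinates\<close>

text \<open>A point at infinity contributes the factor 1: it is recorded only by the degree falling
  short of \<open>size D\<close>.\<close>

definition div_poly :: "csphere multiset \<Rightarrow> complex poly"
  where "div_poly D = (\<Prod>a\<in>#D. case a of Fin a \<Rightarrow> [:- a, 1:] | Infty \<Rightarrow> 1)"

lemma div_poly_nonzero [simp]: "div_poly D \<noteq> 0"
  unfolding div_poly_def by (induction D) (auto split: csphere.split)

lemma order_div_poly: "order a (div_poly D) = count D (Fin a)"
proof (induction D)
  case empty
  then show ?case by (simp add: div_poly_def)
next
  case (add x D)
  have *: "div_poly (add_mset x D) = (case x of Fin a \<Rightarrow> [:- a, 1:] | Infty \<Rightarrow> 1) * div_poly D"
    by (simp add: div_poly_def)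
  show ?case
  proof (cases x)
    case (Fin c)
    have "order a [:- c, 1:] = (if a = c then 1 else 0)"
      using order_power_n_n[of c 1] by (auto simp: order_0I)
    moreover have "div_poly (add_mset x D) = [:- c, 1:] * div_poly D" by (simp add: div_poly_def Fin)
    moreover have "order a ([:- c, 1:] * div_poly D) = order a [:- c, 1:] + order a (div_poly D)"
      by (rule order_mult) (simp del: mult_pCons_left)
    ultimately show ?thesis using add Fin by simp
  next
    case Infty
    then show ?thesis using add unfolding * by simp
  qed
qed

lemma degree_div_poly: "degree (div_poly D) + count D Infty = size D"
proof (induction D)
  case empty
  then show ?case by (simp add: div_poly_def)
next
  case (add x D)
  have *: "div_poly (add_mset x D) = (case x of Fin a \<Rightarrow> [:- a, 1:] | Infty \<Rightarrow> 1) * div_poly D"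
    by (simp add: div_poly_def)
  show ?case
  proof (cases x)
    case (Fin c)
    then have "div_poly (add_mset x D) = [:- c, 1:] * div_poly D" by (simp add: div_poly_def)
    then have "degree (div_poly (add_mset x D)) = Suc (degree (div_poly D))"
      by (simp add: degree_mult_eq del: mult_pCons_left)
    then show ?thesis using add Fin by simp
  next
    case Infty
    then show ?thesis using add unfolding * by simp
  qed
qed

lemma div_poly_decomp:
  obtains w where "div_poly D = [:- a, 1:] ^ count D (Fin a) * w" "poly w a \<noteq> 0"
  using order_decomp[of "div_poly D" a] unfolding order_div_poly
  by (metis div_poly_nonzero poly_eq_0_iff_dvd)

lemma poly_div_poly_eq_0_iff: "poly (div_poly D) a = 0 \<longleftrightarrow> Fin a \<in># D"
  using order_root[of "div_poly D" a] by (simp add: order_div_poly)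

lemma poly_node_poly_eq_0_iff: "finite S \<Longrightarrow> poly (node_poly S) a = 0 \<longleftrightarrow> a \<in> S"
  by (auto simp: node_poly_def poly_prod)

lemma node_poly_nonzero [simp]: "node_poly S \<noteq> 0"
  by (cases "finite S") (auto simp: node_poly_def)

lemma node_poly_dvd: "finite T \<Longrightarrow> S \<subseteq> T \<Longrightarrow> node_poly S dvd node_poly T"
  unfolding node_poly_def by (rule prod_dvd_prod_subset)

lemma count_image_mset_fibre:
  assumes "\<And>x. x \<in># M \<Longrightarrow> f x = f y \<Longrightarrow> x = y"
  shows "count (image_mset f M) (f y) = count M y"
  using assms by (induction M) auto

lemma on_comp_smooth_inj:
  assumes "k \<noteq> 5" "\<And>c. a = Fin c \<Longrightarrow> c \<noteq> 0 \<Longrightarrow> poly (q k) c \<noteq> 0"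
    and "on_comp q k a = on_comp q k' a'"
  shows "(k, a) = (k', a')"
proof -
  have "a = a'" using arg_cong[OF assms(3), of lambda] by simp
  with assms show ?thesis by (cases a) (auto simp: param_eq_iff split: if_splits)
qed

section \<open>The sheaf determines the divisor\<close>

context
  fixes \<beta>0 :: complex and \<Delta> :: "complex set"
  assumes fin: "finite \<Delta>" and ne: "\<Delta> \<noteq> {}" and unit: "\<And>s. s \<in> nodes \<beta>0 \<Delta> \<Longrightarrow> cmod s = 1"
    and card_nodes: "card (nodes \<beta>0 \<Delta>) = card \<Delta>" and sym: "uminus ` nodes \<beta>0 \<Delta> = nodes \<beta>0 \<Delta>"
begin

lemma finite_nodes: "finite (nodes \<beta>0 \<Delta>)" using fin by (simp add: nodes_def)

lemma finite_S1: "finite (S1 \<beta>0 \<Delta> E)" using finite_nodes by (simp add: S1_def)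

lemma XE_fam_dvd: "XE_fam \<beta>0 \<Delta> E k dvd X_fam \<beta>0 \<Delta> k"
proof -
  have "S1 \<beta>0 \<Delta> E \<subseteq> nodes \<beta>0 \<Delta>" by (auto simp: S1_def)
  moreover from this have "uminus ` S1 \<beta>0 \<Delta> E \<subseteq> nodes \<beta>0 \<Delta>" using sym by blast
  ultimately show ?thesis using finite_nodes by (auto simp: XE_fam_def X_fam_def intro: node_poly_dvd)
qed

lemma count_E_prime:
  "count (E_prime \<beta>0 \<Delta> E) (Fin b) + (if b \<in> nodes \<beta>0 \<Delta> - S1 \<beta>0 \<Delta> E then 1 else 0) = count E (Fin b)"
proof -
  have "Fin b \<in> Fin ` {s \<in> nodes \<beta>0 \<Delta>. Fin s \<in># E} \<longleftrightarrow> b \<in> nodes \<beta>0 \<Delta> - S1 \<beta>0 \<Delta> E"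
    by (auto simp: S1_def)
  moreover have "Fin b \<in># E" if "b \<in> nodes \<beta>0 \<Delta> - S1 \<beta>0 \<Delta> E" using that by (auto simp: S1_def)
  ultimately show ?thesis using finite_nodes by (auto simp: E_prime_def count_mset_set' Suc_leI)
qed

text \<open>The divisor avoids the crossings of X_E: a node in \<open>S1\<close> is not in E by
  definition, and reflection fixes the unit circle, so it cannot move another point of E onto a
  node. Hence \<open>on_comp\<close> is injective along the divisor. The images under \<rho>, \<tau>
  and \<rho>\<tau> lie on C_3, C_4 and C_2; C_1 keeps E' and the point P_1, and C_5 gets
  nothing.\<close>

lemma count_D_div:
  "count (D_div \<beta>0 \<Delta> E) (on_comp (XE_fam \<beta>0 \<Delta> E) 1 (Fin b)) =
     count (E_prime \<beta>0 \<Delta> E) (Fin b) + (if b = 0 then 1 else 0)"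
  "count (D_div \<beta>0 \<Delta> E) (on_comp (XE_fam \<beta>0 \<Delta> E) 5 (Fin b)) = 0"
proof -
  define q where "q = XE_fam \<beta>0 \<Delta> E"
  define f where "f = (\<lambda>(k, a). on_comp q k a)"
  define E1 where "E1 = image_mset (Pair (1::5)) (E_prime \<beta>0 \<Delta> E)"
  define M where "M = E1 + image_mset rho E1 + image_mset tau E1 + image_mset (rho \<circ> tau) E1"
  have D: "D_div \<beta>0 \<Delta> E = image_mset f M + mset_set (PtZero ` {1, 2, 3, 4})"
    by (simp add: D_div_def Let_def q_def f_def E1_def M_def)
  have S1: "c \<notin> S1 \<beta>0 \<Delta> E" if "Fin c \<in># E_prime \<beta>0 \<Delta> E" for c
    using that by (auto simp: E_prime_def S1_def dest: in_diffD)
  have unit_refl: "c = s" if "cmod s = 1" "inverse (cnj c) = s" for c s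
  proof -
    have "s * cnj s = 1" using that complex_norm_square[of s] by simp
    then have "cnj s = inverse s" by (metis inverse_unique)
    then show ?thesis using that(2) by (metis complex_cnj_cnj complex_cnj_inverse inverse_inverse_eq)
  qed
  have S1u: "cmod s = 1" if "s \<in> S1 \<beta>0 \<Delta> E" for s using that unit by (simp add: S1_def)
  have roots: "poly (q 1) c = 0 \<longleftrightarrow> c \<in> S1 \<beta>0 \<Delta> E" "poly (q 3) c = 0 \<longleftrightarrow> c \<in> S1 \<beta>0 \<Delta> E"
    "poly (q 2) c = 0 \<longleftrightarrow> - c \<in> S1 \<beta>0 \<Delta> E" "poly (q 4) c = 0 \<longleftrightarrow> - c \<in> S1 \<beta>0 \<Delta> E" for c
    using finite_S1 by (auto simp: q_def XE_fam_def poly_node_poly_eq_0_iff image_iff equation_minus_iff)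
  have smooth: "fst x \<noteq> 5 \<and> (\<forall>c. snd x = Fin c \<longrightarrow> c \<noteq> 0 \<longrightarrow> poly (q (fst x)) c \<noteq> 0)" if "x \<in># M" for x
  proof -
    have neg_refl: False if "Fin c \<in># E_prime \<beta>0 \<Delta> E" "inverse (cnj c) \<in> S1 \<beta>0 \<Delta> E" for c
      using unit_refl[OF S1u[OF that(2)] refl] S1[OF that(1)] that(2) by simp
    from that obtain a where a: "a \<in># E_prime \<beta>0 \<Delta> E"
      and "x = (1, a) \<or> x = rho (1, a) \<or> x = tau (1, a) \<or> x = rho (tau (1, a))"
      by (auto simp: M_def E1_def)
    then have x: "x = (1, a) \<or> x = (3, reflect a) \<or> x = (4, neg a) \<or> x = (2, reflect (neg a))"
      by (auto simp: rho_def tau_def)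
    show ?thesis
    proof (cases a)
      case (Fin c)
      with x S1 a neg_refl show ?thesis by (auto simp: roots split: if_splits)
    next
      case Infty
      with x show ?thesis by (auto simp: roots)
    qed
  qed
  have inj: "x = y" if "x \<in># M" "f x = f y" for x y
    using on_comp_smooth_inj[of "fst x" "snd x" q "fst y" "snd y"] smooth[OF that(1)] that(2)
    by (auto simp: f_def split: prod.splits)
  have cnt: "count (image_mset f M) (on_comp q k a) = count M (k, a)" for k a
    using count_image_mset_fibre[of M f "(k, a)"] inj by (simp add: f_def)
  have zero: "x \<notin># M \<Longrightarrow> count M x = 0" for x by (simp add: not_in_iff)
  have other: "count (image_mset g E1) (1, a) = 0" if "\<And>a. fst (g (1, a)) \<noteq> 1" for g and a :: csphere
  proof -
    have "(1, a) \<notin># image_mset g E1" using that by (auto simp: E1_def) (metis fst_conv)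
    then show ?thesis by (meson not_in_iff)
  qed
  have "count E1 (1, Fin b) = count (E_prime \<beta>0 \<Delta> E) (Fin b)"
    unfolding E1_def by (rule count_image_mset_fibre) auto
  moreover have "count (image_mset rho E1) (1, Fin b) = 0" by (rule other) (simp add: rho_def)
  moreover have "count (image_mset tau E1) (1, Fin b) = 0" by (rule other) (simp add: tau_def)
  moreover have "count (image_mset (rho \<circ> tau) E1) (1, Fin b) = 0"
    by (rule other) (simp add: rho_def tau_def)
  ultimately have "count M (1, Fin b) = count (E_prime \<beta>0 \<Delta> E) (Fin b)" by (simp add: M_def)
  then show "count (D_div \<beta>0 \<Delta> E) (on_comp (XE_fam \<beta>0 \<Delta> E) 1 (Fin b)) =
     count (E_prime \<beta>0 \<Delta> E) (Fin b) + (if b = 0 then 1 else 0)"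
    unfolding D q_def[symmetric] count_union cnt by (auto simp: count_mset_set')
  have "(5, Fin b) \<notin># M" using smooth by fastforce
  then show "count (D_div \<beta>0 \<Delta> E) (on_comp (XE_fam \<beta>0 \<Delta> E) 5 (Fin b)) = 0"
    unfolding D q_def[symmetric] count_union cnt by (auto simp: count_mset_set' not_in_iff)
qed

lemma L_sheaf_iso_imp_eq:
  assumes E: "E \<in> eff_divs \<beta>0 \<Delta>" and F: "F \<in> eff_divs \<beta>0 \<Delta>"
    and iso: "sheaf_iso (X_fam \<beta>0 \<Delta>) (L_sheaf \<beta>0 \<Delta> E) (L_sheaf \<beta>0 \<Delta> F)"
  shows "E = F"
proof -
  define q1 where "q1 = XE_fam \<beta>0 \<Delta> E"
  define q2 where "q2 = XE_fam \<beta>0 \<Delta> F"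
  define D1 where "D1 = D_div \<beta>0 \<Delta> E"
  define D2 where "D2 = D_div \<beta>0 \<Delta> F"
  have q: "q1 k \<noteq> 0" "q2 k \<noteq> 0" for k by (auto simp: q1_def q2_def XE_fam_def)
  obtain m where m: "\<And>k. m$k \<noteq> 0" and T: "\<And>B. finite B \<Longrightarrow> Infty \<in> B \<Longrightarrow>
      sections q2 D2 (points_off q2 B) = (*) m ` sections q1 D1 (points_off q1 B)"
    using sheaf_iso_multiplier[of "X_fam \<beta>0 \<Delta>" q1 D1 q2 D2] iso XE_fam_dvd
    unfolding L_sheaf_def q1_def q2_def D1_def D2_def by (auto simp: X_fam_def)
  define m' where "m' = (\<chi> k. inverse (m$k))"
  have T': "sections q1 D1 (points_off q1 B) = (*) m' ` sections q2 D2 (points_off q2 B)"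
    if "finite B" "Infty \<in> B" for B
  proof -
    have "m' * (m * g) = g" for g using m by (simp add: m'_def vec_eq_iff)
    then show ?thesis unfolding T[OF that] by (simp add: image_image)
  qed
  have m': "m'$k \<noteq> 0" for k using m by (simp add: m'_def)
  note loc = sheaf_multiplier_local[OF q m T]
  note loc' = sheaf_multiplier_local[OF q(2,1) m' T']
  have root: "poly (q1 1) b = 0 \<longleftrightarrow> b \<in> S1 \<beta>0 \<Delta> E" "poly (q2 1) b = 0 \<longleftrightarrow> b \<in> S1 \<beta>0 \<Delta> F" for b
    using finite_S1 by (auto simp: q1_def q2_def XE_fam_def poly_node_poly_eq_0_iff)
  have nz: "b \<noteq> 0" if "b \<in> S1 \<beta>0 \<Delta> G" for b G using unit[of b] that by (auto simp: S1_def)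
  \<comment> \<open>The local comparison is applied to the multiplier and to its inverse: each curve
    has all the crossings of the other on C_1.\<close>
  have S: "S1 \<beta>0 \<Delta> F = S1 \<beta>0 \<Delta> E"
    using loc(2)[of _ 1] loc'(2)[of _ 1] root nz by auto
  \<comment> \<open>P_1 and the node correction in \<open>E_prime\<close> contribute equally on both
    sides because the sets \<open>S1\<close> agree; what remains is the difference of E and F
    themselves.\<close>
  have e: "count D1 (on_comp q1 1 (Fin b)) + count F (Fin b) =
    count D2 (on_comp q2 1 (Fin b)) + count E (Fin b)" for b
    using count_D_div[of E b] count_D_div[of F b] count_E_prime[of E b] count_E_prime[of F b]
    unfolding D1_def D2_def q1_def q2_def S by linarith
  have e5: "count D1 (on_comp q1 5 (Fin b)) = 0" "count D2 (on_comp q2 5 (Fin b)) = 0" for b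
    unfolding D1_def D2_def q1_def q2_def by (rule count_D_div)+
  have "\<exists>u. u \<noteq> 0 \<and> value_at b (m$5) u" for b
    using loc(1)[of b 5] unfolding e5 by simp
  then obtain c where c: "c \<noteq> 0" "m$5 = to_fract [:c:]"
    using value_at_everywhere_nonzero_imp_const by blast
  define h where "h = div_poly E"
  define k where "k = div_poly F"
  \<comment> \<open>The orders of \<open>m$1\<close> and of \<open>k / h\<close> at \<open>b\<close>
    are opposite, so the product has neither zeros nor poles.\<close>
  have "\<exists>u. u \<noteq> 0 \<and> value_at b (m$1 * to_fract k * inverse (to_fract h)) u" for b
  proof -
    define t where "t = to_fract [:- b, 1:]"
    have t: "t \<noteq> 0" by (simp add: t_def)
    define e1 where "e1 = count D1 (on_comp q1 1 (Fin b))"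
    define e2 where "e2 = count D2 (on_comp q2 1 (Fin b))"
    obtain u where u: "u \<noteq> 0" "value_at b (t ^ e2 * m$1 * inverse (t ^ e1)) u"
      using loc(1)[of b 1] by (auto simp: t_def e1_def e2_def)
    obtain x where x: "h = [:- b, 1:] ^ count E (Fin b) * x" "poly x b \<noteq> 0"
      unfolding h_def by (rule div_poly_decomp)
    obtain y where y: "k = [:- b, 1:] ^ count F (Fin b) * y" "poly y b \<noteq> 0"
      unfolding k_def by (rule div_poly_decomp)
    have "x \<noteq> 0" using x(2) by auto
    have tt: "t ^ e1 * t ^ count F (Fin b) = t ^ e2 * t ^ count E (Fin b)"
      unfolding power_add[symmetric] using e[of b] by (simp add: e1_def e2_def)
    have "m$1 * to_fract k * inverse (to_fract h) =
        m$1 * (t ^ e1 * t ^ count F (Fin b)) * inverse (t ^ e1) * to_fract y *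
          inverse (t ^ count E (Fin b) * to_fract x)"
      using t by (simp add: x(1) y(1) to_fract_mult to_fract_power[symmetric] t_def[symmetric] field_simps)
    also have "\<dots> = t ^ e2 * m$1 * inverse (t ^ e1) * to_fract y * inverse (to_fract x)"
      unfolding tt using t \<open>x \<noteq> 0\<close> by (simp add: field_simps)
    finally show ?thesis
      using u x(2) y(2) value_at_mult[OF value_at_mult[OF u(2) value_at_to_fract[of b y]]
        value_at_inverse[OF value_at_to_fract[of b x]]]
      by (metis (no_types, lifting) inverse_nonzero_iff_nonzero mult_eq_0_iff)
  qed
  then obtain \<kappa> where \<kappa>: "\<kappa> \<noteq> 0" "m$1 * to_fract k * inverse (to_fract h) = to_fract [:\<kappa>:]"
    using value_at_everywhere_nonzero_imp_const by blast
  have hk: "m$1 * to_fract k = to_fract (smult \<kappa> h)"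
  proof -
    have "m$1 * to_fract k = to_fract [:\<kappa>:] * to_fract h"
      unfolding \<kappa>(2)[symmetric] by (simp add: h_def)
    then show ?thesis by (simp add: to_fract_mult[symmetric])
  qed
  have eq: "smult c k - smult \<kappa> h = 0"
  proof (rule ccontr)
    assume nz': "smult c k - smult \<kappa> h \<noteq> 0"
    \<comment> \<open>At a crossing left on X_E, \<open>m$1\<close> and \<open>m$5\<close> share the
      value \<open>c\<close>, so \<open>m$1 * k = \<kappa> h\<close> gives the equality. At every
      other node \<open>m$1\<close> is not coupled to \<open>m$5\<close>, but the node lies in both
      supports and both polynomials vanish.\<close>
    have "poly (smult c k - smult \<kappa> h) s = 0" if s: "s \<in> nodes \<beta>0 \<Delta>" for s
    proof (cases "s \<in> S1 \<beta>0 \<Delta> E")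
      case True
      have s0: "s \<noteq> 0" "poly (q1 1) s = 0" "poly (q2 1) s = 0" using nz True root S by auto
      have same: "on_comp q1 1 (Fin s) = on_comp q1 5 (Fin s)" "on_comp q2 1 (Fin s) = on_comp q2 5 (Fin s)"
        using s0 by (auto simp: param_eq_iff)
      obtain u where u: "value_at s (m$1) u" "value_at s (m$5) u"
        using loc(2)[of s 1] s0 unfolding same e5 by auto
      have "u = c" using value_at_unique[OF u(2)[unfolded c(2)] value_at_to_fract] by simp
      have "value_at s (m$1 * to_fract k) (c * poly k s)"
        using value_at_mult[OF u(1) value_at_to_fract[of s k]] \<open>u = c\<close> by simp
      moreover have "value_at s (m$1 * to_fract k) (\<kappa> * poly h s)"
        unfolding hk using value_at_to_fract[of s "smult \<kappa> h"] by simp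
      ultimately have "c * poly k s = \<kappa> * poly h s" by (rule value_at_unique)
      then show ?thesis by simp
    next
      case False
      then have "Fin s \<in># E" "Fin s \<in># F" using s S by (auto simp: S1_def)
      then show ?thesis by (simp add: h_def k_def poly_div_poly_eq_0_iff[symmetric])
    qed
    then have "nodes \<beta>0 \<Delta> \<subseteq> {s. poly (smult c k - smult \<kappa> h) s = 0}" by auto
    then have "card \<Delta> \<le> card {s. poly (smult c k - smult \<kappa> h) s = 0}"
      unfolding card_nodes[symmetric] by (rule card_mono[OF poly_roots_finite[OF nz']])
    also have "\<dots> \<le> degree (smult c k - smult \<kappa> h)"
      by (rule card_poly_roots_bound[OF nz'])
    also have "\<dots> \<le> card \<Delta> - 1"
      using degree_div_poly[of E] degree_div_poly[of F] E F c \<kappa>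
      by (intro degree_diff_le) (auto simp: h_def k_def eff_divs_def)
    finally show False using fin ne by (metis card_gt_0_iff diff_less not_le zero_less_one)
  qed
  then have "smult c k = smult \<kappa> h" by simp
  then have ord: "order a k = order a h" "degree k = degree h" for a
    using c(1) \<kappa>(1) by (metis order_smult, metis degree_smult_eq)
  show ?thesis
  proof (rule multiset_eqI)
    fix x show "count E x = count F x"
    proof (cases x)
      case (Fin a)
      then show ?thesis using ord(1)[of a] by (simp add: h_def k_def order_div_poly)
    next
      \<comment> \<open>The fibre over infinity was discarded; its multiplicity is the difference
        between the common size of the divisors and the common degree.\<close>
      case Infty
      then show ?thesis using ord(2) degree_div_poly[of E] degree_div_poly[of F] E F
        by (simp add: h_def k_def eff_divs_def)
    qed
  qed
qed

end

section \<open>Zero divisors of polynomials\<close>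

lemma proportional_if_same_orders:
  fixes h k :: "complex poly"
  assumes "h \<noteq> 0" "k \<noteq> 0" "\<And>a. order a h = order a k"
  obtains c where "c \<noteq> 0" "h = smult c k"
proof -
  have "\<exists>u. u \<noteq> 0 \<and> value_at b (to_fract h * inverse (to_fract k)) u" for b
  proof -
    obtain x where x: "h = [:- b, 1:] ^ order b k * x" "\<not> [:- b, 1:] dvd x"
      using order_decomp[OF assms(1), of b] assms(3) by metis
    obtain y where y: "k = [:- b, 1:] ^ order b k * y" "\<not> [:- b, 1:] dvd y"
      using order_decomp[OF assms(2), of b] by metis
    have xy: "poly x b \<noteq> 0" "poly y b \<noteq> 0" using x y by (auto simp: poly_eq_0_iff_dvd)
    define t where "t = to_fract ([:- b, 1:] ^ order b k)"
    have "t \<noteq> 0" by (simp add: t_def)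
    have hk: "to_fract h = t * to_fract x" "to_fract k = t * to_fract y"
      unfolding t_def to_fract_mult[symmetric] using x(1) y(1) by simp_all
    have "to_fract h * inverse (to_fract k) = to_fract x * inverse (to_fract y)"
      unfolding hk using \<open>t \<noteq> 0\<close> by (simp add: field_simps)
    moreover have "value_at b (to_fract x * inverse (to_fract y)) (poly x b * inverse (poly y b))"
      by (intro value_at_mult value_at_inverse value_at_to_fract xy)
    ultimately show ?thesis using xy by (intro exI[of _ "poly x b * inverse (poly y b)"]) simp
  qed
  then obtain c where c: "c \<noteq> 0" "to_fract h * inverse (to_fract k) = to_fract [:c:]"
    using value_at_everywhere_nonzero_imp_const by blast
  have "to_fract h = to_fract [:c:] * to_fract k"
    unfolding c(2)[symmetric] using assms(2) by simp
  then have "h = smult c k" by (simp add: to_fract_mult[symmetric])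
  with c that show ?thesis by blast
qed

lemma count_div_of:
  assumes "h \<noteq> 0"
  shows "count (div_of d h) (Fin a) = order a h" "count (div_of d h) Infty = d - degree h"
proof -
  have fin: "finite {a. poly h a = 0}" using assms by (rule poly_roots_finite)
  have "count (\<Sum>a\<in>{a. poly h a = 0}. replicate_mset (order a h) (Fin a)) x
     = (\<Sum>a\<in>{a. poly h a = 0}. if Fin a = x then order a h else 0)" for x
    by (auto simp: count_sum intro!: sum.cong)
  moreover have "(\<Sum>b\<in>{a. poly h a = 0}. if Fin b = Fin a then order b h else 0) = order a h"
    using fin assms by (simp add: order_root)
  moreover have "(\<Sum>b\<in>{a. poly h a = 0}. if Fin b = Infty then order b h else 0) = 0" by simp
  ultimately show "count (div_of d h) (Fin a) = order a h" "count (div_of d h) Infty = d - degree h"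
    unfolding div_of_def by (simp_all add: order_root)
qed

lemma div_of_div_poly: "div_of (size D) (div_poly D) = D"
proof (rule multiset_eqI)
  fix x show "count (div_of (size D) (div_poly D)) x = count D x"
    using degree_div_poly[of D] by (cases x) (auto simp: count_div_of order_div_poly)
qed

lemma div_of_smult: "c \<noteq> 0 \<Longrightarrow> div_of d (smult c h) = div_of d h"
  by (simp add: div_of_def order_smult)

lemma proportional_div_poly:
  assumes "h \<noteq> 0"
  obtains c where "c \<noteq> 0" "h = smult c (div_poly (div_of d h))"
proof -
  have "order a h = order a (div_poly (div_of d h))" for a
    using assms by (simp add: order_div_poly count_div_of)
  from proportional_if_same_orders[OF assms div_poly_nonzero this]
  obtain c where "c \<noteq> 0" "h = smult c (div_poly (div_of d h))" .
  then show ?thesis by (rule that)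
qed

lemma size_div_of:
  assumes "h \<noteq> 0" "degree h \<le> d"
  shows "size (div_of d h) = d"
proof -
  obtain c where c: "c \<noteq> 0" "h = smult c (div_poly (div_of d h))" using proportional_div_poly[OF assms(1)] .
  have "degree h = degree (div_poly (div_of d h))" using arg_cong[OF c(2), of degree] c(1) by simp
  then show ?thesis using degree_div_poly[of "div_of d h"] assms by (simp add: count_div_of)
qed

section \<open>Lines in vector spaces\<close>

lemma line_scale:
  assumes "c \<noteq> 0"
  shows "line (*s) (c *s v) = line (*s) v"
proof -
  have "b *s v = (b / c) *s (c *s v)" for b using assms by simp
  then have "line (*s) v \<subseteq> line (*s) (c *s v)" unfolding line_def by blast
  moreover have "line (*s) (c *s v) \<subseteq> line (*s) v" unfolding line_def by auto
  ultimately show ?thesis by blast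
qed

lemma self_in_line: "v \<in> line (*s) v" "p \<in> line smult p"
proof -
  have "v = 1 *s v" "p = smult 1 p" by simp_all
  then show "v \<in> line (*s) v" "p \<in> line smult p" unfolding line_def by (blast intro: range_eqI)+
qed

lemma line_eq_iff:
  assumes "v \<noteq> 0"
  shows "line (*s) v = line (*s) w \<longleftrightarrow> (\<exists>c. c \<noteq> 0 \<and> w = c *s v)"
proof
  assume *: "line (*s) v = line (*s) w"
  have "w \<in> line (*s) v" "v \<in> line (*s) w" unfolding * using * self_in_line by blast+
  then obtain c c' where c: "w = c *s v" "v = c' *s w" unfolding line_def by blast
  have "c \<noteq> 0"
  proof
    assume "c = 0"
    then have "w = 0" using c(1) by simp
    then show False using c(2) assms by simp
  qed
  with c(1) show "\<exists>c. c \<noteq> 0 \<and> w = c *s v" by blast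
qed (auto simp: line_scale)

lemma line_smult_eq_iff:
  assumes "v \<noteq> 0"
  shows "line smult v = line smult w \<longleftrightarrow> (\<exists>c. c \<noteq> 0 \<and> w = smult c v)"
proof
  assume *: "line smult v = line smult w"
  have "w \<in> line smult v" "v \<in> line smult w" unfolding * using * self_in_line by blast+
  then obtain c c' where c: "w = smult c v" "v = smult c' w" unfolding line_def by blast
  have "c \<noteq> 0"
  proof
    assume "c = 0"
    then have "w = 0" using c(1) by simp
    then show False using c(2) assms by simp
  qed
  with c(1) show "\<exists>c. c \<noteq> 0 \<and> w = smult c v" by blast
next
  assume "\<exists>c. c \<noteq> 0 \<and> w = smult c v"
  then obtain c where c: "c \<noteq> 0" "w = smult c v" by blast
  have "smult b v = smult (b / c) w" for b using c by simp
  then have "line smult v \<subseteq> line smult w" unfolding line_def by blast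
  moreover have "line smult w \<subseteq> line smult v" unfolding line_def c(2) by auto
  ultimately show "line smult v = line smult w" by blast
qed

section \<open>Spectral triples as effective divisors\<close>

text \<open>Finiteness of the frequency set is taken as an assumption because the enumeration by a
  finite type in the final statement supplies it at once.\<close>

locale hsl_setting =
  fixes \<Gamma> :: "complex set" and \<beta>0 :: complex
  assumes lattice: "is_lattice \<Gamma>"
    and \<beta>0_dual: "\<beta>0 \<in> dual_lattice \<Gamma>"
    and freqs_ne: "freqs \<Gamma> \<beta>0 \<noteq> {}"
    and fin_freqs: "finite (freqs \<Gamma> \<beta>0)"
begin

lemma \<beta>0_nz [simp]: "\<beta>0 \<noteq> 0"
proof
  assume "\<beta>0 = 0"
  then show False using freqs_ne by (auto simp: freqs_def)
qed

lemma dual_lattice_diff: "a \<in> dual_lattice \<Gamma> \<Longrightarrow> b \<in> dual_lattice \<Gamma> \<Longrightarrow> a - b \<in> dual_lattice \<Gamma>"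
  by (auto simp: dual_lattice_def inner_diff_left)

lemma dual_lattice_minus: "a \<in> dual_lattice \<Gamma> \<Longrightarrow> - a \<in> dual_lattice \<Gamma>"
  by (auto simp: dual_lattice_def)

lemma freqs_minus: "g \<in> freqs \<Gamma> \<beta>0 \<Longrightarrow> - g \<in> freqs \<Gamma> \<beta>0"
proof -
  assume g: "g \<in> freqs \<Gamma> \<beta>0"
  then obtain d where d: "d \<in> dual_lattice \<Gamma>" "g = d + \<beta>0 / 2" by (auto simp: freqs_def)
  have "- d - \<beta>0 \<in> dual_lattice \<Gamma>" using d(1) \<beta>0_dual by (intro dual_lattice_diff dual_lattice_minus)
  moreover have "- g = (- d - \<beta>0) + \<beta>0 / 2" using d(2) by (simp add: field_simps)
  ultimately have "\<exists>\<delta>\<in>dual_lattice \<Gamma>. - g = \<delta> + \<beta>0 / 2" by blast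
  moreover have "cmod (- g) = cmod \<beta>0 / 2" "- g \<noteq> \<beta>0 / 2" "- g \<noteq> - (\<beta>0 / 2)"
    using g by (auto simp: freqs_def minus_equation_iff[of g] equation_minus_iff[of g])
  ultimately show ?thesis unfolding freqs_def by blast
qed

lemma inj_node: "inj_on (node \<beta>0) A"
  by (auto simp: node_def inj_on_def)

lemma node_minus [simp]: "node \<beta>0 (- g) = - node \<beta>0 g"
  by (simp add: node_def)

lemma norm_node: "g \<in> freqs \<Gamma> \<beta>0 \<Longrightarrow> cmod (node \<beta>0 g) = 1"
  by (auto simp: freqs_def node_def norm_divide norm_mult)

lemma nodes_minus_iff: "admissible \<Gamma> \<beta>0 \<Delta> \<Longrightarrow> - s \<in> nodes \<beta>0 \<Delta> \<longleftrightarrow> s \<in> nodes \<beta>0 \<Delta>"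
proof -
  assume "admissible \<Gamma> \<beta>0 \<Delta>"
  then have "- g \<in> \<Delta>" if "g \<in> \<Delta>" for g using that by (auto simp: admissible_def)
  then have "- s \<in> nodes \<beta>0 \<Delta>" if "s \<in> nodes \<beta>0 \<Delta>" for s using that
    unfolding nodes_def by (auto simp: image_iff intro!: bexI[of _ "- _"])
  then show ?thesis by (metis minus_minus)
qed

lemma admissible_freqs: "admissible \<Gamma> \<beta>0 (freqs \<Gamma> \<beta>0)"
  using freqs_ne freqs_minus by (auto simp: admissible_def image_iff) (metis minus_minus)

lemma admissible_finite: "admissible \<Gamma> \<beta>0 \<Delta> \<Longrightarrow> finite \<Delta>"
  using fin_freqs by (auto simp: admissible_def intro: finite_subset)

lemma admissible_facts:
  assumes "admissible \<Gamma> \<beta>0 \<Delta>"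
  shows "finite \<Delta>" "\<Delta> \<noteq> {}" "\<And>s. s \<in> nodes \<beta>0 \<Delta> \<Longrightarrow> cmod s = 1" "card (nodes \<beta>0 \<Delta>) = card \<Delta>"
    "uminus ` nodes \<beta>0 \<Delta> = nodes \<beta>0 \<Delta>" "finite (nodes \<beta>0 \<Delta>)"
    "nodes \<beta>0 \<Delta> \<subseteq> nodes \<beta>0 (freqs \<Gamma> \<beta>0)" "card \<Delta> \<le> card (freqs \<Gamma> \<beta>0)" "card \<Delta> > 0"
proof -
  show f: "finite \<Delta>" and ne: "\<Delta> \<noteq> {}" using assms admissible_finite by (auto simp: admissible_def)
  then show "finite (nodes \<beta>0 \<Delta>)" "card \<Delta> > 0" by (auto simp: nodes_def card_gt_0_iff)
  show "card (nodes \<beta>0 \<Delta>) = card \<Delta>" unfolding nodes_def by (rule card_image[OF inj_node])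
  have sub: "\<Delta> \<subseteq> freqs \<Gamma> \<beta>0" using assms by (auto simp: admissible_def)
  then show "cmod s = 1" if "s \<in> nodes \<beta>0 \<Delta>" for s using that norm_node by (auto simp: nodes_def)
  show "uminus ` nodes \<beta>0 \<Delta> = nodes \<beta>0 \<Delta>"
    using nodes_minus_iff[OF assms] by (auto simp: image_iff) (metis minus_minus)
  show "nodes \<beta>0 \<Delta> \<subseteq> nodes \<beta>0 (freqs \<Gamma> \<beta>0)" using sub by (auto simp: nodes_def)
  show "card \<Delta> \<le> card (freqs \<Gamma> \<beta>0)" using sub fin_freqs by (rule card_mono[rotated])
qed

text \<open>The set of points already determines \<Delta>. Over a node of \<Delta> that is no node
  of \<Delta>' the component C_1 of the second curve has Z_1 nonzero, while the equation of the
  first curve reduces there to Z_1 squared = 0.\<close>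

lemma curve_X_fam_inj:
  assumes "admissible \<Gamma> \<beta>0 \<Delta>" "admissible \<Gamma> \<beta>0 \<Delta>'" "curve (X_fam \<beta>0 \<Delta>) = curve (X_fam \<beta>0 \<Delta>')"
  shows "\<Delta> \<subseteq> \<Delta>'"
proof
  fix g assume g: "g \<in> \<Delta>"
  define a where "a = node \<beta>0 g"
  have a: "a \<in> nodes \<beta>0 \<Delta>" using g by (simp add: a_def nodes_def)
  then have a0: "a \<noteq> 0" using admissible_facts(3)[OF assms(1)] by fastforce
  have "a \<in> nodes \<beta>0 \<Delta>'"
  proof (rule ccontr)
    assume "a \<notin> nodes \<beta>0 \<Delta>'"
    then have nz: "poly (node_poly (nodes \<beta>0 \<Delta>')) a \<noteq> 0"
      using poly_node_poly_eq_0_iff admissible_facts(6)[OF assms(2)] by blast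
    have "on_comp (X_fam \<beta>0 \<Delta>') 1 (Fin a) \<in> curve (X_fam \<beta>0 \<Delta>)"
      using on_comp_in_curve assms(3) by metis
    then have "param (X_fam \<beta>0 \<Delta>') 1 a \<in> affine_curve (X_fam \<beta>0 \<Delta>)" using a0 by (auto simp: curve_def)
    then have "poly (node_poly (nodes \<beta>0 \<Delta>')) a *
      (poly (node_poly (nodes \<beta>0 \<Delta>')) a - poly (node_poly (nodes \<beta>0 \<Delta>)) a) = 0"
    proof -
      define Z where "Z = param (X_fam \<beta>0 \<Delta>') 1 a"
      assume "param (X_fam \<beta>0 \<Delta>') 1 a \<in> affine_curve (X_fam \<beta>0 \<Delta>)"
      then have "\<forall>j. j \<noteq> 5 \<longrightarrow> Z$j * (Z$j - poly (X_fam \<beta>0 \<Delta> j) (Z$5)) = 0"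
        unfolding Z_def affine_curve_def by blast
      from this[rule_format, of 1] show ?thesis by (simp add: Z_def param_def X_fam_def)
    qed
    moreover have "poly (node_poly (nodes \<beta>0 \<Delta>)) a = 0"
      using a poly_node_poly_eq_0_iff admissible_facts(6)[OF assms(1)] by blast
    ultimately show False using nz by simp
  qed
  then show "g \<in> \<Delta>'" using inj_node[of UNIV] by (auto simp: nodes_def a_def inj_on_def)
qed

lemma sheaf_iso_refl: "sheaf_iso q F F"
  unfolding sheaf_iso_def by (intro exI[of _ "\<lambda>U g. g"]) (auto simp: bij_betw_def)

lemma triple_inj:
  assumes "admissible \<Gamma> \<beta>0 \<Delta>" "admissible \<Gamma> \<beta>0 \<Delta>'" "E \<in> eff_divs \<beta>0 \<Delta>" "E' \<in> eff_divs \<beta>0 \<Delta>'"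
    and "triple \<beta>0 \<Delta> E = triple \<beta>0 \<Delta>' E'"
  shows "\<Delta> = \<Delta>' \<and> E = E'"
proof -
  have "curve (X_fam \<beta>0 \<Delta>) = curve (X_fam \<beta>0 \<Delta>')" using assms(5) by (simp add: triple_def Let_def)
  then have D: "\<Delta> = \<Delta>'" using curve_X_fam_inj assms(1,2) by (metis subset_antisym)
  have "iso_class (X_fam \<beta>0 \<Delta>) (L_sheaf \<beta>0 \<Delta> E) = iso_class (X_fam \<beta>0 \<Delta>) (L_sheaf \<beta>0 \<Delta> E')"
    using assms(5) D by (simp add: triple_def Let_def)
  then have "sheaf_iso (X_fam \<beta>0 \<Delta>) (L_sheaf \<beta>0 \<Delta> E) (L_sheaf \<beta>0 \<Delta> E')"
    using sheaf_iso_refl by (auto simp: iso_class_def)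
  then have "E = E'" using L_sheaf_iso_imp_eq admissible_facts[OF assms(1)] assms(3,4) D by metis
  with D show ?thesis by simp
qed

definition full_div :: "complex set \<Rightarrow> csphere multiset \<Rightarrow> csphere multiset"
  where "full_div \<Delta> E = E + mset_set (Fin ` (nodes \<beta>0 (freqs \<Gamma> \<beta>0) - nodes \<beta>0 \<Delta>))"

lemma total_div_triple:
  assumes "admissible \<Gamma> \<beta>0 \<Delta>" "E \<in> eff_divs \<beta>0 \<Delta>"
  shows "total_div \<Gamma> \<beta>0 (triple \<beta>0 \<Delta> E) = full_div \<Delta> E"
  unfolding total_div_def full_div_def[symmetric]
proof (rule the_equality)
  show "\<exists>\<Delta>' E'. admissible \<Gamma> \<beta>0 \<Delta>' \<and> E' \<in> eff_divs \<beta>0 \<Delta>' \<and>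
      triple \<beta>0 \<Delta> E = triple \<beta>0 \<Delta>' E' \<and> full_div \<Delta> E = full_div \<Delta>' E'"
    using assms by blast
  fix D assume "\<exists>\<Delta>' E'. admissible \<Gamma> \<beta>0 \<Delta>' \<and> E' \<in> eff_divs \<beta>0 \<Delta>' \<and>
      triple \<beta>0 \<Delta> E = triple \<beta>0 \<Delta>' E' \<and> D = full_div \<Delta>' E'"
  then show "D = full_div \<Delta> E" using triple_inj[OF assms(1) _ assms(2)] by blast
qed

lemma finite_all_nodes: "finite (nodes \<beta>0 (freqs \<Gamma> \<beta>0))"
  using fin_freqs by (simp add: nodes_def)

lemma size_full_div:
  assumes "admissible \<Gamma> \<beta>0 \<Delta>" "E \<in> eff_divs \<beta>0 \<Delta>"
  shows "size (full_div \<Delta> E) = card (freqs \<Gamma> \<beta>0) - 1"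
proof -
  note A = admissible_facts[OF assms(1)] and B = admissible_facts[OF admissible_freqs]
  have "card (Fin ` (nodes \<beta>0 (freqs \<Gamma> \<beta>0) - nodes \<beta>0 \<Delta>)) = card (nodes \<beta>0 (freqs \<Gamma> \<beta>0)) - card (nodes \<beta>0 \<Delta>)"
    by (subst card_image) (auto simp: inj_on_def card_Diff_subset[OF A(6,7)])
  then show ?thesis using assms(2) A B by (simp add: full_div_def eff_divs_def)
qed

text \<open>Nodes outside \<Delta> are added in antipodal pairs, whereas \<open>eff_divs\<close>
  forbids E to contain both s and -s for a node of \<Delta>. So antipodal pairs in the support mark
  exactly the nodes that were left out.\<close>

lemma nodes_eq_full_div:
  assumes "admissible \<Gamma> \<beta>0 \<Delta>" "E \<in> eff_divs \<beta>0 \<Delta>"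
  shows "nodes \<beta>0 \<Delta> = {s \<in> nodes \<beta>0 (freqs \<Gamma> \<beta>0). \<not> (Fin s \<in># full_div \<Delta> E \<and> Fin (- s) \<in># full_div \<Delta> E)}"
proof -
  have mem: "Fin s \<in># full_div \<Delta> E \<longleftrightarrow> Fin s \<in># E \<or> s \<in> nodes \<beta>0 (freqs \<Gamma> \<beta>0) - nodes \<beta>0 \<Delta>" for s
    using finite_all_nodes by (auto simp: full_div_def)
  show ?thesis
    using assms(2) admissible_facts(7)[OF assms(1)] nodes_minus_iff[OF assms(1)]
      nodes_minus_iff[OF admissible_freqs]
    unfolding mem eff_divs_def by auto
qed

lemma full_div_inj:
  assumes "admissible \<Gamma> \<beta>0 \<Delta>" "E \<in> eff_divs \<beta>0 \<Delta>" "admissible \<Gamma> \<beta>0 \<Delta>'" "E' \<in> eff_divs \<beta>0 \<Delta>'"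
    and "full_div \<Delta> E = full_div \<Delta>' E'"
  shows "\<Delta> = \<Delta>' \<and> E = E'"
proof -
  have "nodes \<beta>0 \<Delta> = nodes \<beta>0 \<Delta>'"
    using nodes_eq_full_div[OF assms(1,2)] nodes_eq_full_div[OF assms(3,4)] assms(5) by simp
  then have "\<Delta> = \<Delta>'" unfolding nodes_def by (metis inj_image_eq_iff inj_node)
  with assms(5) show ?thesis by (simp add: full_div_def)
qed

lemma full_div_surj:
  fixes D :: "csphere multiset"
  assumes "size D = card (freqs \<Gamma> \<beta>0) - 1"
  obtains \<Delta> E where "admissible \<Gamma> \<beta>0 \<Delta>" "E \<in> eff_divs \<beta>0 \<Delta>" "full_div \<Delta> E = D"
proof -
  note B = admissible_facts[OF admissible_freqs]
  \<comment> \<open>Forced by \<open>nodes_eq_full_div\<close>: the frequencies to omit are those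
    whose nodes occur in D together with their antipodes.\<close>
  define \<Delta> where "\<Delta> = {g \<in> freqs \<Gamma> \<beta>0. \<not> (Fin (node \<beta>0 g) \<in># D \<and> Fin (- node \<beta>0 g) \<in># D)}"
  define R where "R = nodes \<beta>0 (freqs \<Gamma> \<beta>0) - nodes \<beta>0 \<Delta>"
  have R: "R = node \<beta>0 ` (freqs \<Gamma> \<beta>0 - \<Delta>)"
    unfolding R_def nodes_def by (rule image_set_diff[symmetric, OF inj_node])
  have finR: "finite R" using fin_freqs by (simp add: R)
  have inj: "inj_on Fin R" by (auto simp: inj_on_def)
  have sub: "mset_set (Fin ` R) \<subseteq># D"
  proof (rule mset_subset_eqI)
    fix x show "count (mset_set (Fin ` R)) x \<le> count D x"
      using finR by (auto simp: count_mset_set' R \<Delta>_def Suc_le_eq)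
  qed
  have cR: "card R = card (freqs \<Gamma> \<beta>0) - card \<Delta>"
    unfolding R by (subst card_image[OF inj_node], subst card_Diff_subset) (auto simp: \<Delta>_def fin_freqs)
  \<comment> \<open>The degree N - 1 is one too small for D to contain all N nodes.\<close>
  have ne: "\<Delta> \<noteq> {}"
  proof
    assume "\<Delta> = {}"
    then have "card (freqs \<Gamma> \<beta>0) = size (mset_set (Fin ` R))" using cR by (simp add: card_image[OF inj])
    also have "\<dots> \<le> size D" using sub by (rule size_mset_mono)
    finally show False using assms B(9) by simp
  qed
  have minus: "- g \<in> \<Delta>" if "g \<in> \<Delta>" for g using that freqs_minus by (auto simp: \<Delta>_def)
  have adm: "admissible \<Gamma> \<beta>0 \<Delta>" unfolding admissible_def
  proof (intro conjI)
    show "uminus ` \<Delta> = \<Delta>" using minus by (auto simp: image_iff) (metis minus_minus)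
  qed (use ne in \<open>auto simp: \<Delta>_def\<close>)
  define E where "E = D - mset_set (Fin ` R)"
  have "size E = card \<Delta> - 1"
    using sub assms cR admissible_facts(8,9)[OF adm]
    by (simp add: E_def size_Diff_submset card_image[OF inj])
  moreover have "Fin s \<notin># E \<or> Fin (- s) \<notin># E" if "s \<in> nodes \<beta>0 \<Delta>" for s
    using that by (auto simp: nodes_def \<Delta>_def E_def dest: in_diffD)
  ultimately have "E \<in> eff_divs \<beta>0 \<Delta>" by (auto simp: eff_divs_def)
  moreover have "full_div \<Delta> E = D" using sub by (simp add: full_div_def E_def R_def)
  ultimately show ?thesis using that adm by blast
qed

lemma bij_total_div:
  "bij_betw (total_div \<Gamma> \<beta>0) (spectral_triples \<Gamma> \<beta>0) {D. size D = card (freqs \<Gamma> \<beta>0) - 1}"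
  unfolding bij_betw_def
proof
  show "inj_on (total_div \<Gamma> \<beta>0) (spectral_triples \<Gamma> \<beta>0)"
  proof (rule inj_onI)
    fix \<sigma> \<sigma>' assume "\<sigma> \<in> spectral_triples \<Gamma> \<beta>0" "\<sigma>' \<in> spectral_triples \<Gamma> \<beta>0"
      and eq: "total_div \<Gamma> \<beta>0 \<sigma> = total_div \<Gamma> \<beta>0 \<sigma>'"
    then obtain \<Delta> E \<Delta>' E' where *: "admissible \<Gamma> \<beta>0 \<Delta>" "E \<in> eff_divs \<beta>0 \<Delta>" "\<sigma> = triple \<beta>0 \<Delta> E"
      "admissible \<Gamma> \<beta>0 \<Delta>'" "E' \<in> eff_divs \<beta>0 \<Delta>'" "\<sigma>' = triple \<beta>0 \<Delta>' E'"
      unfolding spectral_triples_def by blast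
    then have "full_div \<Delta> E = full_div \<Delta>' E'" using eq by (simp add: total_div_triple)
    then show "\<sigma> = \<sigma>'" using full_div_inj[OF *(1,2,4,5)] *(3,6) by simp
  qed
  show "total_div \<Gamma> \<beta>0 ` spectral_triples \<Gamma> \<beta>0 = {D. size D = card (freqs \<Gamma> \<beta>0) - 1}"
  proof (intro set_eqI iffI)
    fix D :: "csphere multiset" assume "D \<in> {D. size D = card (freqs \<Gamma> \<beta>0) - 1}"
    then obtain \<Delta> E where "admissible \<Gamma> \<beta>0 \<Delta>" "E \<in> eff_divs \<beta>0 \<Delta>" "full_div \<Delta> E = D"
      using full_div_surj by blast
    then show "D \<in> total_div \<Gamma> \<beta>0 ` spectral_triples \<Gamma> \<beta>0"
      using total_div_triple by (force simp: spectral_triples_def)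
  qed (auto simp: spectral_triples_def total_div_triple size_full_div)
qed

lemma poly_line_eq:
  assumes "size (total_div \<Gamma> \<beta>0 \<sigma>) = card (freqs \<Gamma> \<beta>0) - 1"
  shows "poly_line \<Gamma> \<beta>0 \<sigma> = line smult (div_poly (total_div \<Gamma> \<beta>0 \<sigma>))"
proof (intro set_eqI iffI)
  define D where "D = total_div \<Gamma> \<beta>0 \<sigma>"
  have D: "div_of (card (freqs \<Gamma> \<beta>0) - 1) (div_poly D) = D" "degree (div_poly D) \<le> card (freqs \<Gamma> \<beta>0) - 1"
    using div_of_div_poly[of D] degree_div_poly[of D] assms by (simp_all add: D_def)
  fix h
  {
    assume "h \<in> poly_line \<Gamma> \<beta>0 \<sigma>"
    then show "h \<in> line smult (div_poly D)"
    proof (cases "h = 0")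
      case True
      then have "h = smult 0 (div_poly D)" by simp
      then show ?thesis unfolding line_def by (rule range_eqI)
    next
      case False
      assume "h \<in> poly_line \<Gamma> \<beta>0 \<sigma>"
      with False have "div_of (card (freqs \<Gamma> \<beta>0) - 1) h = D" by (simp add: poly_line_def D_def)
      with proportional_div_poly[OF False] obtain c where "h = smult c (div_poly D)" by blast
      then show ?thesis unfolding line_def by (rule range_eqI)
    qed
  next
    assume "h \<in> line smult (div_poly D)"
    then obtain c where c: "h = smult c (div_poly D)" by (auto simp: line_def)
    have "degree h \<le> card (freqs \<Gamma> \<beta>0) - 1"
      unfolding c by (rule order_trans[OF degree_smult_le D(2)])
    moreover have "h = 0 \<or> div_of (card (freqs \<Gamma> \<beta>0) - 1) h = D"
      using c D(1) by (cases "c = 0") (auto simp: div_of_smult)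
    ultimately show "h \<in> poly_line \<Gamma> \<beta>0 \<sigma>" by (simp add: poly_line_def polys_def D_def)
  }
qed

lemma bij_line_div_poly:
  "bij_betw (\<lambda>D. line smult (div_poly D)) {D. size D = card (freqs \<Gamma> \<beta>0) - 1} (proj_space smult (polys \<Gamma> \<beta>0))"
  unfolding bij_betw_def
proof
  show "inj_on (\<lambda>D. line smult (div_poly D)) {D. size D = card (freqs \<Gamma> \<beta>0) - 1}"
  proof (rule inj_onI)
    fix D D' assume *: "D \<in> {D. size D = card (freqs \<Gamma> \<beta>0) - 1}" "D' \<in> {D. size D = card (freqs \<Gamma> \<beta>0) - 1}"
      "line smult (div_poly D) = line smult (div_poly D')"
    then obtain c where "c \<noteq> 0" "div_poly D' = smult c (div_poly D)" by (auto simp: line_smult_eq_iff)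
    then show "D = D'" using * div_of_div_poly[of D] div_of_div_poly[of D'] by (simp add: div_of_smult)
  qed
  show "(\<lambda>D. line smult (div_poly D)) ` {D. size D = card (freqs \<Gamma> \<beta>0) - 1} = proj_space smult (polys \<Gamma> \<beta>0)"
  proof (intro set_eqI iffI)
    fix P assume "P \<in> (\<lambda>D. line smult (div_poly D)) ` {D. size D = card (freqs \<Gamma> \<beta>0) - 1}"
    then obtain D where D: "P = line smult (div_poly D)" "size D = card (freqs \<Gamma> \<beta>0) - 1" by auto
    then have "degree (div_poly D) \<le> card (freqs \<Gamma> \<beta>0) - 1" using degree_div_poly[of D] by simp
    then show "P \<in> proj_space smult (polys \<Gamma> \<beta>0)" by (auto simp: D proj_space_def polys_def)
  next
    fix P assume "P \<in> proj_space smult (polys \<Gamma> \<beta>0)"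
    then obtain h where h: "P = line smult h" "h \<noteq> 0" "degree h \<le> card (freqs \<Gamma> \<beta>0) - 1"
      by (auto simp: proj_space_def polys_def)
    define D where "D = div_of (card (freqs \<Gamma> \<beta>0) - 1) h"
    obtain c where "c \<noteq> 0" "h = smult c (div_poly D)"
      using proportional_div_poly[OF h(2)] unfolding D_def by blast
    then have "line smult (div_poly D) = P" unfolding h(1) by (subst line_smult_eq_iff) auto
    moreover have "size D = card (freqs \<Gamma> \<beta>0) - 1" unfolding D_def using h(2,3) by (rule size_div_of)
    ultimately show "P \<in> (\<lambda>D. line smult (div_poly D)) ` {D. size D = card (freqs \<Gamma> \<beta>0) - 1}" by blast
  qed
qed

lemma bij_poly_line: "bij_betw (poly_line \<Gamma> \<beta>0) (spectral_triples \<Gamma> \<beta>0) (proj_space smult (polys \<Gamma> \<beta>0))"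
proof -
  have "bij_betw ((\<lambda>D. line smult (div_poly D)) \<circ> total_div \<Gamma> \<beta>0)
    (spectral_triples \<Gamma> \<beta>0) (proj_space smult (polys \<Gamma> \<beta>0))"
    by (rule bij_betw_trans[OF bij_total_div bij_line_div_poly])
  moreover have "size (total_div \<Gamma> \<beta>0 \<sigma>) = card (freqs \<Gamma> \<beta>0) - 1" if "\<sigma> \<in> spectral_triples \<Gamma> \<beta>0" for \<sigma>
    using bij_total_div that by (auto simp: bij_betw_def)
  ultimately show ?thesis by (subst bij_betw_cong) (auto simp: poly_line_eq)
qed

end

section \<open>Evaluation at the nodes and the map \<Phi>\<close>

locale hsl_frequencies = hsl_setting +
  fixes \<gamma> :: "'n::finite \<Rightarrow> complex"
  assumes bij_\<gamma>: "bij_betw \<gamma> UNIV (freqs \<Gamma> \<beta>0)"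
begin

definition nd :: "'n \<Rightarrow> complex" where "nd j = node \<beta>0 (\<gamma> j)"

lemma inj_nd: "inj nd"
  using bij_\<gamma> inj_node[of UNIV] by (auto simp: nd_def inj_on_def bij_betw_def)

lemma card_n: "card (freqs \<Gamma> \<beta>0) = CARD('n)"
  using bij_betw_same_card[OF bij_\<gamma>] by simp

definition eval_nodes :: "complex poly \<Rightarrow> complex ^ 'n"
  where "eval_nodes h = (\<chi> j. poly h (nd j))"

lemma eval_nodes_simps:
  "eval_nodes (h + k) = eval_nodes h + eval_nodes k" "eval_nodes (smult c h) = c *s eval_nodes h"
  "eval_nodes (h - k) = eval_nodes h - eval_nodes k" "eval_nodes 0 = 0"
  by (auto simp: eval_nodes_def vec_eq_iff)

lemma eval_nodes_eq_0:
  assumes "h \<in> polys \<Gamma> \<beta>0" "eval_nodes h = 0"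
  shows "h = 0"
proof (rule ccontr)
  assume h: "h \<noteq> 0"
  have "range nd \<subseteq> {a. poly h a = 0}" using assms(2) by (auto simp: eval_nodes_def vec_eq_iff)
  then have "CARD('n) \<le> card {a. poly h a = 0}" unfolding card_image[OF inj_nd, symmetric]
    by (rule card_mono[OF poly_roots_finite[OF h]])
  also have "\<dots> \<le> degree h" by (rule card_poly_roots_bound[OF h])
  also have "\<dots> \<le> CARD('n) - 1" using assms(1) card_n by (simp add: polys_def)
  finally show False using zero_less_card_finite[where 'a='n] by linarith
qed

text \<open>There are N distinct nodes for a polynomial of degree at most N - 1: injective by
  counting roots, onto by Lagrange interpolation. This linear map induces \<Phi>.\<close>

lemma bij_eval_nodes: "bij_betw eval_nodes (polys \<Gamma> \<beta>0) UNIV"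
  unfolding bij_betw_def
proof
  show "inj_on eval_nodes (polys \<Gamma> \<beta>0)"
  proof (rule inj_onI)
    fix h k assume *: "h \<in> polys \<Gamma> \<beta>0" "k \<in> polys \<Gamma> \<beta>0" "eval_nodes h = eval_nodes k"
    then have "h - k \<in> polys \<Gamma> \<beta>0" by (auto simp: polys_def intro: degree_diff_le)
    then show "h = k" using eval_nodes_eq_0[of "h - k"] * by (simp add: eval_nodes_simps)
  qed
  have "t \<in> eval_nodes ` polys \<Gamma> \<beta>0" for t
  proof -
    define b where "b j = (\<Prod>m\<in>UNIV - {j}. [:- nd m, 1:])" for j
    define h where "h = (\<Sum>j\<in>UNIV. smult (t$j / poly (b j) (nd j)) (b j))"
    have bj: "poly (b j) (nd i) = 0 \<longleftrightarrow> i \<noteq> j" for i j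
      using inj_nd by (auto simp: b_def poly_prod inj_on_def)
    have "degree (b j) \<le> card (freqs \<Gamma> \<beta>0) - 1" for j
      unfolding b_def card_n by (rule order_trans[OF degree_prod_sum_le]) (auto simp: card_Diff_singleton)
    then have "h \<in> polys \<Gamma> \<beta>0" unfolding h_def polys_def
      by (auto intro!: degree_sum_le order_trans[OF degree_smult_le])
    moreover have "poly h (nd i) = t$i" for i
    proof -
      have "poly h (nd i) = (\<Sum>j\<in>UNIV. if j = i then t$j else 0)"
        unfolding h_def poly_sum by (rule sum.cong) (auto simp: bj)
      then show ?thesis by simp
    qed
    ultimately show ?thesis by (auto simp: image_iff eval_nodes_def vec_eq_iff intro!: bexI[of _ h])
  qed
  then show "eval_nodes ` polys \<Gamma> \<beta>0 = UNIV" by blast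
qed

lemma Phi_eq:
  assumes "poly_line \<Gamma> \<beta>0 \<sigma> = line smult h" "h \<noteq> 0"
  shows "Phi \<Gamma> \<beta>0 \<gamma> \<sigma> = line (*s) (eval_nodes h)"
proof -
  have "Phi \<Gamma> \<beta>0 \<gamma> \<sigma> = (THE P. \<exists>k\<in>poly_line \<Gamma> \<beta>0 \<sigma> - {0}. P = line (*s) (eval_nodes k))"
    by (simp add: Phi_def eval_nodes_def nd_def)
  also have "\<dots> = line (*s) (eval_nodes h)"
  proof (rule the_equality)
    have "h \<in> line smult h" by (rule self_in_line)
    then show "\<exists>k\<in>poly_line \<Gamma> \<beta>0 \<sigma> - {0}. line (*s) (eval_nodes h) = line (*s) (eval_nodes k)"
      using assms by blast
  next
    fix P assume "\<exists>k\<in>poly_line \<Gamma> \<beta>0 \<sigma> - {0}. P = line (*s) (eval_nodes k)"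
    then obtain k where k: "k \<in> line smult h" "k \<noteq> 0" "P = line (*s) (eval_nodes k)"
      unfolding assms(1) by blast
    then obtain c where c: "k = smult c h" by (auto simp: line_def)
    with k have "c \<noteq> 0" "P = line (*s) (eval_nodes (smult c h))" by auto
    then show "P = line (*s) (eval_nodes h)" by (simp add: eval_nodes_simps line_scale)
  qed
  finally show ?thesis .
qed

text \<open>A line of polynomials has no distinguished generator, so \<open>SOME\<close> picks one;
  \<open>F\<close> below shows that the resulting line does not depend on the choice.\<close>

lemma bij_line_image:
  "bij_betw (\<lambda>P. line (*s) (eval_nodes (SOME h. h \<noteq> 0 \<and> P =
    line smult h))) (proj_space smult (polys \<Gamma> \<beta>0)) CP"
  (is "bij_betw ?F _ _")
proof -
  have F: "?F (line smult h) = line (*s) (eval_nodes h)" if hnz: "h \<noteq> 0" for h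
  proof -
    have "(SOME k. k \<noteq> 0 \<and> line smult h = line smult k) \<noteq> 0 \<and>
       line smult h = line smult (SOME k. k \<noteq> 0 \<and> line smult h = line smult k)"
      by (rule someI[of _ h]) (use hnz in auto)
    then obtain c where c: "c \<noteq> 0" "(SOME k. k \<noteq> 0 \<and> line smult h = line smult k) = smult c h"
      using line_smult_eq_iff[OF hnz] by metis
    show ?thesis unfolding c(2) using c(1) by (simp add: eval_nodes_simps line_scale)
  qed
  show ?thesis unfolding bij_betw_def
  proof
    show "inj_on ?F (proj_space smult (polys \<Gamma> \<beta>0))"
    proof (rule inj_onI)
      fix P Q assume "P \<in> proj_space smult (polys \<Gamma> \<beta>0)" "Q \<in> proj_space smult (polys \<Gamma> \<beta>0)"
        and FPQ: "?F P = ?F Q"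
      then obtain h k where h: "P = line smult h" "h \<noteq> 0" "h \<in> polys \<Gamma> \<beta>0"
        and k: "Q = line smult k" "k \<noteq> 0" "k \<in> polys \<Gamma> \<beta>0"
        by (auto simp: proj_space_def)
      have "eval_nodes h \<noteq> 0" using eval_nodes_eq_0 h by blast
      moreover have "line (*s) (eval_nodes h) = line (*s) (eval_nodes k)"
        using FPQ unfolding h(1) k(1) F[OF h(2)] F[OF k(2)] .
      ultimately obtain c where c: "c \<noteq> 0" "eval_nodes k = c *s eval_nodes h"
        by (auto simp: line_eq_iff)
      have "smult c h \<in> polys \<Gamma> \<beta>0" using h(3) degree_smult_le[of c h] by (auto simp: polys_def)
      then have "k = smult c h"
        using bij_eval_nodes k(3) c(2) unfolding bij_betw_def inj_on_def by (auto simp: eval_nodes_simps)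
      then show "P = Q" unfolding h(1) k(1) using line_smult_eq_iff[OF h(2)] c(1) by blast
    qed
    show "?F ` proj_space smult (polys \<Gamma> \<beta>0) = CP"
    proof (intro set_eqI iffI)
      fix L assume "L \<in> ?F ` proj_space smult (polys \<Gamma> \<beta>0)"
      then obtain P where P: "P \<in> proj_space smult (polys \<Gamma> \<beta>0)" "L = ?F P" by blast
      then obtain h where h: "h \<noteq> 0" "h \<in> polys \<Gamma> \<beta>0" "P = line smult h"
        by (auto simp: proj_space_def)
      then have h: "h \<noteq> 0" "h \<in> polys \<Gamma> \<beta>0" "L = line (*s) (eval_nodes h)"
        using P(2) F[OF h(1)] by simp_all
      then have "eval_nodes h \<noteq> 0" using eval_nodes_eq_0 by blast
      then show "L \<in> CP" using h(3) by (auto simp: proj_space_def)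
    next
      fix L :: "(complex ^ 'n) set" assume "L \<in> CP"
      then obtain t where t: "L = line (*s) t" "t \<noteq> 0" by (auto simp: proj_space_def)
      obtain h where h: "h \<in> polys \<Gamma> \<beta>0" "t = eval_nodes h"
        using bij_eval_nodes unfolding bij_betw_def by blast
      with t have "h \<noteq> 0" by (auto simp: eval_nodes_simps)
      have "L = ?F (line smult h)" unfolding F[OF \<open>h \<noteq> 0\<close>] t(1) h(2) ..
      then show "L \<in> ?F ` proj_space smult (polys \<Gamma> \<beta>0)"
        using h(1) \<open>h \<noteq> 0\<close> by (auto simp: proj_space_def)
    qed
  qed
qed

lemma poly_line_ex:
  assumes "\<sigma> \<in> spectral_triples \<Gamma> \<beta>0"
  obtains h where "h \<noteq> 0" "h \<in> polys \<Gamma> \<beta>0" "poly_line \<Gamma> \<beta>0 \<sigma> = line smult h"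
proof -
  have "poly_line \<Gamma> \<beta>0 \<sigma> \<in> proj_space smult (polys \<Gamma> \<beta>0)" using bij_poly_line assms
    by (auto simp: bij_betw_def)
  then show ?thesis using that by (auto simp: proj_space_def)
qed

lemma bij_Phi: "bij_betw (Phi \<Gamma> \<beta>0 \<gamma>) (spectral_triples \<Gamma> \<beta>0) CP"
proof -
  let ?F = "\<lambda>P. line (*s) (eval_nodes (SOME h. h \<noteq> 0 \<and> P = line smult h))"
  have "bij_betw (?F \<circ> poly_line \<Gamma> \<beta>0) (spectral_triples \<Gamma> \<beta>0) CP"
    by (rule bij_betw_trans[OF bij_poly_line bij_line_image])
  moreover have "(?F \<circ> poly_line \<Gamma> \<beta>0) \<sigma> = Phi \<Gamma> \<beta>0 \<gamma> \<sigma>" if \<sigma>: "\<sigma> \<in> spectral_triples \<Gamma> \<beta>0" for \<sigma>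
  proof -
    obtain h where h: "h \<noteq> 0" "poly_line \<Gamma> \<beta>0 \<sigma> = line smult h" by (rule poly_line_ex[OF \<sigma>])
    have "(SOME k. k \<noteq> 0 \<and> line smult h = line smult k) \<noteq> 0 \<and>
       line smult h = line smult (SOME k. k \<noteq> 0 \<and> line smult h = line smult k)"
      by (rule someI[of "\<lambda>k. k \<noteq> 0 \<and> line smult h = line smult k" h]) (use h(1) in simp)
    then have "Phi \<Gamma> \<beta>0 \<gamma> \<sigma> = line (*s) (eval_nodes (SOME k. k \<noteq> 0 \<and> line smult h = line smult k))"
      using h(2) by (intro Phi_eq) simp_all
    then show ?thesis unfolding o_def h(2) ..
  qed
  ultimately show ?thesis by (subst bij_betw_cong[symmetric]) auto
qed

lemma proj_isomorphism_Phi: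
  "proj_isomorphism smult (polys \<Gamma> \<beta>0) (*s) UNIV
     (Phi \<Gamma> \<beta>0 \<gamma> \<circ> inv_into (spectral_triples \<Gamma> \<beta>0) (poly_line \<Gamma> \<beta>0))"
  unfolding proj_isomorphism_def
proof (intro exI[of _ eval_nodes] conjI ballI allI bij_eval_nodes eval_nodes_simps)
  fix h assume "h \<in> polys \<Gamma> \<beta>0 - {0}"
  then have h: "h \<noteq> 0" "h \<in> polys \<Gamma> \<beta>0" by auto
  then have "line smult h \<in> poly_line \<Gamma> \<beta>0 ` spectral_triples \<Gamma> \<beta>0"
    using bij_poly_line by (auto simp: bij_betw_def proj_space_def)
  then have "poly_line \<Gamma> \<beta>0 (inv_into (spectral_triples \<Gamma> \<beta>0) (poly_line \<Gamma> \<beta>0) (line smult h)) = line smult h"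
    by (rule f_inv_into_f)
  from Phi_eq[OF this h(1)]
  show "(Phi \<Gamma> \<beta>0 \<gamma> \<circ> inv_into (spectral_triples \<Gamma> \<beta>0) (poly_line \<Gamma> \<beta>0)) (line smult h) =
    line (*s) (eval_nodes h)"
    by simp
qed

end

section \<open>Wirtinger calculus in complex coordinates\<close>

lemma vector_4_nth [simp]:
  "(vector [x, y, z, w] :: 'a::zero ^ 4) $ 1 = x" "(vector [x, y, z, w] :: 'a::zero ^ 4) $ 2 = y"
  "(vector [x, y, z, w] :: 'a::zero ^ 4) $ 3 = z" "(vector [x, y, z, w] :: 'a::zero ^ 4) $ 4 = w"
  unfolding vector_def by simp_all

lemma bounded_linear_Jop: "bounded_linear (Jop :: 'a::real_normed_field ^ 4 \<Rightarrow> 'a ^ 4)"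
proof -
  have "Jop (x + y) = Jop x + Jop y" "Jop (r *\<^sub>R x) = r *\<^sub>R Jop x" for x y :: "'a ^ 4" and r
    by (auto simp: Jop_def vec_eq_iff forall_4)
  moreover have "norm (Jop x) \<le> norm x * 1" for x :: "'a ^ 4"
    by (simp add: Jop_def norm_vec_def L2_set_def sum_4)
  ultimately show ?thesis by (rule bounded_linear_intro)
qed

lemma Jop_Jop: "Jop (Jop w) = - w"
  by (auto simp: Jop_def vec_eq_iff forall_4)

lemma expJ_eq:
  fixes w :: "'a::real_normed_field ^ 4"
  shows "expJ t w = cos t *\<^sub>R w + sin t *\<^sub>R Jop w"
proof -
  interpret J: bounded_linear "Jop :: 'a ^ 4 \<Rightarrow> 'a ^ 4" by (rule bounded_linear_Jop)
  have pow: "(t ^ n / fact n) *\<^sub>R (Jop ^^ n) w =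
    (cos_coeff n *\<^sub>R t ^ n) *\<^sub>R w + (sin_coeff n *\<^sub>R t ^ n) *\<^sub>R Jop w" for n
  proof -
    have even: "(Jop ^^ (2 * k)) w = (-1) ^ k *\<^sub>R w" for k
      by (induction k) (auto simp: Jop_Jop J.neg J.scale)
    show ?thesis
    proof (cases "even n")
      case True
      then obtain k where "n = 2 * k" by (elim evenE)
      then show ?thesis using even by (simp add: cos_coeff_def sin_coeff_def)
    next
      case False
      then obtain k where k: "n = 2 * k + 1" by (elim oddE)
      then have "(Jop ^^ n) w = (-1) ^ k *\<^sub>R Jop w" using even by (simp add: J.scale)
      then show ?thesis by (simp add: k cos_coeff_def sin_coeff_def)
    qed
  qed
  have "(\<lambda>n. (cos_coeff n *\<^sub>R t ^ n) *\<^sub>R w + (sin_coeff n *\<^sub>R t ^ n) *\<^sub>R Jop w) sums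
     (cos t *\<^sub>R w + sin t *\<^sub>R Jop w)"
    by (intro sums_add bounded_linear.sums[OF bounded_linear_scaleR_left] cos_converges sin_converges)
  then show ?thesis unfolding expJ_def pow by (simp add: sums_iff)
qed

text \<open>
  \<open>Wvec c1 c2 c3 c4\<close> is \<open>(c1 v1 + c2 v2 + c3 v3 + c4 v4) / \<surd>2\<close>; \<open>Rvec P Q\<close> identifies pairs of
  complex numbers with vectors in \<open>\<real>\<^sup>4\<close>, so that \<open>J\<close> becomes multiplication by \<open>\<i>\<close>.
\<close>

definition Wvec :: "complex \<Rightarrow> complex \<Rightarrow> complex \<Rightarrow> complex \<Rightarrow> complex ^ 4"
  where "Wvec c1 c2 c3 c4 = vector [(c1 + c3) / 2, - \<i> * (c1 - c3) / 2, (c2 + c4) / 2, - \<i> * (c2 - c4) / 2]"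

definition Rvec :: "complex \<Rightarrow> complex \<Rightarrow> real ^ 4"
  where "Rvec P Q = vector [Re P, Im P, Re Q, Im Q]"

definition fstc :: "real ^ 4 \<Rightarrow> complex" where "fstc w = Complex (w$1) (w$2)"
definition sndc :: "real ^ 4 \<Rightarrow> complex" where "sndc w = Complex (w$3) (w$4)"

lemma Wvec_nth:
  "Wvec c1 c2 c3 c4 $ 1 = (c1 + c3) / 2" "Wvec c1 c2 c3 c4 $ 2 = - \<i> * (c1 - c3) / 2"
  "Wvec c1 c2 c3 c4 $ 3 = (c2 + c4) / 2" "Wvec c1 c2 c3 c4 $ 4 = - \<i> * (c2 - c4) / 2"
  by (simp_all add: Wvec_def)

lemma Wvec_eq_iff: "Wvec a b c d = Wvec a' b' c' d' \<longleftrightarrow> a = a' \<and> b = b' \<and> c = c' \<and> d = d'"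
proof
  assume *: "Wvec a b c d = Wvec a' b' c' d'"
  have e: "x = y" if "x + p = y + q" "x - p = y - q" for x y p q :: complex
  proof -
    have "2 * x = (x + p) + (x - p)" by simp
    also have "\<dots> = 2 * y" unfolding that by simp
    finally show ?thesis by simp
  qed
  have "(a + c) / 2 = (a' + c') / 2" "- \<i> * (a - c) / 2 = - \<i> * (a' - c') / 2"
    "(b + d) / 2 = (b' + d') / 2" "- \<i> * (b - d) / 2 = - \<i> * (b' - d') / 2"
    using arg_cong[OF *, of "\<lambda>v. v$1"] arg_cong[OF *, of "\<lambda>v. v$2"] arg_cong[OF *, of "\<lambda>v. v$3"]
      arg_cong[OF *, of "\<lambda>v. v$4"] unfolding Wvec_nth .
  moreover have "x = y" if "x / 2 = y / 2" for x y :: complex using that by simp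
  moreover have "x = y" if "- \<i> * x / 2 = - \<i> * y / 2" for x y using that by simp
  ultimately have "a + c = a' + c'" "a - c = a' - c'" "b + d = b' + d'" "b - d = b' - d'" by blast+
  then show "a = a' \<and> b = b' \<and> c = c' \<and> d = d'" using e by (metis add.commute add_left_cancel)
qed simp

lemma Wvec_add: "Wvec a b c d + Wvec a' b' c' d' = Wvec (a + a') (b + b') (c + c') (d + d')"
  by (simp add: vec_eq_iff forall_4 Wvec_nth field_simps)

lemma Wvec_smult: "k *s Wvec a b c d = Wvec (k * a) (k * b) (k * c) (k * d)"
  by (simp add: vec_eq_iff forall_4 Wvec_nth field_simps)

lemma Wvec_scaleR: "r *\<^sub>R Wvec a b c d = Wvec (r *\<^sub>R a) (r *\<^sub>R b) (r *\<^sub>R c) (r *\<^sub>R d)"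
  by (simp add: vec_eq_iff forall_4 Wvec_nth complex_eq_iff algebra_simps)

lemma Wvec_0: "Wvec 0 0 0 0 = 0"
  by (simp add: vec_eq_iff forall_4 Wvec_nth)

lemma Wvec_sum: "(\<Sum>i\<in>A. Wvec (a i) (b i) (c i) (d i)) = Wvec (sum a A) (sum b A) (sum c A) (sum d A)"
  by (induction A rule: infinite_finite_induct) (auto simp: Wvec_0 Wvec_add)

lemma Jop_Wvec: "Jop (Wvec a b c d) = Wvec (\<i> * a) (\<i> * b) (- \<i> * c) (- \<i> * d)"
  by (simp add: Jop_def vec_eq_iff forall_4 Wvec_nth field_simps)

lemma Lop_Wvec: "Lop (Wvec a b c d) = Wvec (- d) c (- b) a"
  by (simp add: Lop_def vec_eq_iff forall_4 Wvec_nth field_simps)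

lemma expJ_Wvec: "expJ t (Wvec a b c d) = Wvec (cis t * a) (cis t * b) (cis (- t) * c) (cis (- t) * d)"
  unfolding expJ_eq Jop_Wvec Wvec_scaleR Wvec_add Wvec_eq_iff by (simp add: complex_eq_iff)

lemma v_Wvec:
  "v1 = Wvec (of_real (sqrt 2)) 0 0 0" "v2 = Wvec 0 (of_real (sqrt 2)) 0 0"
  "v3 = Wvec 0 0 (of_real (sqrt 2)) 0" "v4 = Wvec 0 0 0 (of_real (sqrt 2))"
proof -
  have "1 / sqrt 2 = sqrt 2 / (2::real)" by (simp add: field_simps)
  then have 1: "complex_of_real (1 / sqrt 2) = of_real (sqrt 2) / 2"
    by (simp only: of_real_divide of_real_numeral)
  show 2: "v1 = Wvec (of_real (sqrt 2)) 0 0 0" "v2 = Wvec 0 (of_real (sqrt 2)) 0 0"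
    unfolding v1_def v2_def 1 by (simp_all add: vec_eq_iff forall_4 Wvec_nth eps_def axis_def)
  show "v3 = Wvec 0 0 (of_real (sqrt 2)) 0" "v4 = Wvec 0 0 0 (of_real (sqrt 2))"
    unfolding v3_def v4_def 2 by (simp_all add: vec_eq_iff forall_4 Wvec_nth)
qed

lemma Rvec_nth: "Rvec P Q $ 1 = Re P" "Rvec P Q $ 2 = Im P" "Rvec P Q $ 3 = Re Q" "Rvec P Q $ 4 = Im Q"
  by (simp_all add: Rvec_def)

lemma fstc_Rvec [simp]: "fstc (Rvec P Q) = P" and sndc_Rvec [simp]: "sndc (Rvec P Q) = Q"
  and Rvec_fstc_sndc [simp]: "Rvec (fstc w) (sndc w) = w"
  by (simp_all add: fstc_def sndc_def Rvec_nth vec_eq_iff forall_4)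

lemma Rvec_eq_iff: "Rvec P Q = Rvec P' Q' \<longleftrightarrow> P = P' \<and> Q = Q'"
  by (metis fstc_Rvec sndc_Rvec)

lemma Rvec_ops:
  "Rvec P Q + Rvec P' Q' = Rvec (P + P') (Q + Q')" "Rvec P Q - Rvec P' Q' = Rvec (P - P') (Q - Q')"
  "r *\<^sub>R Rvec P Q = Rvec (r *\<^sub>R P) (r *\<^sub>R Q)" "Rvec 0 0 = 0"
  by (simp_all add: vec_eq_iff forall_4 Rvec_nth)

lemma Jop_Rvec: "Jop (Rvec P Q) = Rvec (\<i> * P) (\<i> * Q)"
  by (simp add: Jop_def vec_eq_iff forall_4 Rvec_nth)

lemma Lop_Rvec: "Lop (Rvec P Q) = Rvec (- cnj Q) (cnj P)"
  by (simp add: Lop_def vec_eq_iff forall_4 Rvec_nth)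

lemma expJ_Rvec: "expJ t (Rvec P Q) = Rvec (cis t * P) (cis t * Q)"
  unfolding expJ_eq Jop_Rvec Rvec_ops Rvec_eq_iff by (simp add: complex_eq_iff)

lemma bounded_linear_fstc: "bounded_linear fstc" and bounded_linear_sndc: "bounded_linear sndc"
  by (auto intro!: linear_conv_bounded_linear[THEN iffD1] linearI simp: fstc_def sndc_def complex_eq_iff)

lemma bounded_linear_Rvec:
  assumes "bounded_linear p" "bounded_linear q"
  shows "bounded_linear (\<lambda>z::'a::real_normed_vector. Rvec (p z) (q z))"
proof -
  interpret p: bounded_linear p by fact
  interpret q: bounded_linear q by fact
  have "linear (\<lambda>x::complex \<times> complex. Rvec (fst x) (snd x))"
    by (rule linearI) (auto simp: Rvec_ops)
  then have "bounded_linear (\<lambda>x::complex \<times> complex. Rvec (fst x) (snd x))"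
    by (simp add: linear_conv_bounded_linear)
  from bounded_linear_compose[OF this bounded_linear_Pair[OF assms]] show ?thesis by simp
qed

lemma complexify_eq: "complexify f z = Wvec (fstc (f z)) (sndc (f z)) (cnj (fstc (f z))) (cnj (sndc (f z)))"
  by (auto simp: complexify_def vec_eq_iff forall_4 Wvec_nth fstc_def sndc_def complex_eq_iff)

lemma complexify_has_derivative:
  assumes "(f has_derivative f') (at z)"
  shows "(complexify f has_derivative complexify f') (at z)"
proof -
  have "linear (\<lambda>w::real^4. (\<chi> i. complex_of_real (w$i)))"
    by (rule linearI) (auto simp: vec_eq_iff complex_eq_iff)
  then have "bounded_linear (\<lambda>w::real^4. (\<chi> i. complex_of_real (w$i)))"
    by (simp add: linear_conv_bounded_linear)
  from bounded_linear.has_derivative[OF this assms] show ?thesis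
    by (simp add: complexify_def[abs_def])
qed

text \<open>The last two coordinates of the complexified map are cnj P and cnj Q, whose
  z-derivatives are the conjugates of the zbar-derivatives of P and Q. So f_z already contains all
  first derivatives of f.\<close>

lemma wirtinger_Wvec:
  assumes "(f has_derivative (\<lambda>v. Rvec (a * v + a' * cnj v) (b * v + b' * cnj v))) (at z)"
  shows "d_z f z = Wvec a b (cnj a') (cnj b')" "d_zbar f z = Wvec a' b' (cnj a) (cnj b)"
proof -
  have "frechet_derivative (complexify f) (at z) =
      complexify (\<lambda>v. Rvec (a * v + a' * cnj v) (b * v + b' * cnj v))"
    using frechet_derivative_at[OF complexify_has_derivative[OF assms]] by simp
  then show "d_z f z = Wvec a b (cnj a') (cnj b')" "d_zbar f z = Wvec a' b' (cnj a) (cnj b)"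
    unfolding d_z_def d_zbar_def complexify_eq
    by (simp_all add: vec_eq_iff forall_4 Wvec_nth field_simps)
qed

lemma linear_complex_eq:
  assumes "linear p"
  shows "p v = (p 1 - \<i> * p \<i>) / 2 * v + (p 1 + \<i> * p \<i>) / 2 * cnj v"
proof -
  interpret linear p by fact
  have "v = Re v *\<^sub>R 1 + Im v *\<^sub>R \<i>" by (simp add: complex_eq_iff)
  then have "p v = Re v *\<^sub>R p 1 + Im v *\<^sub>R p \<i>" by (metis add scale)
  also have "\<dots> = (p 1 - \<i> * p \<i>) / 2 * v + (p 1 + \<i> * p \<i>) / 2 * cnj v"
    by (simp add: complex_eq_iff field_simps)
  finally show ?thesis .
qed

text \<open>The four coordinates of the equation form two pairs; since \<open>e * cnj e = 1\<close>,
  the members of a pair are equivalent, so only two scalar conditions remain.\<close>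

lemma HSL_equation_iff:
  assumes "cmod e = 1" "cis t = e"
  shows "expJ t (Lop (Wvec a b (cnj a') (cnj b'))) = \<i> *s Wvec a b (cnj a') (cnj b') \<longleftrightarrow>
    b' = \<i> * e * cnj a \<and> b = - \<i> * e * cnj a'"
proof -
  have e: "cnj e * e = 1" "e * cnj e = 1" using assms(1) complex_norm_square[of e]
    by (simp_all add: mult.commute)
  have ct: "cis (- t) = cnj e" using assms(2) cis_cnj[of t] by simp
  have mi: "p = \<i> * q \<longleftrightarrow> q = - \<i> * p" for p q by auto
  have cj: "cnj y = w \<longleftrightarrow> y = cnj w" for y w by auto
  have inv: "\<i> * e * cnj y = x" if "y = \<i> * e * cnj x" for x y
  proof -
    have "\<i> * e * cnj y = (e * cnj e) * x" unfolding that by (simp add: algebra_simps)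
    then show ?thesis by (simp add: e)
  qed
  have inv': "- \<i> * e * cnj y = x" if "y = - \<i> * e * cnj x" for x y
  proof -
    have "- \<i> * e * cnj y = (e * cnj e) * x" unfolding that by (simp add: algebra_simps)
    then show ?thesis by (simp add: e)
  qed
  have lem: "e * cnj x = \<i> * y \<longleftrightarrow> y = - \<i> * e * cnj x" "cnj e * x = \<i> * cnj y \<longleftrightarrow> y = \<i> * e * cnj x"
    "- (e * cnj x) = \<i> * y \<longleftrightarrow> x = \<i> * e * cnj y" "- (cnj e * x) = \<i> * cnj y \<longleftrightarrow> x = - \<i> * e * cnj y" for x y
  proof -
    show "e * cnj x = \<i> * y \<longleftrightarrow> y = - \<i> * e * cnj x" unfolding mi by (simp add: mult.assoc)
    show "cnj e * x = \<i> * cnj y \<longleftrightarrow> y = \<i> * e * cnj x" unfolding mi cj by (simp add: mult.assoc)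
    have "- (e * cnj x) = \<i> * y \<longleftrightarrow> y = \<i> * e * cnj x" unfolding mi by (simp add: mult.assoc)
    then show "- (e * cnj x) = \<i> * y \<longleftrightarrow> x = \<i> * e * cnj y" using inv by metis
    have "- (cnj e * x) = \<i> * cnj y \<longleftrightarrow> y = - \<i> * e * cnj x" unfolding mi cj by (simp add: mult.assoc)
    then show "- (cnj e * x) = \<i> * cnj y \<longleftrightarrow> x = - \<i> * e * cnj y" using inv' by metis
  qed
  show ?thesis
    unfolding Lop_Wvec expJ_Wvec Wvec_smult Wvec_eq_iff assms(2) ct
    using lem(1)[of a' b] lem(2)[of a b'] lem(3)[of b' a] lem(4)[of b a']
    by (simp add: mult.assoc) blast
qed

section \<open>Characters of the plane\<close>

lemma echar_add: "echar (a + b) z = echar a z * echar b z"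
  by (simp add: echar_def inner_add_left exp_add[symmetric] algebra_simps)

lemma echar_add_right: "echar a (z + w) = echar a z * echar a w"
  by (simp add: echar_def inner_add_right exp_add[symmetric] algebra_simps)

lemma echar_0 [simp]: "echar a 0 = 1" "echar 0 z = 1"
  by (simp_all add: echar_def)

lemma norm_echar [simp]: "cmod (echar a z) = 1"
  by (simp add: echar_def norm_exp_eq_Re)

lemma echar_nonzero [simp]: "echar a z \<noteq> 0"
  by (simp add: echar_def)

lemma echar_minus: "echar (- a) z = cnj (echar a z)"
  by (simp add: echar_def exp_cnj)

lemma cis_beta: "cis (beta \<beta>0 z) = echar \<beta>0 z" "cis (- beta \<beta>0 z / 2) = echar (- (\<beta>0 / 2)) z"
  "cis (- (- beta \<beta>0 z / 2)) = echar (\<beta>0 / 2) z"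
proof -
  have half: "(\<beta>0 / 2) \<bullet> z = (\<beta>0 \<bullet> z) / 2" for z by (simp add: inner_complex_def field_simps)
  show "cis (beta \<beta>0 z) = echar \<beta>0 z" "cis (- beta \<beta>0 z / 2) = echar (- (\<beta>0 / 2)) z"
    "cis (- (- beta \<beta>0 z / 2)) = echar (\<beta>0 / 2) z"
    by (simp_all add: cis_conv_exp beta_def echar_def half mult_ac)
qed

lemma of_real_inner_complex: "complex_of_real (a \<bullet> v) = (cnj a * v + a * cnj v) / 2"
  by (simp add: complex_eq_iff inner_complex_def)

lemma echar_has_derivative:
  "(echar a has_derivative (\<lambda>v. (2 * pi * \<i> * of_real (a \<bullet> v)) * echar a z)) (at z)"
proof -
  have 1: "((\<lambda>z. 2 * pi * \<i> * complex_of_real (a \<bullet> z)) has_derivative (\<lambda>v. 2 *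
    pi * \<i> * of_real (a \<bullet> v))) (at z)"
    by (auto intro!: derivative_eq_intros)
  have 2: "(exp has_derivative (*) (exp (2 * pi * \<i> * complex_of_real (a \<bullet> z)))) (at (2 *
    pi * \<i> * complex_of_real (a \<bullet> z)))"
    using DERIV_exp by (simp only: has_field_derivative_def)
  show ?thesis unfolding echar_def[abs_def]
    by (rule has_derivative_eq_rhs[OF has_derivative_compose[OF 1 2]]) (simp only: mult.commute)
qed

section \<open>Smooth maps\<close>

lemma Ck_on_const: "Ck_on n UNIV (\<lambda>_. c)"
  by (induction n arbitrary: c) (auto simp: frechet_derivative_const)

lemma Ck_on_cong:
  assumes "open U" "\<And>x. x \<in> U \<Longrightarrow> h x = k x" "Ck_on n U h"
  shows "Ck_on n U k"
  using assms(2,3)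
proof (induction n arbitrary: h k)
  case 0
  then show ?case by (simp cong: continuous_on_cong)
next
  case (Suc n)
  have der: "(k has_derivative frechet_derivative h (at x)) (at x)" if "x \<in> U" for x
  proof (rule has_derivative_transform_within_open[OF _ \<open>open U\<close> that])
    show "(h has_derivative frechet_derivative h (at x)) (at x)"
      using Suc.prems(2) that by (simp add: frechet_derivative_works)
  qed (rule Suc.prems(1))
  then have "frechet_derivative h (at x) v = frechet_derivative k (at x) v" if "x \<in> U" for x v
    using that frechet_derivative_at by metis
  moreover have "Ck_on n U (\<lambda>x. frechet_derivative h (at x) v)" for v
    using Suc.prems(2) by simp
  ultimately have "Ck_on n U (\<lambda>x. frechet_derivative k (at x) v)" for v
    by (rule Suc.IH)
  with der show ?case by (auto simp: differentiable_def)
qed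

lemma Ck_on_add:
  assumes "open U" "Ck_on n U f" "Ck_on n U g"
  shows "Ck_on n U (\<lambda>x. f x + g x)"
  using assms(2,3)
proof (induction n arbitrary: f g)
  case 0
  then show ?case by (simp add: continuous_on_add)
next
  case (Suc n)
  have d: "((\<lambda>x. f x + g x) has_derivative (\<lambda>v. frechet_derivative f (at x) v +
    frechet_derivative g (at x) v)) (at x)"
    if "x \<in> U" for x
    using Suc.prems that by (intro has_derivative_add) (simp_all add: frechet_derivative_works)
  have "Ck_on n U (\<lambda>x. frechet_derivative f (at x) v + frechet_derivative g (at x) v)" for v
    by (rule Suc.IH) (use Suc.prems in simp_all)
  moreover have "frechet_derivative f (at x) v + frechet_derivative g (at x) v =
    frechet_derivative (\<lambda>x. f x + g x) (at x) v"
    if "x \<in> U" for x v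
    using frechet_derivative_at[OF d[OF that]] by metis
  ultimately have "Ck_on n U (\<lambda>x. frechet_derivative (\<lambda>x. f x + g x) (at x) v)" for v
    using Ck_on_cong[OF \<open>open U\<close>] by (metis (no_types, lifting))
  with d show ?case by (auto simp: differentiable_def)
qed

lemma smooth_on_const: "smooth_on UNIV (\<lambda>_. c)"
  by (simp add: smooth_on_def Ck_on_const)

lemma smooth_on_add: "smooth_on U f \<Longrightarrow> smooth_on U g \<Longrightarrow> smooth_on U (\<lambda>x. f x + g x)"
  by (auto simp: smooth_on_def intro: Ck_on_add)

lemma smooth_on_sum:
  assumes "\<And>i. i \<in> I \<Longrightarrow> smooth_on UNIV (f i)"
  shows "smooth_on UNIV (\<lambda>x. \<Sum>i\<in>I. f i x)"
  using assms
proof (induction I rule: infinite_finite_induct)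
  case (insert i I)
  then show ?case by (simp add: smooth_on_add)
qed (simp_all add: smooth_on_const)

text \<open>The class of maps \<open>T (echar a z)\<close> with \<open>T\<close> bounded linear is
  closed under directional derivatives, as differentiating composes \<open>T\<close> with
  multiplication by a constant. Hence the induction runs over all \<open>T\<close> at once.\<close>

lemma smooth_on_echar:
  fixes T :: "complex \<Rightarrow> 'b::euclidean_space"
  assumes "bounded_linear T"
  shows "smooth_on UNIV (\<lambda>z. T (echar a z))"
proof -
  have "Ck_on n UNIV (\<lambda>z. T (echar a z))" for n
    using assms
  proof (induction n arbitrary: T)
    case 0
    have "continuous_on UNIV (echar a)"
      unfolding continuous_on_eq_continuous_at[OF open_UNIV]
      using has_derivative_continuous[OF echar_has_derivative] by blast
    then show ?case using bounded_linear.continuous_on[OF 0] by simp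
  next
    case (Suc n)
    have d: "((\<lambda>z. T (echar a z)) has_derivative (\<lambda>v.
      T ((2 * pi * \<i> * of_real (a \<bullet> v)) * echar a z))) (at z)" for z
      by (rule bounded_linear.has_derivative[OF Suc.prems echar_has_derivative])
    then have "frechet_derivative (\<lambda>z. T (echar a z)) (at z) =
      (\<lambda>v. T ((2 * pi * \<i> * of_real (a \<bullet> v)) * echar a z))" for z
      by (rule frechet_derivative_at[symmetric])
    moreover have "Ck_on n UNIV (\<lambda>z. T ((2 * pi * \<i> * of_real (a \<bullet> v)) * echar a z))" for v
      by (rule Suc.IH[OF bounded_linear_compose[OF Suc.prems bounded_linear_mult_right]])
    ultimately show ?case using d by (auto simp: differentiable_def)
  qed
  then show ?thesis by (simp add: smooth_on_def)
qed

lemma smooth_onD: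
  assumes "smooth_on UNIV f"
  shows "(f has_derivative frechet_derivative f (at x)) (at x)"
    and "continuous_on UNIV f" and "continuous_on UNIV (\<lambda>x. frechet_derivative f (at x) v)"
proof -
  have "Ck_on (Suc 0) UNIV f" "Ck_on 0 UNIV f" using assms unfolding smooth_on_def by blast+
  then show "(f has_derivative frechet_derivative f (at x)) (at x)" "continuous_on UNIV f"
    "continuous_on UNIV (\<lambda>x. frechet_derivative f (at x) v)"
    by (auto simp: frechet_derivative_works)
qed

section \<open>Fourier series on the torus\<close>

definition cexp :: "int \<Rightarrow> int \<Rightarrow> real \<times> real \<Rightarrow> complex"
  where "cexp m n x = cis (2 * pi * (of_int m * fst x + of_int n * snd x))"

abbreviation "usq \<equiv> cbox (0::real, 0::real) (1, 1)"

text \<open>Introduced for its closure under multiplication by characters, and hence by polynomials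
  in the coordinates of the torus.\<close>

definition null_modes :: "(real \<times> real \<Rightarrow> complex) set"
  where "null_modes = {W. continuous_on UNIV W \<and> (\<forall>m n. integral usq (\<lambda>x. W x * cexp m n x) = 0)}"

lemma continuous_cexp: "continuous_on S (cexp m n)"
  unfolding cexp_def[abs_def] by (intro continuous_intros)

lemma cexp_mult: "cexp m n x * cexp m' n' x = cexp (m + m') (n + n') x"
  by (simp add: cexp_def cis_mult algebra_simps)

lemma integrable_usq: "continuous_on UNIV (W :: real \<times> real \<Rightarrow> complex) \<Longrightarrow> W integrable_on usq"
  by (rule integrable_continuous) (auto intro: continuous_on_subset)

lemma null_modes_add:
  assumes "V \<in> null_modes" "W \<in> null_modes"
  shows "(\<lambda>x. V x + W x) \<in> null_modes"
proof -
  have "integral usq (\<lambda>x. (V x + W x) * cexp m n x) = 0" for m n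
  proof -
    have "(\<lambda>x. V x * cexp m n x) integrable_on usq" "(\<lambda>x. W x * cexp m n x) integrable_on usq"
      using assms by (auto simp: null_modes_def intro!: integrable_usq continuous_on_mult continuous_cexp)
    from integral_add[OF this] show ?thesis using assms by (simp add: null_modes_def algebra_simps)
  qed
  with assms show ?thesis by (auto simp: null_modes_def intro: continuous_on_add)
qed

lemma null_modes_cmult:
  assumes "W \<in> null_modes"
  shows "(\<lambda>x. c * W x) \<in> null_modes"
proof -
  have "integral usq (\<lambda>x. c * W x * cexp m n x) = 0" for m n
    using integral_mult_right[of usq c "\<lambda>x. W x * cexp m n x"] assms by (simp add: null_modes_def mult.assoc)
  with assms show ?thesis by (auto simp: null_modes_def intro!: continuous_intros)
qed

lemma null_modes_cexp:
  assumes "W \<in> null_modes"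
  shows "(\<lambda>x. W x * cexp m n x) \<in> null_modes"
proof -
  have "integral usq (\<lambda>x. W x * cexp m n x * cexp k l x) = 0" for k l
    using assms unfolding mult.assoc cexp_mult null_modes_def by blast
  moreover have "continuous_on UNIV (\<lambda>x. W x * cexp m n x)"
    using assms by (intro continuous_on_mult continuous_cexp) (simp add: null_modes_def)
  ultimately show ?thesis by (simp add: null_modes_def)
qed

section \<open>Completeness of the characters on the torus\<close>

definition torus_map :: "real \<times> real \<Rightarrow> complex \<times> complex"
  where "torus_map x = (cis (2 * pi * fst x), cis (2 * pi * snd x))"

text \<open>On the torus a real linear functional is a combination of four characters. For a
  product, the hypothesis for \<open>g\<close> is applied to the null mode already multiplied by
  \<open>f\<close>; this is why \<open>W\<close> is arbitrary in the induction.\<close>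

lemma null_modes_real_polynomial:
  assumes "real_polynomial_function f" "W \<in> null_modes"
  shows "(\<lambda>x. W x * of_real (f (torus_map x))) \<in> null_modes"
  using assms
proof (induction f arbitrary: W)
  case (linear f)
  interpret bounded_linear f by fact
  have f: "f (a, b) = Re a * f (1, 0) + Im a * f (\<i>, 0) + Re b * f (0, 1) + Im b * f (0, \<i>)" for a b
  proof -
    have "(a, b) = Re a *\<^sub>R (1, 0) + Im a *\<^sub>R (\<i>, 0) + Re b *\<^sub>R (0, 1) + Im b *\<^sub>R (0, \<i>)"
      by (simp add: complex_eq_iff)
    then have "f (a, b) = f (Re a *\<^sub>R (1, 0) + Im a *\<^sub>R (\<i>, 0) + Re b *\<^sub>R (0, 1) + Im b *\<^sub>R (0, \<i>))"
      by simp
    then show ?thesis by (simp only: add scale real_scaleR_def)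
  qed
  have ri: "of_real (Re (cis t)) = (cis t + cis (- t)) * (1 / 2)"
    "of_real (Im (cis t)) = (cis t - cis (- t)) * (- \<i> / 2)" for t
    by (auto simp: complex_eq_iff)
  have ce: "cexp 1 0 x = cis (2 * pi * fst x)" "cexp (-1) 0 x = cis (- (2 * pi * fst x))"
    "cexp 0 1 x = cis (2 * pi * snd x)" "cexp 0 (-1) x = cis (- (2 * pi * snd x))" for x
    by (simp_all add: cexp_def)
  have arith: "w * ((p + p') * h * a + (p - p') * k * b + (q + q') * h * c + (q - q') * k * d) =
      (h * a + k * b) * (w * p) + (h * a - k * b) * (w * p') +
        (h * c + k * d) * (w * q) + (h * c - k * d) * (w * q')"
    for w p p' q q' h k a b c d :: complex
    by (simp add: algebra_simps)
  have "W x * of_real (f (torus_map x)) =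
      (1 / 2 * of_real (f (1, 0)) + - \<i> / 2 * of_real (f (\<i>, 0))) * (W x * cexp 1 0 x)
      + (1 / 2 * of_real (f (1, 0)) - - \<i> / 2 * of_real (f (\<i>, 0))) * (W x * cexp (-1) 0 x)
      + (1 / 2 * of_real (f (0, 1)) + - \<i> / 2 * of_real (f (0, \<i>))) * (W x * cexp 0 1 x)
      + (1 / 2 * of_real (f (0, 1)) - - \<i> / 2 * of_real (f (0, \<i>))) * (W x * cexp 0 (-1) x)" for x
    unfolding torus_map_def f[of "cis (2 * pi * fst x)" "cis (2 * pi * snd x)"] of_real_add of_real_mult ri ce
    by (rule arith)
  then show ?case
    using linear.prems by (simp only:) (intro null_modes_add null_modes_cmult null_modes_cexp)
next
  case (const c)
  then show ?case using null_modes_cmult[of W "of_real c"] by (simp add: mult.commute)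
next
  case (add f g)
  then show ?case using null_modes_add[OF add.IH(1)[OF add.prems] add.IH(2)[OF add.prems]]
    by (simp add: algebra_simps)
next
  case (mult f g)
  show ?case using mult.IH(2)[OF mult.IH(1)[OF mult.prems]] by (simp add: mult.assoc)
qed

lemma continuous_torus_map: "continuous_on S torus_map"
  unfolding torus_map_def[abs_def] by (intro continuous_intros)

lemma cis_eq_cis_iff: "cis (2 * pi * s) = cis (2 * pi * s') \<longleftrightarrow> (\<exists>n::int. s = s' + n)"
proof -
  have "cis (2 * pi * s) = cis (2 * pi * s') \<longleftrightarrow>
      sin (2 * pi * s) = sin (2 * pi * s') \<and> cos (2 * pi * s) = cos (2 * pi * s')"
    by (auto simp: complex_eq_iff)
  also have "\<dots> \<longleftrightarrow> (\<exists>n::int. 2 * pi * s = 2 * pi * s' + 2 * pi * n)" by (rule sin_cos_eq_iff)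
  also have "\<dots> \<longleftrightarrow> (\<exists>n::int. s = s' + n)"
  proof -
    have "2 * pi * s = 2 * pi * s' + 2 * pi * of_int n \<longleftrightarrow> s = s' + of_int n" for n :: int
    proof -
      have "2 * pi * s' + 2 * pi * of_int n = 2 * pi * (s' + of_int n)" by (simp add: algebra_simps)
      then show ?thesis by simp
    qed
    then show ?thesis by simp
  qed
  finally show ?thesis .
qed

lemma int_periodic:
  fixes g :: "real \<Rightarrow> 'a"
  assumes "\<And>s. g (s + 1) = g s"
  shows "g (s + of_int n) = g s"
proof -
  have nat: "g (s + of_nat k) = g s" for s and k :: nat
  proof (induction k arbitrary: s)
    case (Suc k)
    have "s + of_nat (Suc k) = (s + of_nat k) + 1" by simp
    then show ?case using Suc assms by metis
  qed simp
  show ?thesis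
  proof (cases n)
    case (nonneg k)
    then show ?thesis using nat by simp
  next
    case (neg k)
    then show ?thesis using nat[of "s + of_int n" "Suc k"] by simp
  qed
qed

text \<open>
  Since functions on the torus are uniform limits of polynomials in the coordinates of
  \<open>S\<^sup>1 \<times> S\<^sup>1\<close>, a function with vanishing Fourier coefficients is orthogonal to itself.
\<close>

lemma null_modes_Re_eq_0:
  assumes W: "W \<in> null_modes" and per: "\<And>s t. W (s + 1, t) = W (s, t)" "\<And>s t. W (s, t + 1) = W (s, t)"
    and x: "x \<in> usq"
  shows "Re (W x) = 0"
proof -
  have cW: "continuous_on S W" for S using W by (auto simp: null_modes_def intro: continuous_on_subset)
  have perW: "W (s + of_int m, t + of_int n) = W (s, t)" for s t m n
    using int_periodic[of "\<lambda>s. W (s, t + of_int n)" s m] int_periodic[of "\<lambda>t. W (s, t)" t n] per by simp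
  define T where "T = torus_map ` usq"
  \<comment> \<open>The real part of \<open>W\<close> as a function on the torus; by periodicity the
    choice of a preimage does not matter.\<close>
  define g where "g y = Re (W (SOME x. x \<in> usq \<and> torus_map x = y))" for y
  have g: "g (torus_map x) = Re (W x)" if "x \<in> usq" for x
  proof -
    define x' where "x' = (SOME x'. x' \<in> usq \<and> torus_map x' = torus_map x)"
    have "x' \<in> usq \<and> torus_map x' = torus_map x" unfolding x'_def by (rule someI[of _ x]) (use that in auto)
    then obtain m n :: int where "fst x' = fst x + m" "snd x' = snd x + n"
      by (auto simp: torus_map_def cis_eq_cis_iff)
    then have "W x' = W x" using perW[of "fst x" m "snd x" n] by (metis prod.collapse)
    then show ?thesis by (simp add: g_def x'_def)
  qed
  have compT: "compact T" unfolding T_def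
    by (intro compact_continuous_image continuous_torus_map compact_cbox)
  \<comment> \<open>\<open>torus_map\<close> restricted to the compact square is a closed map, so
    continuity descends to the image: preimages under \<open>g\<close> are images of compact
    sets.\<close>
  have "continuous_on T g"
  proof (subst continuous_on_closed_vimage)
    show "closed T" using compT by (rule compact_imp_closed)
    show "\<forall>B. closed B \<longrightarrow> closed (g -` B \<inter> T)"
    proof (intro allI impI)
      fix B :: "real set" assume B: "closed B"
      have "g -` B \<inter> T = torus_map ` ((\<lambda>x. Re (W x)) -` B \<inter> usq)"
        using g by (auto simp: T_def)
      moreover have "compact ((\<lambda>x. Re (W x)) -` B \<inter> usq)"
        using B cW by (intro closed_Int_compact closed_vimage compact_cbox) (auto intro!: continuous_intros)
      ultimately show "closed (g -` B \<inter> T)"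
        by (simp add: compact_imp_closed compact_continuous_image continuous_torus_map)
    qed
  qed
  define M where "M = integral usq (\<lambda>x. \<bar>Re (W x)\<bar>)"
  define I where "I = integral usq (\<lambda>x. Re (W x) * Re (W x))"
  have int: "h integrable_on usq" if "continuous_on UNIV h" for h :: "real \<times> real \<Rightarrow> real"
    using that by (intro integrable_continuous) (auto intro: continuous_on_subset)
  \<comment> \<open>For a real polynomial f within e of \<open>g\<close>, the integral of Re W times
    f is zero, so the integral of the square of Re W equals that of Re W times (Re W - f).\<close>
  have le: "I \<le> e * M" if e: "e > 0" for e
  proof -
    obtain f where f: "real_polynomial_function f" "\<And>y. y \<in> T \<Longrightarrow> \<bar>g y - f y\<bar> < e"
      using Stone_Weierstrass_real_polynomial_function[OF compT \<open>continuous_on T g\<close> e] by blast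
    have cf: "continuous_on UNIV (\<lambda>x. f (torus_map x))"
      using continuous_on_compose2[OF continuous_on_polymonial_function[of f UNIV]
        continuous_torus_map[of UNIV]] f(1)
      by (simp add: real_polynomial_function_eq)
    have null: "(\<lambda>x. W x * of_real (f (torus_map x))) \<in> null_modes"
      by (rule null_modes_real_polynomial[OF f(1) W])
    then have "integral usq (\<lambda>x. W x * of_real (f (torus_map x)) * cexp 0 0 x) = 0"
      unfolding null_modes_def by blast
    then have i0: "integral usq (\<lambda>x. W x * of_real (f (torus_map x))) = 0" by (simp add: cexp_def)
    have iW: "(\<lambda>x. W x * of_real (f (torus_map x))) integrable_on usq"
      using cW cf by (intro integrable_usq continuous_intros) auto
    have "((\<lambda>x. W x * of_real (f (torus_map x))) has_integral 0) usq"
      using integrable_integral[OF iW] unfolding i0 .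
    from has_integral_linear[OF this bounded_linear_Re]
    have z: "((\<lambda>x. Re (W x) * f (torus_map x)) has_integral 0) usq" by (simp add: o_def)
    have "I = integral usq (\<lambda>x. Re (W x) * Re (W x)) - integral usq (\<lambda>x. Re (W x) * f (torus_map x))"
      using integral_unique[OF z] by (simp add: I_def)
    also have "\<dots> = integral usq (\<lambda>x. Re (W x) * Re (W x) - Re (W x) * f (torus_map x))"
      using cW cf by (intro integral_diff[symmetric] int continuous_intros) auto
    also have "\<dots> \<le> integral usq (\<lambda>x. e * \<bar>Re (W x)\<bar>)"
    proof (rule integral_le)
      show "(\<lambda>x. Re (W x) * Re (W x) - Re (W x) * f (torus_map x)) integrable_on usq"
        "(\<lambda>x. e * \<bar>Re (W x)\<bar>) integrable_on usq"
        using cW cf by (auto intro!: int continuous_intros)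
      fix x assume "x \<in> usq"
      then have "\<bar>Re (W x) - f (torus_map x)\<bar> < e" using f(2)[of "torus_map x"] g by (auto simp: T_def)
      then have "\<bar>Re (W x)\<bar> * \<bar>Re (W x) - f (torus_map x)\<bar> \<le> \<bar>Re (W x)\<bar> * e"
        by (intro mult_left_mono) auto
      then have "\<bar>Re (W x) * (Re (W x) - f (torus_map x))\<bar> \<le> \<bar>Re (W x)\<bar> * e" by (simp only: abs_mult)
      then show "Re (W x) * Re (W x) - Re (W x) * f (torus_map x) \<le> e * \<bar>Re (W x)\<bar>"
        by (simp add: algebra_simps)
    qed
    also have "\<dots> = e * M" by (simp add: M_def)
    finally show ?thesis .
  qed
  have "I \<le> 0"
  proof -
    have "M \<ge> 0" unfolding M_def by (rule integral_nonneg) (use cW in \<open>auto intro!: int continuous_intros\<close>)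
    have "I \<le> 0 + d" if "d > 0" for d
    proof -
      \<comment> \<open>The denominator is \<open>M + 1\<close> because \<open>M\<close> may be
        0.\<close>
      have "I \<le> d / (M + 1) * M" using that \<open>M \<ge> 0\<close> by (intro le) simp
      also have "\<dots> \<le> d" using that \<open>M \<ge> 0\<close> by (simp add: field_simps)
      finally show ?thesis by simp
    qed
    then show ?thesis using field_le_epsilon by blast
  qed
  moreover have "I \<ge> 0" unfolding I_def by (rule integral_nonneg)
    (use cW in \<open>auto intro!: int continuous_intros\<close>)
  ultimately have "I = 0" by simp
  have iI: "(\<lambda>x. Re (W x) * Re (W x)) integrable_on usq" using cW by (auto intro!: int continuous_intros)
  have "((\<lambda>x. Re (W x) * Re (W x)) has_integral 0) usq"
    using integrable_integral[OF iI] \<open>I = 0\<close> unfolding I_def by simp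
  moreover have "box (0::real, 0::real) (1, 1) \<noteq> {}"
    by (auto simp: box_ne_empty Basis_prod_def inner_prod_def)
  ultimately have "Re (W x) * Re (W x) = 0"
    using cW x by (intro has_integral_0_cbox_imp_0[of "(0,0)" "(1,1)" "\<lambda>x. Re (W x) * Re (W x)"])
      (auto intro!: continuous_intros)
  then show ?thesis by simp
qed

lemma null_modes_periodic_eq_0:
  assumes W: "W \<in> null_modes" and per: "\<And>s t. W (s + 1, t) = W (s, t)" "\<And>s t. W (s, t + 1) = W (s, t)"
  shows "W x = 0"
proof -
  have 1: "W x = 0" if "x \<in> usq" for x
  proof -
    have "Re (W x) = 0" by (rule null_modes_Re_eq_0[OF W per that])
    moreover have "Re (- \<i> * W x) = 0"
      by (rule null_modes_Re_eq_0[OF null_modes_cmult[OF W]]) (use per that in auto)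
    ultimately show ?thesis by (simp add: complex_eq_iff)
  qed
  have perW: "W (s + of_int m, t + of_int n) = W (s, t)" for s t m n
    using int_periodic[of "\<lambda>s. W (s, t + of_int n)" s m] int_periodic[of "\<lambda>t. W (s, t)" t n] per by simp
  have "(frac (fst x), frac (snd x)) \<in> usq"
    by (auto simp: cbox_Pair_eq frac_ge_0 less_imp_le[OF frac_lt_1])
  from 1[OF this] perW[of "frac (fst x)" "\<lfloor>fst x\<rfloor>" "frac (snd x)" "\<lfloor>snd x\<rfloor>"]
  show ?thesis by (simp add: frac_def)
qed

section \<open>Fourier coefficients with respect to a lattice\<close>

definition par :: "complex \<Rightarrow> complex \<Rightarrow> real \<times> real \<Rightarrow> complex"
  where "par w1 w2 x = complex_of_real (fst x) * w1 + complex_of_real (snd x) * w2"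

text \<open>The mean over a period parallelogram: integrating in basis coordinates over the unit
  square absorbs the area factor. It is the scalar counterpart of
  \<open>fourier_coeff\<close>.\<close>

definition fc :: "complex \<Rightarrow> complex \<Rightarrow> (complex \<Rightarrow> complex) \<Rightarrow> complex \<Rightarrow> complex"
  where "fc w1 w2 p d = integral usq (\<lambda>x. echar (- d) (par w1 w2 x) * p (par w1 w2 x))"

lemma continuous_par: "continuous_on S (par w1 w2)"
  unfolding par_def[abs_def] by (intro continuous_intros)

lemma continuous_echar: "continuous_on S (echar a)"
proof -
  have "continuous (at x) (echar a)" for x by (rule has_derivative_continuous[OF echar_has_derivative])
  then show ?thesis by (auto intro: continuous_at_imp_continuous_on)
qed

lemma continuous_on_par_comp:
  "continuous_on UNIV p \<Longrightarrow> continuous_on S (\<lambda>x. p (par w1 w2 x))"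
  using continuous_on_compose2[of UNIV p S "par w1 w2"] continuous_par by blast

lemma fc_integrable:
  fixes p :: "complex \<Rightarrow> complex"
  shows "continuous_on UNIV p \<Longrightarrow> (\<lambda>x. echar (- d) (par w1 w2 x) * p (par w1 w2 x)) integrable_on usq"
  by (intro integrable_usq continuous_on_mult continuous_on_par_comp continuous_echar)

lemma fc_add:
  assumes "continuous_on UNIV p" "continuous_on UNIV q"
  shows "fc w1 w2 (\<lambda>z. p z + q z) d = fc w1 w2 p d + fc w1 w2 q d"
  unfolding fc_def distrib_left by (intro integral_add fc_integrable assms)

lemma fc_cmult: "fc w1 w2 (\<lambda>z. c * p z) d = c * fc w1 w2 p d"
proof -
  have "(\<lambda>x. echar (- d) (par w1 w2 x) * (c * p (par w1 w2 x))) =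
    (\<lambda>x. c * (echar (- d) (par w1 w2 x) * p (par w1 w2 x)))"
    by (auto simp: algebra_simps)
  then show ?thesis unfolding fc_def by simp
qed

lemma fc_diff:
  assumes "continuous_on UNIV p" "continuous_on UNIV q"
  shows "fc w1 w2 (\<lambda>z. p z - q z) d = fc w1 w2 p d - fc w1 w2 q d"
  using fc_add[of p "\<lambda>z. - 1 * q z" w1 w2 d] assms fc_cmult[of w1 w2 "-1" q d]
  by (simp add: continuous_on_minus)

lemma fc_sum:
  assumes "\<And>i. i \<in> I \<Longrightarrow> continuous_on UNIV (p i)"
  shows "fc w1 w2 (\<lambda>z. \<Sum>i\<in>I. p i z) d = (\<Sum>i\<in>I. fc w1 w2 (p i) d)"
  using assms
proof (induction I rule: infinite_finite_induct)
  case (insert i I)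
  then show ?case by (simp add: fc_add continuous_on_sum)
qed (simp_all add: fc_def)

lemma fc_echar_mult: "fc w1 w2 (\<lambda>z. echar b z * p z) d = fc w1 w2 p (d - b)"
proof -
  have "echar (- d) z * (echar b z * p z) = echar (- (d - b)) z * p z" for z
    using echar_add[of "- d" b z] by (simp add: mult.assoc)
  then show ?thesis by (simp only: fc_def)
qed

lemma fc_cnj: "continuous_on UNIV p \<Longrightarrow> fc w1 w2 (\<lambda>z. cnj (p z)) d = cnj (fc w1 w2 p (- d))"
proof -
  assume p: "continuous_on UNIV p"
  have "echar (- d) z * cnj (p z) = cnj (echar (- (- d)) z * p z)" for z
    by (simp add: echar_minus)
  then have "fc w1 w2 (\<lambda>z. cnj (p z)) d =
    integral usq (\<lambda>x. cnj (echar (- (- d)) (par w1 w2 x) * p (par w1 w2 x)))"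
    by (simp only: fc_def)
  also have "\<dots> = cnj (fc w1 w2 p (- d))"
    using integral_linear[OF fc_integrable[OF p, of "- d" w1 w2] bounded_linear_cnj]
    by (simp only: fc_def o_def)
  finally show ?thesis .
qed

context
  fixes \<Gamma> :: "complex set" and w1 w2 :: complex
  assumes basis: "lattice_basis \<Gamma> w1 w2"
begin

lemma basis_det: "Re w1 * Im w2 - Im w1 * Re w2 \<noteq> 0"
proof
  assume d: "Re w1 * Im w2 - Im w1 * Re w2 = 0"
  have ind: "independent {w1, w2}" "w1 \<noteq> w2" using basis by (auto simp: lattice_basis_def)
  have lin: "a = 0 \<and> b = 0" if "a *\<^sub>R w1 + b *\<^sub>R w2 = 0" for a b
  proof -
    define u where "u v = (if v = w1 then a else b)" for v
    have "(\<Sum>v\<in>{w1, w2}. u v *\<^sub>R v) = 0" using ind(2) that by (simp add: u_def)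
    then have "u w1 = 0" "u w2 = 0" using independentD[OF ind(1), of "{w1, w2}" u] by auto
    then show ?thesis using ind(2) by (auto simp: u_def)
  qed
  have "Im w2 *\<^sub>R w1 + (- Im w1) *\<^sub>R w2 = 0" "Re w2 *\<^sub>R w1 + (- Re w1) *\<^sub>R w2 = 0"
    using d by (auto simp: complex_eq_iff algebra_simps)
  then have "w1 = 0" using lin by (metis complex_eqI neg_equal_0_iff_equal zero_complex.sel)
  then show False using lin[of 1 0] by simp
qed

lemma basis_mem: "w1 \<in> \<Gamma>" "w2 \<in> \<Gamma>"
proof -
  have "w1 = of_int 1 * w1 + of_int 0 * w2" "w2 = of_int 0 * w1 + of_int 1 * w2" by simp_all
  then show "w1 \<in> \<Gamma>" "w2 \<in> \<Gamma>" using basis unfolding lattice_basis_def by blast+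
qed

lemma par_surj: "\<exists>x. par w1 w2 x = z"
proof -
  define D where "D = Re w1 * Im w2 - Im w1 * Re w2"
  have D: "D \<noteq> 0" using basis_det by (simp add: D_def)
  define s where "s = (Re z * Im w2 - Im z * Re w2) / D"
  define t where "t = (Im z * Re w1 - Re z * Im w1) / D"
  have "(Re z * Im w2 - Im z * Re w2) * Re w1 + (Im z * Re w1 - Re z * Im w1) * Re w2 = Re z * D"
    "(Re z * Im w2 - Im z * Re w2) * Im w1 + (Im z * Re w1 - Re z * Im w1) * Im w2 = Im z * D"
    by (simp_all add: D_def algebra_simps)
  then have "s * Re w1 + t * Re w2 = Re z" "s * Im w1 + t * Im w2 = Im z"
    using D by (simp_all add: s_def t_def field_simps)
  then have "par w1 w2 (s, t) = z" by (simp add: par_def complex_eq_iff)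
  then show ?thesis by blast
qed

lemma echar_par: "echar d (par w1 w2 x) = cis (2 * pi * (fst x * (d \<bullet> w1) + snd x * (d \<bullet> w2)))"
proof -
  have "d \<bullet> par w1 w2 x = fst x * (d \<bullet> w1) + snd x * (d \<bullet> w2)"
    by (simp add: par_def inner_complex_def algebra_simps)
  then show ?thesis by (simp add: echar_def cis_conv_exp mult_ac)
qed

lemma mode_ex: "\<exists>d\<in>dual_lattice \<Gamma>. \<forall>x. echar (- d) (par w1 w2 x) = cexp m n x"
proof -
  define D where "D = Re w1 * Im w2 - Im w1 * Re w2"
  have D: "D \<noteq> 0" using basis_det by (simp add: D_def)
  \<comment> \<open>Cramer's rule for the system \<open>d \<bullet> w1 = - m\<close>,
    \<open>d \<bullet> w2 = - n\<close>; the signs fit the character \<open>echar (- d)\<close> in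
    \<open>fc\<close>.\<close>
  define d where "d = Complex ((of_int n * Im w1 - of_int m * Im w2) / D) ((of_int m *
    Re w2 - of_int n * Re w1) / D)"
  have e: "(of_int n * Im w1 - of_int m * Im w2) * Re w1 + (of_int m * Re w2 - of_int n * Re w1) * Im w1 =
    - of_int m * D"
    "(of_int n * Im w1 - of_int m * Im w2) * Re w2 + (of_int m * Re w2 - of_int n * Re w1) * Im w2 =
      - of_int n * D"
    by (simp_all add: D_def algebra_simps)
  have "d \<bullet> w1 = ((of_int n * Im w1 - of_int m * Im w2) * Re w1 +
    (of_int m * Re w2 - of_int n * Re w1) * Im w1) / D"
    "d \<bullet> w2 = ((of_int n * Im w1 - of_int m * Im w2) * Re w2 +
      (of_int m * Re w2 - of_int n * Re w1) * Im w2) / D"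
    by (simp_all add: d_def inner_complex_def add_divide_distrib)
  then have d: "d \<bullet> w1 = - of_int m" "d \<bullet> w2 = - of_int n" unfolding e using D by simp_all
  have "d \<bullet> z \<in> \<int>" if "z \<in> \<Gamma>" for z
  proof -
    obtain k l :: int where z: "z = of_int k * w1 + of_int l * w2"
      using \<open>z \<in> \<Gamma>\<close> basis unfolding lattice_basis_def by blast
    have "d \<bullet> z = of_int k * (d \<bullet> w1) + of_int l * (d \<bullet> w2)"
      by (simp add: z inner_complex_def algebra_simps)
    then show ?thesis unfolding d by auto
  qed
  then have "d \<in> dual_lattice \<Gamma>" by (simp add: dual_lattice_def)
  moreover have "echar (- d) (par w1 w2 x) = cexp m n x" for x
    by (simp add: echar_par cexp_def d mult_ac)
  ultimately show ?thesis by blast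
qed

lemma par_add: "par w1 w2 (s + 1, t) = par w1 w2 (s, t) + w1" "par w1 w2 (s, t + 1) = par w1 w2 (s, t) + w2"
  by (simp_all add: par_def algebra_simps)

lemma fc_complete:
  assumes p: "continuous_on UNIV p" "\<And>z w. w \<in> \<Gamma> \<Longrightarrow> p (z + w) = p z"
    and 0: "\<And>d. d \<in> dual_lattice \<Gamma> \<Longrightarrow> fc w1 w2 p d = 0"
  shows "p z = 0"
proof -
  define W where "W x = p (par w1 w2 x)" for x
  have "W \<in> null_modes" unfolding null_modes_def
  proof (intro CollectI conjI allI)
    show "continuous_on UNIV W" unfolding W_def[abs_def] by (intro continuous_on_par_comp p)
    fix m n
    obtain d where d: "d \<in> dual_lattice \<Gamma>" "\<And>x. echar (- d) (par w1 w2 x) = cexp m n x"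
      using mode_ex by blast
    show "integral usq (\<lambda>x. W x * cexp m n x) = 0"
      using 0[OF d(1)] unfolding fc_def d(2) W_def by (simp add: mult.commute)
  qed
  then have "W x = 0" for x
    by (rule null_modes_periodic_eq_0) (use p(2) basis_mem in \<open>auto simp: W_def par_add\<close>)
  moreover obtain x where "par w1 w2 x = z" using par_surj by blast
  ultimately show ?thesis unfolding W_def by metis
qed

text \<open>Integrating first along the lattice direction, the fundamental theorem of calculus gives
  a difference of values that periodicity annihilates; for \<open>w1\<close> the order of
  integration has to be swapped.\<close>

lemma integral_derivative_eq_0:
  fixes p :: "complex \<Rightarrow> complex"
  assumes der: "\<And>z. (p has_derivative p' z) (at z)" and cont: "\<And>v. continuous_on UNIV (\<lambda>z. p' z v)"
    and per: "\<And>z w. w \<in> \<Gamma> \<Longrightarrow> p (z + w) = p z"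
  shows "integral usq (\<lambda>x. p' (par w1 w2 x) w1) = 0" "integral usq (\<lambda>x. p' (par w1 w2 x) w2) = 0"
proof -
  have line: "integral (cbox 0 1) (\<lambda>t. p' (c + of_real t * w) w) = 0" if "w \<in> \<Gamma>" for c w
  proof -
    have "((\<lambda>t. p (c + of_real t * w)) has_vector_derivative p' (c +
      of_real t * w) w) (at t within {0..1})" for t :: real
    proof -
      have "((\<lambda>t::real. c + of_real t * w) has_derivative (\<lambda>h. of_real h * w)) (at t within {0..1})"
        by (auto intro!: derivative_eq_intros)
      from has_derivative_compose[OF this der]
      have "((\<lambda>t. p (c + of_real t * w)) has_derivative (\<lambda>h. p' (c +
        of_real t * w) (of_real h * w))) (at t within {0..1})" .
      moreover have "p' (c + of_real t * w) (of_real h * w) = h *\<^sub>R p' (c + of_real t * w) w" for h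
        using linear_scale[OF has_derivative_linear[OF der], of "c + of_real t * w" h w]
        by (simp add: scaleR_conv_of_real)
      ultimately show ?thesis by (simp add: has_vector_derivative_def)
    qed
    then have "((\<lambda>t. p' (c + of_real t * w) w) has_integral (p (c +
      of_real 1 * w) - p (c + of_real 0 * w))) {0..1}"
      by (intro fundamental_theorem_of_calculus) auto
    then show ?thesis using per[OF that, of c] by (simp add: integral_unique)
  qed
  have c: "continuous_on usq (\<lambda>x. p' (par w1 w2 x) v)" for v by (rule continuous_on_par_comp[OF cont])
  have "integral usq (\<lambda>x. p' (par w1 w2 x) w2) =
    integral (cbox 0 1) (\<lambda>s. integral (cbox 0 1) (\<lambda>t. p' (par w1 w2 (s, t)) w2))"
    by (rule integral_prod_continuous[OF c])
  also have "\<dots> = 0" using line[OF basis_mem(2)] by (simp add: par_def)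
  finally show "integral usq (\<lambda>x. p' (par w1 w2 x) w2) = 0" .
  have "integral usq (\<lambda>x. p' (par w1 w2 x) w1) =
    integral (cbox 0 1) (\<lambda>s. integral (cbox 0 1) (\<lambda>t. p' (par w1 w2 (s, t)) w1))"
    by (rule integral_prod_continuous[OF c])
  also have "\<dots> = integral (cbox 0 1) (\<lambda>t. integral (cbox 0 1) (\<lambda>s. p' (par w1 w2 (s, t)) w1))"
    by (rule integral_swap_continuous) (use c[of w1] in \<open>simp add: case_prod_unfold\<close>)
  also have "\<dots> = 0" using line[OF basis_mem(1)] by (simp add: par_def add.commute)
  finally show "integral usq (\<lambda>x. p' (par w1 w2 x) w1) = 0" .
qed

lemma echar_dual: "d \<in> dual_lattice \<Gamma> \<Longrightarrow> w \<in> \<Gamma> \<Longrightarrow> echar d (z + w) = echar d z"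
proof -
  assume "d \<in> dual_lattice \<Gamma>" "w \<in> \<Gamma>"
  then obtain n :: int where "d \<bullet> w = of_int n" by (auto simp: dual_lattice_def elim: Ints_cases)
  then have "echar d w = cis (2 * pi * of_int n)" by (simp add: echar_def cis_conv_exp mult_ac)
  also have "\<dots> = 1" using cis_eq_cis_iff[of "of_int n" 0] by auto
  finally show ?thesis by (simp add: echar_add_right)
qed

lemma fc_derivative:
  fixes p :: "complex \<Rightarrow> complex"
  assumes der: "\<And>z. (p has_derivative p' z) (at z)" and cont: "\<And>v. continuous_on UNIV (\<lambda>z. p' z v)"
    and per: "\<And>z w. w \<in> \<Gamma> \<Longrightarrow> p (z + w) = p z" and d: "d \<in> dual_lattice \<Gamma>"
  shows "fc w1 w2 (\<lambda>z. p' z v) d = 2 * pi * \<i> * of_real (d \<bullet> v) * fc w1 w2 p d"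
proof -
  have cp: "continuous_on UNIV p"
    using has_derivative_continuous[OF der] by (auto intro: continuous_at_imp_continuous_on)
  \<comment> \<open>The derivative of the product of \<open>echar (- d)\<close> and
    \<open>p\<close>; that its mean vanishes in lattice directions is integration by parts.\<close>
  define g' where "g' z v = echar (- d) z * p' z v +
    (2 * pi * \<i> * of_real ((- d) \<bullet> v)) * echar (- d) z * p z" for z v
  have "((\<lambda>z. echar (- d) z * p z) has_derivative g' z) (at z)" for z
    unfolding g'_def using has_derivative_mult[OF echar_has_derivative[of "- d" z] der[of z]] .
  note g = this
  have gc: "continuous_on UNIV (\<lambda>z. g' z v)" for v
    unfolding g'_def by (intro continuous_intros continuous_echar cont cp)
  have gp: "echar (- d) (z + w) * p (z + w) = echar (- d) z * p z" if "w \<in> \<Gamma>" for z w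
    using echar_dual[OF d that] per[OF that] by (simp add: echar_minus)
  note I = integral_derivative_eq_0[OF g gc gp]
  have split: "integral usq (\<lambda>x. g' (par w1 w2 x) v) =
    fc w1 w2 (\<lambda>z. p' z v) d - 2 * pi * \<i> * of_real (d \<bullet> v) * fc w1 w2 p d" for v
  proof -
    have "g' z v = echar (- d) z * (p' z v - (2 * pi * \<i> * of_real (d \<bullet> v)) * p z)" for z
      by (simp add: g'_def algebra_simps)
    then have "integral usq (\<lambda>x. g' (par w1 w2 x) v) =
      fc w1 w2 (\<lambda>z. p' z v - (2 * pi * \<i> * of_real (d \<bullet> v)) * p z) d"
      by (simp add: fc_def)
    also have "\<dots> = fc w1 w2 (\<lambda>z. p' z v) d - 2 * pi * \<i> * of_real (d \<bullet> v) * fc w1 w2 p d"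
      using fc_diff[of "\<lambda>z. p' z v" "\<lambda>z. (2 * pi * \<i> * of_real (d \<bullet> v)) * p z" w1 w2 d] cont cp
        fc_cmult[of w1 w2 "2 * pi * \<i> * of_real (d \<bullet> v)" p d]
      by (simp add: continuous_on_mult_left)
    finally show ?thesis .
  qed
  \<comment> \<open>So far the formula holds in the two basis directions only; both sides are real
    linear in the direction, which gives every \<open>v\<close>.\<close>
  have e: "fc w1 w2 (\<lambda>z. p' z w) d = 2 * pi * \<i> * of_real (d \<bullet> w) * fc w1 w2 p d" if "w = w1 \<or> w = w2" for w
    using I split[of w] that by auto
  obtain x where x: "v = par w1 w2 x" using par_surj by metis
  have v: "v = fst x *\<^sub>R w1 + snd x *\<^sub>R w2" by (simp add: x par_def scaleR_conv_of_real)
  have "p' z v = of_real (fst x) * p' z w1 + of_real (snd x) * p' z w2" for z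
    unfolding v scaleR_conv_of_real[where 'a=complex, of _ "p' z _", symmetric]
    by (simp only: linear_add[OF has_derivative_linear[OF der]]
      linear_scale[OF has_derivative_linear[OF der]])
  then have "fc w1 w2 (\<lambda>z. p' z v) d = of_real (fst x) * fc w1 w2 (\<lambda>z. p' z w1) d +
    of_real (snd x) * fc w1 w2 (\<lambda>z. p' z w2) d"
    by (simp add: fc_add fc_cmult cont continuous_on_mult_left)
  also have "\<dots> = 2 * pi * \<i> * of_real (d \<bullet> v) * fc w1 w2 p d"
    unfolding e[OF disjI1[OF refl]] e[OF disjI2[OF refl]] v by (simp add: inner_add_right algebra_simps)
  finally show ?thesis .
qed

lemma fc_echar:
  assumes "d \<in> dual_lattice \<Gamma>" "d' \<in> dual_lattice \<Gamma>"
  shows "fc w1 w2 (echar d') d = (if d = d' then 1 else 0)"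
proof -
  have dd: "d - d' \<in> dual_lattice \<Gamma>"
    using assms by (auto simp: dual_lattice_def inner_diff_left)
  have 1: "fc w1 w2 (echar d') d = fc w1 w2 (\<lambda>_. 1) (d - d')"
    using fc_echar_mult[of w1 w2 d' "\<lambda>_. 1" d] by simp
  show ?thesis
  proof (cases "d = d'")
    case True
    then show ?thesis unfolding 1 by (simp add: fc_def content_Pair)
  next
    case False
    \<comment> \<open>The constant function is differentiated in the direction \<open>d - d'\<close>
      itself, so that the factor is a nonzero multiple of |d - d'| squared and the coefficient must
      vanish.\<close>
    have "fc w1 w2 (\<lambda>z. 0) (d - d') = 2 * pi * \<i> * of_real ((d - d') \<bullet> (d - d')) * fc w1 w2 (\<lambda>_. 1) (d - d')"
      by (rule fc_derivative[where p = "\<lambda>_. 1" and p' = "\<lambda>_ _. 0"]) (use dd in auto)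
    then show ?thesis unfolding 1 using False by (simp add: fc_def)
  qed
qed

end

section \<open>The general immersion\<close>

context hsl_setting
begin

abbreviation "F \<equiv> freqs \<Gamma> \<beta>0"
abbreviation "sh g \<equiv> g + \<beta>0 / 2"

lemma sum_freqs_minus: "(\<Sum>g\<in>F. h (- g)) = (\<Sum>g\<in>F. h g)"
  by (rule sum.reindex_bij_witness[of _ uminus uminus]) (auto simp: freqs_minus)

lemma sh_dual: "g \<in> F \<Longrightarrow> sh g \<in> dual_lattice \<Gamma>"
proof -
  assume "g \<in> F"
  then obtain d where d: "d \<in> dual_lattice \<Gamma>" "g = d + \<beta>0 / 2" by (auto simp: freqs_def)
  have "d - (- \<beta>0) \<in> dual_lattice \<Gamma>" using d(1) \<beta>0_dual dual_lattice_diff dual_lattice_minus by blast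
  then show ?thesis by (simp add: d(2) add.assoc)
qed

lemma freqs_sh: "d \<in> dual_lattice \<Gamma> \<Longrightarrow> cmod (d - \<beta>0 / 2) = cmod \<beta>0 / 2 \<Longrightarrow> d \<noteq> 0 \<Longrightarrow> d \<noteq> \<beta>0 \<Longrightarrow>
    d - \<beta>0 / 2 \<in> F"
proof -
  assume d: "d \<in> dual_lattice \<Gamma>" "cmod (d - \<beta>0 / 2) = cmod \<beta>0 / 2" "d \<noteq> 0" "d \<noteq> \<beta>0"
  have "d - \<beta>0 \<in> dual_lattice \<Gamma>" using d(1) \<beta>0_dual dual_lattice_diff by blast
  moreover have "d - \<beta>0 / 2 = (d - \<beta>0) + \<beta>0 / 2" by (simp add: field_simps)
  ultimately have "\<exists>\<delta>\<in>dual_lattice \<Gamma>. d - \<beta>0 / 2 = \<delta> + \<beta>0 / 2" by blast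
  moreover have "d - \<beta>0 / 2 \<noteq> \<beta>0 / 2" using d(4) by (auto simp: diff_eq_eq)
  moreover have "d - \<beta>0 / 2 \<noteq> - (\<beta>0 / 2)" using d(3) by simp
  ultimately show ?thesis using d(2) by (auto simp: freqs_def)
qed

lemma freqs_nz: "g \<in> F \<Longrightarrow> sh g \<noteq> 0" "g \<in> F \<Longrightarrow> g \<noteq> 0" "g \<in> F \<Longrightarrow> \<beta>0 / 2 - g \<noteq> 0"
  using freqs_minus[of g] by (auto simp: freqs_def add_eq_0_iff2)

text \<open>
  The general HSL immersion. Its coefficients \<open>a\<close> are those of \<open>P\<^sub>z\<close>, up to the factor \<open>\<pi> i e\<^bsub>\<beta>0/2\<^esub>\<close>.
\<close>

definition famP :: "(complex \<Rightarrow> complex) \<Rightarrow> complex \<Rightarrow> complex"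
  where "famP a z = (\<Sum>g\<in>F. a g / cnj (sh g) * (echar (sh g) z - 1))"

definition famQ :: "(complex \<Rightarrow> complex) \<Rightarrow> complex \<Rightarrow> complex"
  where "famQ a z = (\<Sum>g\<in>F. - \<i> * cnj (a (- g)) / sh g * (echar (sh g) z - 1))"

definition fam :: "(complex \<Rightarrow> complex) \<Rightarrow> complex \<Rightarrow> real ^ 4"
  where "fam a z = Rvec (famP a z) (famQ a z)"

definition modeA :: "(complex \<Rightarrow> complex) \<Rightarrow> complex \<Rightarrow> complex"
  where "modeA a z = (\<Sum>g\<in>F. a g * echar g z)"

text \<open>Up to nonvanishing factors, \<open>modeA\<close> is P_z and \<open>modeB\<close> is
  P_zbar.\<close>

definition modeB :: "(complex \<Rightarrow> complex) \<Rightarrow> complex \<Rightarrow> complex"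
  where "modeB a z = (\<Sum>g\<in>F. a g * node \<beta>0 g * echar g z)"

abbreviation "\<mu> \<equiv> \<beta>0 / cnj \<beta>0"

text \<open>With \<open>sh g = (1 + s) * \<beta>0 / 2\<close> and |s| = 1, the quotient of 1 + s by
  its conjugate is s. Thus passing from P_z to P_zbar multiplies each mode by its node and a common
  constant.\<close>

lemma sh_ratio: "g \<in> F \<Longrightarrow> sh g / cnj (sh g) = node \<beta>0 g * \<mu>"
proof -
  assume g: "g \<in> F"
  have n: "node \<beta>0 g * cnj (node \<beta>0 g) = 1"
    using norm_node[OF g] complex_norm_square[of "node \<beta>0 g"] by simp
  have gs: "g = node \<beta>0 g * \<beta>0 / 2" by (simp add: node_def)
  have "sh g = node \<beta>0 g * \<mu> * cnj (sh g)"
  proof -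
    have "node \<beta>0 g * \<mu> * cnj (sh g) = \<mu> * (node \<beta>0 g * cnj (node \<beta>0 g) * cnj \<beta>0 + node \<beta>0 g * cnj \<beta>0) / 2"
      by (subst gs) (simp add: field_simps)
    also have "\<dots> = \<mu> * cnj \<beta>0 * (1 + node \<beta>0 g) / 2" unfolding n by (simp add: algebra_simps)
    also have "\<dots> = sh g" by (simp add: node_def field_simps)
    finally show ?thesis by simp
  qed
  moreover have "cnj (sh g) \<noteq> 0" using freqs_nz(1)[OF g] complex_cnj_zero_iff by blast
  ultimately show ?thesis by (metis nonzero_divide_eq_eq)
qed

lemma echar_sh: "echar (sh g) z = echar (\<beta>0 / 2) z * echar g z"
  by (simp add: echar_add mult.commute)

lemma sum_has_derivative:
  "((\<lambda>z. \<Sum>g\<in>F. c g * (echar (sh g) z - 1)) has_derivative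
    (\<lambda>v. (\<Sum>g\<in>F. pi * \<i> * c g * cnj (sh g) * echar (sh g) z) * v
       + (\<Sum>g\<in>F. pi * \<i> * c g * sh g * echar (sh g) z) * cnj v)) (at z)"
proof -
  have "((\<lambda>z. \<Sum>g\<in>F. c g * (echar (sh g) z - 1)) has_derivative
    (\<lambda>v. \<Sum>g\<in>F. c g * ((2 * pi * \<i> * of_real (sh g \<bullet> v)) * echar (sh g) z))) (at z)"
    by (intro has_derivative_sum has_derivative_mult_right)
       (use has_derivative_diff[OF echar_has_derivative has_derivative_const] in simp)
  then show ?thesis
  proof (rule has_derivative_eq_rhs)
    show "(\<lambda>v. \<Sum>g\<in>F. c g * ((2 * pi * \<i> * of_real (sh g \<bullet> v)) * echar (sh g) z)) =
      (\<lambda>v. (\<Sum>g\<in>F. pi * \<i> * c g * cnj (sh g) * echar (sh g) z) * v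
       + (\<Sum>g\<in>F. pi * \<i> * c g * sh g * echar (sh g) z) * cnj v)"
    proof
      fix v
      have "c g * ((2 * pi * \<i> * of_real (sh g \<bullet> v)) * echar (sh g) z) =
        pi * \<i> * c g * cnj (sh g) * echar (sh g) z * v + pi * \<i> * c g * sh g * echar (sh g) z * cnj v" for g
        unfolding of_real_inner_complex by (simp add: algebra_simps)
      then show "(\<Sum>g\<in>F. c g * ((2 * pi * \<i> * of_real (sh g \<bullet> v)) * echar (sh g) z)) =
        (\<Sum>g\<in>F. pi * \<i> * c g * cnj (sh g) * echar (sh g) z) * v
       + (\<Sum>g\<in>F. pi * \<i> * c g * sh g * echar (sh g) z) * cnj v"
        by (simp only: sum.distrib sum_distrib_right)
    qed
  qed
qed

lemma famP_has_derivative: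
  "(famP a has_derivative (\<lambda>v. pi * \<i> * echar (\<beta>0 / 2) z * modeA a z * v
     + pi * \<i> * echar (\<beta>0 / 2) z * \<mu> * modeB a z * cnj v)) (at z)"
proof -
  have 1: "(\<Sum>g\<in>F. pi * \<i> * (a g / cnj (sh g)) * cnj (sh g) * echar (sh g) z) =
    pi * \<i> * echar (\<beta>0 / 2) z * modeA a z"
    unfolding modeA_def sum_distrib_left
  proof (rule sum.cong[OF refl])
    fix g assume "g \<in> F"
    then show "pi * \<i> * (a g / cnj (sh g)) * cnj (sh g) * echar (sh g) z =
      pi * \<i> * echar (\<beta>0 / 2) z * (a g * echar g z)"
      using freqs_nz(1)[of g] unfolding echar_sh by (simp del: complex_cnj_add)
  qed
  have 2: "(\<Sum>g\<in>F. pi * \<i> * (a g / cnj (sh g)) * sh g * echar (sh g) z) =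
    pi * \<i> * echar (\<beta>0 / 2) z * \<mu> * modeB a z"
    unfolding modeB_def sum_distrib_left
  proof (rule sum.cong[OF refl])
    fix g assume g: "g \<in> F"
    have "pi * \<i> * (a g / cnj (sh g)) * sh g * echar (sh g) z =
      pi * \<i> * a g * (sh g / cnj (sh g)) * echar (sh g) z"
      by simp
    also have "\<dots> = pi * \<i> * echar (\<beta>0 / 2) z * \<mu> * (a g * node \<beta>0 g * echar g z)"
      unfolding sh_ratio[OF g] echar_sh by (simp add: mult_ac)
    finally show "pi * \<i> * (a g / cnj (sh g)) * sh g * echar (sh g) z = \<dots>" .
  qed
  show ?thesis using sum_has_derivative[of "\<lambda>g. a g / cnj (sh g)" z] unfolding 1 2 famP_def[abs_def] .
qed

lemma i_cancel: "p * \<i> * (- \<i> * x / s) * c * e = p * x * (c / s) * e"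
  by (simp add: algebra_simps)

lemma famQ_has_derivative:
  "(famQ a has_derivative (\<lambda>v. - \<i> * echar \<beta>0 z * cnj (pi * \<i> * echar (\<beta>0 / 2) z * \<mu> * modeB a z) * v
     + \<i> * echar \<beta>0 z * cnj (pi * \<i> * echar (\<beta>0 / 2) z * modeA a z) * cnj v)) (at z)"
proof -
  have eb: "echar \<beta>0 z * cnj (echar (\<beta>0 / 2) z) = echar (\<beta>0 / 2) z"
    unfolding echar_minus[symmetric] echar_add[symmetric] by simp
  have 1: "(\<Sum>g\<in>F. pi * \<i> * (- \<i> * cnj (a (- g)) / sh g) * cnj (sh g) * echar (sh g) z) =
      - \<i> * echar \<beta>0 z * cnj (pi * \<i> * echar (\<beta>0 / 2) z * \<mu> * modeB a z)"
  proof -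
    have "- \<i> * echar \<beta>0 z * cnj (pi * \<i> * echar (\<beta>0 / 2) z * \<mu> * modeB a z) =
        - pi * (echar \<beta>0 z * cnj (echar (\<beta>0 / 2) z)) * (cnj \<beta>0 / \<beta>0) * cnj (modeB a z)"
      unfolding complex_cnj_mult complex_cnj_i complex_cnj_complex_of_real complex_cnj_divide complex_cnj_cnj
      by (simp add: algebra_simps)
    also have "cnj (modeB a z) = (\<Sum>g\<in>F. cnj (a (- g)) * cnj (node \<beta>0 (- g)) * cnj (echar (- g) z))"
      unfolding sum_freqs_minus[of "\<lambda>g. cnj (a g) * cnj (node \<beta>0 g) * cnj (echar g z)"]
      by (simp add: modeB_def cnj_sum)
    finally have R: "- \<i> * echar \<beta>0 z * cnj (pi * \<i> * echar (\<beta>0 / 2) z * \<mu> * modeB a z) =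
      (\<Sum>g\<in>F. - pi * echar (\<beta>0 / 2) z * (cnj \<beta>0 / \<beta>0) *
        (cnj (a (- g)) * cnj (node \<beta>0 (- g)) * cnj (echar (- g) z)))"
      unfolding eb sum_distrib_left .
    show ?thesis unfolding R
    proof (rule sum.cong[OF refl])
      fix g assume g: "g \<in> F"
      have "cnj (sh g) / sh g = cnj (node \<beta>0 g) * (cnj \<beta>0 / \<beta>0)"
        using arg_cong[OF sh_ratio[OF g], of cnj] by simp
      moreover have "pi * \<i> * (- \<i> * cnj (a (- g)) / sh g) * cnj (sh g) * echar (sh g) z
          = pi * cnj (a (- g)) * (cnj (sh g) / sh g) * echar (sh g) z"
        by (rule i_cancel)
      ultimately have "pi * \<i> * (- \<i> * cnj (a (- g)) / sh g) * cnj (sh g) * echar (sh g) z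
          = pi * cnj (a (- g)) * (cnj (node \<beta>0 g) * (cnj \<beta>0 / \<beta>0)) * echar (sh g) z" by simp
      then show "pi * \<i> * (- \<i> * cnj (a (- g)) / sh g) * cnj (sh g) * echar (sh g) z =
         - pi * echar (\<beta>0 / 2) z * (cnj \<beta>0 / \<beta>0) *
           (cnj (a (- g)) * cnj (node \<beta>0 (- g)) * cnj (echar (- g) z))"
        unfolding echar_sh by (simp add: echar_minus mult_ac)
    qed
  qed
  have 2: "(\<Sum>g\<in>F. pi * \<i> * (- \<i> * cnj (a (- g)) / sh g) * sh g * echar (sh g) z) =
      \<i> * echar \<beta>0 z * cnj (pi * \<i> * echar (\<beta>0 / 2) z * modeA a z)"
  proof -
    have "\<i> * echar \<beta>0 z * cnj (pi * \<i> * echar (\<beta>0 / 2) z * modeA a z) =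
        pi * (echar \<beta>0 z * cnj (echar (\<beta>0 / 2) z)) * cnj (modeA a z)"
      unfolding complex_cnj_mult complex_cnj_i complex_cnj_complex_of_real by (simp add: algebra_simps)
    also have "cnj (modeA a z) = (\<Sum>g\<in>F. cnj (a (- g)) * cnj (echar (- g) z))"
      unfolding sum_freqs_minus[of "\<lambda>g. cnj (a g) * cnj (echar g z)"] by (simp add: modeA_def cnj_sum)
    finally have R: "\<i> * echar \<beta>0 z * cnj (pi * \<i> * echar (\<beta>0 / 2) z * modeA a z) =
       (\<Sum>g\<in>F. pi * echar (\<beta>0 / 2) z * (cnj (a (- g)) * cnj (echar (- g) z)))"
      unfolding eb sum_distrib_left .
    show ?thesis unfolding R
    proof (rule sum.cong[OF refl])
      fix g assume "g \<in> F"
      then show "pi * \<i> * (- \<i> * cnj (a (- g)) / sh g) * sh g * echar (sh g) z =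
        pi * echar (\<beta>0 / 2) z * (cnj (a (- g)) * cnj (echar (- g) z))"
        using freqs_nz(1)[of g] unfolding echar_sh by (simp add: echar_minus mult_ac)
    qed
  qed
  show ?thesis
    using sum_has_derivative[of "\<lambda>g. - \<i> * cnj (a (- g)) / sh g" z] unfolding 1 2 famQ_def[abs_def] .
qed

lemma fam_d_z:
  fixes a z
  defines "p \<equiv> pi * \<i> * echar (\<beta>0 / 2) z * modeA a z"
    and "p' \<equiv> pi * \<i> * echar (\<beta>0 / 2) z * \<mu> * modeB a z"
  shows "d_z (fam a) z = Wvec p (- \<i> * echar \<beta>0 z * cnj p') (cnj p') (cnj (\<i> * echar \<beta>0 z * cnj p))"
    and "d_zbar (fam a) z = Wvec p' (\<i> * echar \<beta>0 z * cnj p) (cnj p) (cnj (- \<i> * echar \<beta>0 z * cnj p'))"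
proof -
  have R: "bounded_linear (\<lambda>x::complex \<times> complex. Rvec (fst x) (snd x))"
    by (rule bounded_linear_Rvec[OF bounded_linear_fst bounded_linear_snd])
  have "((\<lambda>z. (famP a z, famQ a z)) has_derivative
     (\<lambda>v. (p * v + p' * cnj v, - \<i> * echar \<beta>0 z * cnj p' * v + \<i> * echar \<beta>0 z * cnj p * cnj v))) (at z)"
    unfolding p_def p'_def by (rule has_derivative_Pair[OF famP_has_derivative famQ_has_derivative])
  from bounded_linear.has_derivative[OF R this]
  have "(fam a has_derivative (\<lambda>v. Rvec (p * v + p' * cnj v)
      ((- \<i> * echar \<beta>0 z * cnj p') * v + (\<i> * echar \<beta>0 z * cnj p) * cnj v))) (at z)"
    by (simp add: fam_def[abs_def])
  from wirtinger_Wvec[OF this]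
  show "d_z (fam a) z = Wvec p (- \<i> * echar \<beta>0 z * cnj p') (cnj p') (cnj (\<i> * echar \<beta>0 z * cnj p))"
    and "d_zbar (fam a) z = Wvec p' (\<i> * echar \<beta>0 z * cnj p) (cnj p) (cnj (- \<i> * echar \<beta>0 z * cnj p'))"
    by blast+
qed

lemma smooth_fam: "smooth_on UNIV (fam a)"
proof -
  define T where "T g x = Rvec (a g / cnj (sh g) * x) (- \<i> * cnj (a (- g)) / sh g * x)" for g x
  have sum: "(\<Sum>g\<in>A. Rvec (p g) (q g)) = Rvec (sum p A) (sum q A)" for A p q
    by (induction A rule: infinite_finite_induct) (auto simp: Rvec_ops)
  have "fam a = (\<lambda>z. (\<Sum>g\<in>F. T g (echar (sh g) z)) + (\<Sum>g\<in>F. - T g 1))"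
  proof
    fix z
    have "(\<Sum>g\<in>F. T g (echar (sh g) z)) + (\<Sum>g\<in>F. - T g 1) = (\<Sum>g\<in>F. T g (echar (sh g) z) - T g 1)"
      by (simp add: sum.distrib[symmetric])
    also have "\<dots> = (\<Sum>g\<in>F. Rvec (a g / cnj (sh g) * (echar (sh g) z - 1)) (- \<i> *
      cnj (a (- g)) / sh g * (echar (sh g) z - 1)))"
      unfolding T_def Rvec_ops right_diff_distrib by simp
    also have "\<dots> = fam a z" unfolding sum fam_def famP_def famQ_def ..
    finally show "fam a z = (\<Sum>g\<in>F. T g (echar (sh g) z)) + (\<Sum>g\<in>F. - T g 1)" by simp
  qed
  moreover have "bounded_linear (T g)" for g
    unfolding T_def[abs_def] by (intro bounded_linear_Rvec bounded_linear_mult_right)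
  ultimately show ?thesis
    by (simp only:) (intro smooth_on_add smooth_on_const smooth_on_sum smooth_on_echar)
qed

lemma basis_ex: obtains w1 w2 where "lattice_basis \<Gamma> w1 w2"
  using lattice by (auto simp: is_lattice_def)

lemma echar_inverse_mode:
  assumes "lattice_basis \<Gamma> w1 w2" "d \<in> F" "finite F"
  shows "fc w1 w2 (\<lambda>z. echar (\<beta>0 / 2) z * modeA a z) (sh d) = a d"
proof -
  have "(\<lambda>z. echar (\<beta>0 / 2) z * modeA a z) = (\<lambda>z. \<Sum>g\<in>F. a g * echar (sh g) z)"
    unfolding modeA_def echar_sh by (auto simp: sum_distrib_left mult_ac)
  then have "fc w1 w2 (\<lambda>z. echar (\<beta>0 / 2) z * modeA a z) (sh d) =
    (\<Sum>g\<in>F. a g * fc w1 w2 (echar (sh g)) (sh d))"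
    by (simp add: fc_sum fc_cmult continuous_on_mult_left continuous_echar)
  also have "\<dots> = (\<Sum>g\<in>F. if d = g then a g else 0)"
    using assms by (intro sum.cong) (auto simp: fc_echar[OF assms(1)] sh_dual)
  also have "\<dots> = a d" using assms by simp
  finally show ?thesis .
qed

lemma modeA_inj:
  assumes "\<And>z. modeA a z = 0" "d \<in> F"
  shows "a d = 0"
proof -
  obtain w1 w2 where b: "lattice_basis \<Gamma> w1 w2" using basis_ex .
  show ?thesis using echar_inverse_mode[OF b assms(2) fin_freqs, of a] assms(1) by (simp add: fc_def)
qed

lemma fam_in_HSL:
  assumes "\<exists>g\<in>F. a g \<noteq> 0"
  shows "fam a \<in> HSL \<Gamma> \<beta>0"
  unfolding HSL_def
proof (intro CollectI conjI allI ballI)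
  show "smooth_on UNIV (fam a)" by (rule smooth_fam)
  show "fam a 0 = 0" by (simp add: fam_def famP_def famQ_def Rvec_ops)
  fix z
  show "fam a (z + w) = fam a z" if "w \<in> \<Gamma>" for w
  proof -
    obtain w1 w2 where b: "lattice_basis \<Gamma> w1 w2" using basis_ex .
    have "echar (sh g) (z + w) = echar (sh g) z" if "g \<in> F" for g
      using echar_dual[OF b sh_dual[OF that] \<open>w \<in> \<Gamma>\<close>] .
    then show ?thesis by (simp add: fam_def famP_def famQ_def)
  qed
  show "expJ (beta \<beta>0 z) (Lop (d_z (fam a) z)) = \<i> *s d_z (fam a) z"
    unfolding fam_d_z by (subst HSL_equation_iff[of "echar \<beta>0 z"]) (simp_all add: cis_beta)
next
  show "\<not> (\<exists>c. \<forall>z. fam a z = c)"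
  proof
    assume "\<exists>c. \<forall>z. fam a z = c"
    then obtain c where "fam a = (\<lambda>_. c)" by auto
    then have "(fam a has_derivative (\<lambda>v. Rvec (0 * v + 0 * cnj v) (0 * v + 0 * cnj v))) (at z)" for z
      by (simp add: Rvec_ops)
    then have "d_z (fam a) z = Wvec 0 0 (cnj 0) (cnj 0)" for z by (rule wirtinger_Wvec)
    then have "modeA a z = 0" for z unfolding fam_d_z Wvec_eq_iff by simp
    then show False using modeA_inj assms by blast
  qed
qed

text \<open>The coefficient of Q at d is tied to that of P at \<beta>0 - d by two equations, one
  from each Wirtinger derivative. They are compatible with a nonzero coefficient only on the circle
  that defines the frequencies; the other modes vanish, and completeness of the characters gives the
  finite sum.\<close>

lemma HSL_imp_fam:
  assumes "f \<in> HSL \<Gamma> \<beta>0"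
  shows "\<exists>a. f = fam a"
proof -
  obtain w1 w2 where b: "lattice_basis \<Gamma> w1 w2" using basis_ex .
  note f = assms[unfolded HSL_def mem_Collect_eq]
  have sm: "smooth_on UNIV f" using f by blast
  define f' where "f' z = frechet_derivative f (at z)" for z
  have f': "(f has_derivative f' z) (at z)" for z unfolding f'_def by (rule smooth_onD(1)[OF sm])
  have cf': "continuous_on UNIV (\<lambda>z. f' z v)" for v unfolding f'_def by (rule smooth_onD(3)[OF sm])
  define P where "P z = fstc (f z)" for z
  define Q where "Q z = sndc (f z)" for z
  have fPQ: "f z = Rvec (P z) (Q z)" for z by (simp add: P_def Q_def)
  have dP: "(P has_derivative (\<lambda>v. fstc (f' z v))) (at z)"
    and dQ: "(Q has_derivative (\<lambda>v. sndc (f' z v))) (at z)" for z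
    unfolding P_def[abs_def] Q_def[abs_def]
    by (rule bounded_linear.has_derivative[OF bounded_linear_fstc f']
      bounded_linear.has_derivative[OF bounded_linear_sndc f'])+
  have cP': "continuous_on UNIV (\<lambda>z. fstc (f' z v))" and cQ': "continuous_on UNIV (\<lambda>z. sndc (f' z v))" for v
    by (rule bounded_linear.continuous_on[OF bounded_linear_fstc cf']
      bounded_linear.continuous_on[OF bounded_linear_sndc cf'])+
  have cP: "continuous_on UNIV P" and cQ: "continuous_on UNIV Q"
    unfolding P_def[abs_def] Q_def[abs_def]
    by (rule bounded_linear.continuous_on[OF bounded_linear_fstc smooth_onD(2)[OF sm]]
        bounded_linear.continuous_on[OF bounded_linear_sndc smooth_onD(2)[OF sm]])+
  have perP: "P (z + w) = P z" and perQ: "Q (z + w) = Q z" if "w \<in> \<Gamma>" for z w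
    using f that by (auto simp: P_def Q_def)
  have P0: "P 0 = 0" "Q 0 = 0" using f by (auto simp: P_def Q_def fstc_def sndc_def complex_eq_iff)
  define pz where "pz z = (fstc (f' z 1) - \<i> * fstc (f' z \<i>)) / 2" for z
  define pb where "pb z = (fstc (f' z 1) + \<i> * fstc (f' z \<i>)) / 2" for z
  define qz where "qz z = (sndc (f' z 1) - \<i> * sndc (f' z \<i>)) / 2" for z
  define qb where "qb z = (sndc (f' z 1) + \<i> * sndc (f' z \<i>)) / 2" for z
  have eqs: "qb z = \<i> * echar \<beta>0 z * cnj (pz z)" "qz z = - \<i> * echar \<beta>0 z * cnj (pb z)" for z
  proof -
    have "fstc (f' z v) = pz z * v + pb z * cnj v" "sndc (f' z v) = qz z * v + qb z * cnj v" for v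
      unfolding pz_def pb_def qz_def qb_def
      by (rule linear_complex_eq[OF has_derivative_linear[OF dP]]
        linear_complex_eq[OF has_derivative_linear[OF dQ]])+
    then have "f' z = (\<lambda>v. Rvec (pz z * v + pb z * cnj v) (qz z * v + qb z * cnj v))"
      by (metis Rvec_fstc_sndc)
    with f'[of z] have "d_z f z = Wvec (pz z) (qz z) (cnj (pb z)) (cnj (qb z))"
      using wirtinger_Wvec(1) by simp
    moreover have "expJ (beta \<beta>0 z) (Lop (d_z f z)) = \<i> *s d_z f z" using f by blast
    ultimately have "qb z = \<i> * echar \<beta>0 z * cnj (pz z) \<and> qz z = - \<i> * echar \<beta>0 z * cnj (pb z)"
      using HSL_equation_iff[OF norm_echar cis_beta(1)] by simp
    then show "qb z = \<i> * echar \<beta>0 z * cnj (pz z)" "qz z = - \<i> * echar \<beta>0 z * cnj (pb z)" by auto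
  qed
  have wz: "fc w1 w2 (\<lambda>z. (p' z 1 - \<i> * p' z \<i>) / 2) d = pi * \<i> * cnj d * fc w1 w2 p d"
    "fc w1 w2 (\<lambda>z. (p' z 1 + \<i> * p' z \<i>) / 2) d = pi * \<i> * d * fc w1 w2 p d"
    if "\<And>z. (p has_derivative p' z) (at z)" "\<And>v. continuous_on UNIV (\<lambda>z. p' z v)"
      "\<And>z w. w \<in> \<Gamma> \<Longrightarrow> p (z + w) = p z" "d \<in> dual_lattice \<Gamma>" for p p' d
  proof -
    have D: "fc w1 w2 (\<lambda>z. p' z v) d = 2 * pi * \<i> * of_real (d \<bullet> v) * fc w1 w2 p d" for v
      by (rule fc_derivative[OF b that])
    define x where "x = complex_of_real (Re d)"
    define y where "y = complex_of_real (Im d)"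
    have dd: "x + \<i> * y = d" "cnj d = x - \<i> * y" by (auto simp: x_def y_def complex_eq_iff)
    have in1: "complex_of_real (d \<bullet> 1) = x" "complex_of_real (d \<bullet> \<i>) = y"
      by (simp_all add: inner_complex_def x_def y_def)
    have "(\<lambda>z. (p' z 1 - \<i> * p' z \<i>) / 2) = (\<lambda>z. (1/2) * p' z 1 + (- \<i> / 2) * p' z \<i>)"
      "(\<lambda>z. (p' z 1 + \<i> * p' z \<i>) / 2) = (\<lambda>z. (1/2) * p' z 1 + (\<i> / 2) * p' z \<i>)"
      by (auto simp: field_simps)
    then have e: "fc w1 w2 (\<lambda>z. (p' z 1 - \<i> * p' z \<i>) / 2) d =
      (1/2) * fc w1 w2 (\<lambda>z. p' z 1) d + (- \<i> / 2) * fc w1 w2 (\<lambda>z. p' z \<i>) d"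
      "fc w1 w2 (\<lambda>z. (p' z 1 + \<i> * p' z \<i>) / 2) d =
        (1/2) * fc w1 w2 (\<lambda>z. p' z 1) d + (\<i> / 2) * fc w1 w2 (\<lambda>z. p' z \<i>) d"
      by (simp_all only: fc_add fc_cmult continuous_on_mult_left that(2))
    show "fc w1 w2 (\<lambda>z. (p' z 1 - \<i> * p' z \<i>) / 2) d = pi * \<i> * cnj d * fc w1 w2 p d"
      "fc w1 w2 (\<lambda>z. (p' z 1 + \<i> * p' z \<i>) / 2) d = pi * \<i> * d * fc w1 w2 p d"
      unfolding e D[of 1] D[of \<i>] in1 dd(2) unfolding dd(1)[symmetric] by (simp_all add: algebra_simps)
  qed
  define \<phi> where "\<phi> = fc w1 w2 P"
  define \<psi> where "\<psi> = fc w1 w2 Q"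
  \<comment> \<open>Multiplication by the character of \<beta>0 shifts a coefficient, and
    conjugation reflects its index; together they produce \<beta>0 - d.\<close>
  have rel: "d * \<psi> d = \<i> * (d - \<beta>0) * cnj (\<phi> (\<beta>0 - d))" "cnj d * \<psi> d = - \<i> * cnj (d - \<beta>0) * cnj (\<phi> (\<beta>0 - d))"
    if d: "d \<in> dual_lattice \<Gamma>" for d
  proof -
    have d': "\<beta>0 - d \<in> dual_lattice \<Gamma>" using d \<beta>0_dual dual_lattice_diff by blast
    have pin: "complex_of_real pi * \<i> \<noteq> 0" by simp
    have cc: "continuous_on UNIV pz" "continuous_on UNIV pb"
      unfolding pz_def[abs_def] pb_def[abs_def] by (intro continuous_intros cP'; simp)+
    have "pi * \<i> * d * \<psi> d = fc w1 w2 qb d"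
      using wz(2)[OF dQ cQ' perQ d] by (simp add: \<psi>_def qb_def[abs_def])
    also have "\<dots> = \<i> * fc w1 w2 (\<lambda>z. echar \<beta>0 z * cnj (pz z)) d"
      unfolding eqs(1)[abs_def] mult.assoc by (rule fc_cmult)
    also have "\<dots> = \<i> * cnj (fc w1 w2 pz (\<beta>0 - d))"
      unfolding fc_echar_mult fc_cnj[OF cc(1)] by simp
    also have "fc w1 w2 pz (\<beta>0 - d) = pi * \<i> * cnj (\<beta>0 - d) * \<phi> (\<beta>0 - d)"
      using wz(1)[OF dP cP' perP d'] by (simp add: \<phi>_def pz_def[abs_def])
    finally have "(pi * \<i>) * (d * \<psi> d) = (pi * \<i>) * (\<i> * (d - \<beta>0) * cnj (\<phi> (\<beta>0 - d)))"
      by (simp add: algebra_simps)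
    then show "d * \<psi> d = \<i> * (d - \<beta>0) * cnj (\<phi> (\<beta>0 - d))" by simp
    have "pi * \<i> * cnj d * \<psi> d = fc w1 w2 qz d"
      using wz(1)[OF dQ cQ' perQ d] by (simp add: \<psi>_def qz_def[abs_def])
    also have "\<dots> = - \<i> * fc w1 w2 (\<lambda>z. echar \<beta>0 z * cnj (pb z)) d"
      unfolding eqs(2)[abs_def] mult.assoc by (rule fc_cmult)
    also have "\<dots> = - \<i> * cnj (fc w1 w2 pb (\<beta>0 - d))"
      unfolding fc_echar_mult fc_cnj[OF cc(2)] by simp
    also have "fc w1 w2 pb (\<beta>0 - d) = pi * \<i> * (\<beta>0 - d) * \<phi> (\<beta>0 - d)"
      using wz(2)[OF dP cP' perP d'] by (simp add: \<phi>_def pb_def[abs_def])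
    finally have "(pi * \<i>) * (cnj d * \<psi> d) = (pi * \<i>) * (- \<i> * cnj (d - \<beta>0) * cnj (\<phi> (\<beta>0 - d)))"
      by (simp add: algebra_simps)
    then show "cnj d * \<psi> d = - \<i> * cnj (d - \<beta>0) * cnj (\<phi> (\<beta>0 - d))"
      unfolding mult_left_cancel[OF pin] .
  qed
  have \<phi>0: "\<phi> d = 0" if d: "d \<in> dual_lattice \<Gamma>" "d \<noteq> 0" "d - \<beta>0 / 2 \<notin> F" for d
  proof (rule ccontr)
    assume nz: "\<phi> d \<noteq> 0"
    have d': "\<beta>0 - d \<in> dual_lattice \<Gamma>" using d \<beta>0_dual dual_lattice_diff by blast
    note r = rel[OF d', simplified]
    \<comment> \<open>At d = \<beta>0 the first relation has left side 0, so the mode vanishes: this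
      is the excluded frequency \<beta>0/2. The other one, -\<beta>0/2, is the constant mode d = 0,
      fixed later by f(0) = 0.\<close>
    have "d \<noteq> \<beta>0" using r(1) nz d(2) by auto
    \<comment> \<open>Eliminating the coefficient of Q from the two relations leaves Re (\<beta>0
      cnj d) = |d|^2, the circle of radius |\<beta>0|/2 about \<beta>0/2.\<close>
    have "cnj (\<beta>0 - d) * ((\<beta>0 - d) * \<psi> (\<beta>0 - d)) = (\<beta>0 - d) * (cnj (\<beta>0 - d) * \<psi> (\<beta>0 - d))" by simp
    then have "cnj (\<beta>0 - d) * (\<i> * (- d) * cnj (\<phi> d)) = (\<beta>0 - d) * (- \<i> * cnj (- d) * cnj (\<phi> d))"
      using r by (simp only: ) (simp add: algebra_simps)
    then have "(\<i> * cnj (\<phi> d)) * (cnj (\<beta>0 - d) * d + (\<beta>0 - d) * cnj d) = 0"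
      by (simp add: algebra_simps)
    then have "cnj (\<beta>0 - d) * d + (\<beta>0 - d) * cnj d = 0" using nz by simp
    then have e: "Re \<beta>0 * Re d + Im \<beta>0 * Im d = (Re d)\<^sup>2 + (Im d)\<^sup>2"
      by (simp add: complex_eq_iff power2_eq_square algebra_simps)
    have "(cmod (d - \<beta>0 / 2))\<^sup>2 = (cmod \<beta>0 / 2)\<^sup>2"
      using e unfolding power_divide cmod_power2 by (simp add: power2_eq_square field_simps)
    then have "cmod (d - \<beta>0 / 2) = cmod \<beta>0 / 2" by (simp add: power2_eq_iff_nonneg)
    then show False using freqs_sh d \<open>d \<noteq> \<beta>0\<close> by blast
  qed
  have \<psi>0: "\<psi> d = 0" if d: "d \<in> dual_lattice \<Gamma>" "d \<noteq> 0" "d - \<beta>0 / 2 \<notin> F" for d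
  proof (cases "d = \<beta>0")
    case True
    then show ?thesis using rel(1)[OF d(1)] d(2) by simp
  next
    case False
    have "\<beta>0 - d - \<beta>0 / 2 = - (d - \<beta>0 / 2)" by (simp add: field_simps)
    then have "\<beta>0 - d - \<beta>0 / 2 \<notin> F" using d(3) freqs_minus by (metis minus_minus)
    then have "\<phi> (\<beta>0 - d) = 0" using False d(1) \<beta>0_dual dual_lattice_diff by (intro \<phi>0) auto
    then show ?thesis using rel(1)[OF d(1)] d(2) by simp
  qed
  \<comment> \<open>Subtracting the surviving modes and the mean leaves a function without Fourier
    coefficients, hence 0; the condition \<open>p 0 = 0\<close> then replaces the mean by the terms
    -1.\<close>
  have expand: "p z = (\<Sum>g\<in>F. fc w1 w2 p (sh g) * (echar (sh g) z - 1))"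
    if cp: "continuous_on UNIV p" and perp: "\<And>z w. w \<in> \<Gamma> \<Longrightarrow> p (z + w) = p z" and p0: "p 0 = 0"
      and van: "\<And>d. d \<in> dual_lattice \<Gamma> \<Longrightarrow> d \<noteq> 0 \<Longrightarrow> d - \<beta>0 / 2 \<notin> F \<Longrightarrow> fc w1 w2 p d = 0" for p z
  proof -
    define S where "S z = (\<Sum>g\<in>F. fc w1 w2 p (sh g) * echar (sh g) z)" for z
    define R where "R z = p z - (S z + fc w1 w2 p 0 * echar 0 z)" for z
    have cS: "continuous_on UNIV S" unfolding S_def[abs_def]
      by (intro continuous_on_sum continuous_on_mult_left continuous_echar)
    have zd: "0 \<in> dual_lattice \<Gamma>" by (simp add: dual_lattice_def)
    have "R z = 0" for z
    proof (rule fc_complete[OF b, of R])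
      show "continuous_on UNIV R" unfolding R_def[abs_def]
        by (intro continuous_on_diff continuous_on_add continuous_on_mult_left continuous_echar cS cp)
      show "R (z + w) = R z" if "w \<in> \<Gamma>" for z w
        using perp[OF that] echar_dual[OF b sh_dual that] by (simp add: R_def S_def)
      fix d assume d: "d \<in> dual_lattice \<Gamma>"
      have "fc w1 w2 S d = (\<Sum>g\<in>F. fc w1 w2 p (sh g) * fc w1 w2 (echar (sh g)) d)"
        unfolding S_def[abs_def] by (simp add: fc_sum fc_cmult continuous_on_mult_left continuous_echar)
      also have "\<dots> = (\<Sum>g\<in>F. if g = d - \<beta>0 / 2 then fc w1 w2 p d else 0)"
        by (intro sum.cong refl) (auto simp: fc_echar[OF b d sh_dual])
      also have "\<dots> = (if d - \<beta>0 / 2 \<in> F then fc w1 w2 p d else 0)" using fin_freqs by simp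
      finally have 1: "fc w1 w2 S d = (if d - \<beta>0 / 2 \<in> F then fc w1 w2 p d else 0)" .
      have "fc w1 w2 R d = fc w1 w2 p d - (fc w1 w2 S d + fc w1 w2 p 0 * fc w1 w2 (echar 0) d)"
        unfolding R_def[abs_def]
        by (simp only: fc_diff fc_add fc_cmult cp cS continuous_on_add
          continuous_on_mult_left continuous_echar)
      also have "\<dots> = 0"
      proof (cases "d = 0")
        case True
        have "- (\<beta>0 / 2) \<notin> F" using freqs_nz(1) by fastforce
        then show ?thesis unfolding 1 fc_echar[OF b d zd] using True by simp
      next
        case False
        then show ?thesis unfolding 1 fc_echar[OF b d zd] using van[OF d False] by simp
      qed
      finally show "fc w1 w2 R d = 0" .
    qed
    then have "p z = S z + fc w1 w2 p 0" for z by (metis R_def echar_0(2) eq_iff_diff_eq_0 mult.right_neutral)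
    from this[of z] this[of 0] p0 have "p z = S z - S 0" by (simp add: add_eq_0_iff)
    then show ?thesis by (simp add: S_def sum_subtractf[symmetric] right_diff_distrib)
  qed
  \<comment> \<open>Differentiating P multiplies its mode at \<open>sh g\<close> by \<pi> i
    \<open>cnj (sh g)\<close>; up to \<pi> i this is the coefficient in P_z.\<close>
  define a where "a g = cnj (sh g) * \<phi> (sh g)" for g
  have "P z = famP a z" for z
  proof -
    have "P z = (\<Sum>g\<in>F. \<phi> (sh g) * (echar (sh g) z - 1))"
      unfolding \<phi>_def by (rule expand[OF cP perP P0(1)]) (use \<phi>0 in \<open>auto simp: \<phi>_def\<close>)
    also have "\<dots> = famP a z" unfolding famP_def
      by (intro sum.cong refl) (use freqs_nz(1) in \<open>simp add: a_def del: complex_cnj_add\<close>)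
    finally show ?thesis .
  qed
  moreover have "Q z = famQ a z" for z
  proof -
    have "Q z = (\<Sum>g\<in>F. \<psi> (sh g) * (echar (sh g) z - 1))"
      unfolding \<psi>_def by (rule expand[OF cQ perQ P0(2)]) (use \<psi>0 in \<open>auto simp: \<psi>_def\<close>)
    also have "\<dots> = famQ a z" unfolding famQ_def
    proof (intro sum.cong refl)
      fix g assume g: "g \<in> F"
      have e: "\<beta>0 - sh g = sh (- g)" "sh g - \<beta>0 = - sh (- g)" by (simp_all add: field_simps)
      have "sh g * \<psi> (sh g) = - \<i> * (sh (- g) * cnj (\<phi> (sh (- g))))"
        using rel(1)[OF sh_dual[OF g]] unfolding e
        by (simp only: mult_minus_left mult_minus_right mult.assoc)
      moreover have "cnj (a (- g)) = sh (- g) * cnj (\<phi> (sh (- g)))" by (simp add: a_def)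
      ultimately have "sh g * \<psi> (sh g) = - \<i> * cnj (a (- g))" by (simp only:)
      then have "\<psi> (sh g) = - \<i> * cnj (a (- g)) / sh g" using freqs_nz(1)[OF g] by (simp add: field_simps)
      then show "\<psi> (sh g) * (echar (sh g) z - 1) = - \<i> * cnj (a (- g)) / sh g * (echar (sh g) z - 1)" by simp
    qed
    finally show ?thesis .
  qed
  ultimately have "f = fam a" by (simp add: fun_eq_iff fPQ fam_def)
  then show ?thesis by blast
qed

end

section \<open>The action of the torus and the change of base point\<close>

definition cvec :: "real ^ 4 \<Rightarrow> complex ^ 4"
  where "cvec w = (\<chi> i. complex_of_real (w$i))"

lemma cvec_Rvec: "cvec (Rvec P Q) = Wvec P Q (cnj P) (cnj Q)"
  by (auto simp: cvec_def vec_eq_iff forall_4 Wvec_nth Rvec_nth complex_eq_iff)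

lemma complexify_matrix_cvec: "complexify_matrix T *v cvec w = cvec (T *v w)"
  by (simp add: complexify_matrix_def cvec_def matrix_vector_mult_def vec_eq_iff)

lemma Wvec_first: "Wvec c 0 0 0 = (c / 2) *s (cvec (Rvec 1 0) - \<i> *s cvec (Rvec \<i> 0))"
  unfolding cvec_Rvec by (simp add: vec_eq_iff forall_4 Wvec_nth)

lemma complexify_matrix_first:
  "complexify_matrix T *v Wvec c 0 0 0 = (c / 2) *s (cvec (T *v Rvec 1 0) - \<i> *s cvec (T *v Rvec \<i> 0))"
  unfolding Wvec_first complexify_matrix_cvec[symmetric]
  by (simp only: vector_scalar_commute matrix_vector_mult_diff_distrib)

text \<open>Commuting with J, the matrix is determined on the first factor by the image of (1, 0);
  preserving the line of v_1 removes the second component of this image; commuting with L transports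
  the action to the second factor with the conjugate scalar.\<close>

lemma T0_action:
  assumes "T \<in> T0"
  obtains k where "k \<noteq> 0" "\<And>P Q. T *v Rvec P Q = Rvec (k * P) (cnj k * Q)"
proof -
  have G: "rotation_matrix T" "\<And>w. T *v Jop w = Jop (T *v w)" "\<And>w. T *v Lop w = Lop (T *v w)"
    and im: "(\<lambda>w. complexify_matrix T *v w) ` line (*s) v1 = line (*s) v1"
    using assms by (auto simp: T0_def G0_def)
  obtain x y where xy: "T *v Rvec 1 0 = Rvec x y" by (metis Rvec_fstc_sndc)
  have T\<i>: "T *v Rvec \<i> 0 = Rvec (\<i> * x) (\<i> * y)"
    using G(2)[of "Rvec 1 0"] unfolding Jop_Rvec xy by simp
  have "complexify_matrix T *v v1 \<in> line (*s) v1" using im self_in_line(1)[of v1] by blast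
  then obtain k where "complexify_matrix T *v v1 = k *s v1" by (auto simp: line_def)
  then have k: "complexify_matrix T *v Wvec (of_real (sqrt 2)) 0 0 0 = Wvec (k * of_real (sqrt 2)) 0 0 0"
    unfolding v_Wvec Wvec_smult by simp
  have "complexify_matrix T *v Wvec (of_real (sqrt 2)) 0 0 0 =
    Wvec (of_real (sqrt 2) * x) (of_real (sqrt 2) * y) 0 0"
    unfolding complexify_matrix_first xy T\<i> cvec_Rvec by (simp add: vec_eq_iff forall_4 Wvec_nth field_simps)
  then have y: "y = 0" unfolding k Wvec_eq_iff by simp
  have T1: "T *v Rvec P 0 = Rvec (x * P) 0" for P
  proof -
    have "Rvec P 0 = Re P *\<^sub>R Rvec 1 0 + Im P *\<^sub>R Rvec \<i> 0"
      unfolding Rvec_ops Rvec_eq_iff by (simp add: complex_eq_iff)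
    then have "T *v Rvec P 0 = Re P *\<^sub>R Rvec x 0 + Im P *\<^sub>R Rvec (\<i> * x) 0"
      using xy T\<i> y by (simp add: matrix_vector_right_distrib matrix_vector_mult_scaleR)
    then show ?thesis unfolding Rvec_ops Rvec_eq_iff by (simp add: complex_eq_iff algebra_simps Rvec_eq_iff)
  qed
  have T2: "T *v Rvec 0 Q = Rvec 0 (cnj x * Q)" for Q
    using G(3)[of "Rvec (cnj Q) 0"] unfolding Lop_Rvec T1 by simp
  have "T *v Rvec P Q = Rvec (x * P) (cnj x * Q)" for P Q
  proof -
    have "T *v Rvec P Q = T *v (Rvec P 0 + Rvec 0 Q)" by (simp add: Rvec_ops)
    also have "\<dots> = Rvec (x * P) 0 + Rvec 0 (cnj x * Q)" unfolding matrix_vector_right_distrib T1 T2 ..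
    finally show ?thesis by (simp add: Rvec_ops)
  qed
  moreover have "x \<noteq> 0"
  proof
    assume "x = 0"
    then have "T *v Rvec 1 0 = 0" using T1[of 1] by (simp add: Rvec_ops)
    then have "transpose T *v (T *v Rvec 1 0) = 0" by simp
    then have "Rvec 1 0 = 0"
      using G(1) by (simp add: rotation_matrix_def orthogonal_matrix_def matrix_vector_mul_assoc)
    then show False unfolding Rvec_ops(4)[symmetric] Rvec_eq_iff by simp
  qed
  ultimately show ?thesis using that by blast
qed

definition torus_rot :: "complex \<Rightarrow> real ^ 4 \<Rightarrow> real ^ 4"
  where "torus_rot e w = Rvec (e * fstc w) (cnj e * sndc w)"

lemma linear_torus_rot: "linear (torus_rot e)"
  unfolding torus_rot_def[abs_def]
  by (intro bounded_linear.linear bounded_linear_Rvec bounded_linear_mult_const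
      bounded_linear_compose[OF bounded_linear_mult_right bounded_linear_fstc]
      bounded_linear_compose[OF bounded_linear_mult_right bounded_linear_sndc])

lemma orthogonal_torus_rot:
  assumes "cmod e = 1"
  shows "orthogonal_transformation (torus_rot e)"
proof -
  have nR: "(norm (Rvec P Q))\<^sup>2 = (cmod P)\<^sup>2 + (cmod Q)\<^sup>2" for P Q
    by (simp add: power2_norm_eq_inner inner_vec_def sum_4 Rvec_nth inner_complex_def)
  have "norm (torus_rot e w) = norm w" for w
  proof -
    have "(norm (torus_rot e w))\<^sup>2 = (norm (Rvec (fstc w) (sndc w)))\<^sup>2"
      unfolding torus_rot_def nR using assms by (simp add: norm_mult)
    then show ?thesis by (simp add: power2_eq_iff_nonneg)
  qed
  then show ?thesis by (simp add: orthogonal_transformation linear_torus_rot)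
qed

lemma matrix_torus_rot: "matrix (torus_rot e) *v w = torus_rot e w"
  using matrix_works[of "torus_rot e" w] linear_torus_rot
  by (simp add: linear_matrix_vector_mul_eq scalar_mult_eq_scaleR linear_def)

lemma torus_rot_T0:
  assumes e: "cmod e = 1"
  shows "matrix (torus_rot e) \<in> T0"
proof -
  \<comment> \<open>The square root shows that the determinant is 1: the rotation is the square of
    an orthogonal map, whose determinant is 1 or -1.\<close>
  define d where "d = csqrt e"
  have d: "cmod d = 1" "d * d = e"
    using e power2_csqrt[of e] by (auto simp: d_def norm_csqrt power2_eq_square)
  have "torus_rot e = torus_rot d \<circ> torus_rot d"
    unfolding d(2)[symmetric] by (auto simp: torus_rot_def fun_eq_iff mult.assoc)
  then have "matrix (torus_rot e) = matrix (torus_rot d) ** matrix (torus_rot d)"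
    by (simp add: matrix_compose linear_torus_rot)
  then have "det (matrix (torus_rot e)) = det (matrix (torus_rot d)) * det (matrix (torus_rot d))"
    by (simp add: det_mul)
  moreover have "orthogonal_matrix (matrix (torus_rot d))" "orthogonal_matrix (matrix (torus_rot e))"
    using orthogonal_torus_rot d(1) e by (auto simp: orthogonal_transformation_matrix)
  ultimately have rot: "rotation_matrix (matrix (torus_rot e))"
    using det_orthogonal_matrix[of "matrix (torus_rot d)"] by (auto simp: rotation_matrix_def)
  have JL: "torus_rot e (Jop w) = Jop (torus_rot e w)" "torus_rot e (Lop w) = Lop (torus_rot e w)" for w
  proof -
    obtain P Q where w: "w = Rvec P Q" by (metis Rvec_fstc_sndc)
    show "torus_rot e (Jop w) = Jop (torus_rot e w)" "torus_rot e (Lop w) = Lop (torus_rot e w)"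
      unfolding w torus_rot_def by (simp_all add: Jop_Rvec Lop_Rvec Rvec_eq_iff)
  qed
  have G: "matrix (torus_rot e) \<in> G0" using rot JL by (simp add: G0_def matrix_torus_rot)
  have act: "complexify_matrix (matrix (torus_rot e)) *v v1 = e *s v1"
    unfolding v_Wvec complexify_matrix_first matrix_torus_rot Wvec_smult
    by (simp add: torus_rot_def cvec_Rvec vec_eq_iff forall_4 Wvec_nth field_simps)
  have "(\<lambda>w. complexify_matrix (matrix (torus_rot e)) *v w) ` line (*s) v1 = line (*s) (e *s v1)"
    unfolding line_def image_image by (simp only: vector_scalar_commute act)
  also have "\<dots> = line (*s) v1" using e by (intro line_scale) auto
  finally show ?thesis using G by (simp add: T0_def)
qed

context hsl_setting
begin

lemma fam_cong:
  assumes "\<And>g. g \<in> F \<Longrightarrow> a g = b g"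
  shows "fam a = fam b"
proof
  fix z
  have "famP a z = famP b z" unfolding famP_def by (rule sum.cong) (simp_all add: assms)
  moreover have "famQ a z = famQ b z" unfolding famQ_def by (rule sum.cong) (simp_all add: assms freqs_minus)
  ultimately show "fam a z = fam b z" by (simp add: fam_def)
qed

lemma fam_scale: "fam (\<lambda>g. k * a g) z = Rvec (k * famP a z) (cnj k * famQ a z)"
proof -
  have "famP (\<lambda>g. k * a g) z = k * famP a z"
    unfolding famP_def sum_distrib_left by (rule sum.cong) simp_all
  moreover have "famQ (\<lambda>g. k * a g) z = cnj k * famQ a z"
    unfolding famQ_def sum_distrib_left by (rule sum.cong) (simp_all add: mult_ac)
  ultimately show ?thesis by (simp add: fam_def)
qed

lemma fam_inj:
  assumes "fam a = fam b" "g \<in> F"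
  shows "a g = b g"
proof -
  have "modeA a z = modeA b z" for z
  proof -
    have "d_z (fam a) z = d_z (fam b) z" using assms by simp
    then show ?thesis unfolding fam_d_z Wvec_eq_iff by simp
  qed
  then have "modeA (\<lambda>g. a g - b g) z = 0" for z by (simp add: modeA_def algebra_simps sum_subtractf)
  from modeA_inj[OF this assms(2)] show ?thesis by simp
qed

lemma fam_HSL_iff: "fam a \<in> HSL \<Gamma> \<beta>0 \<longleftrightarrow> (\<exists>g\<in>F. a g \<noteq> 0)"
proof
  assume h: "fam a \<in> HSL \<Gamma> \<beta>0"
  show "\<exists>g\<in>F. a g \<noteq> 0"
  proof (rule ccontr)
    assume "\<not> (\<exists>g\<in>F. a g \<noteq> 0)"
    then have "fam a = fam (\<lambda>_. 0)" by (intro fam_cong) auto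
    then have "\<forall>z. fam a z = Rvec 0 0" by (simp add: fam_def famP_def famQ_def)
    then show False using h unfolding HSL_def by blast
  qed
qed (rule fam_in_HSL)

lemma HSL_equiv_iff:
  assumes "fam a \<in> HSL \<Gamma> \<beta>0" "fam b \<in> HSL \<Gamma> \<beta>0"
  shows "(fam a, fam b) \<in> HSL_equiv \<Gamma> \<beta>0 \<longleftrightarrow> (\<exists>k. k \<noteq> 0 \<and> (\<forall>g\<in>F. b g = k * a g))"
proof
  assume "(fam a, fam b) \<in> HSL_equiv \<Gamma> \<beta>0"
  then obtain c T where c: "c > 0" "T \<in> T0" "\<And>z. fam b z = c *\<^sub>R (T *v fam a z)"
    by (auto simp: HSL_equiv_def)
  obtain k where k: "k \<noteq> 0" "\<And>P Q. T *v Rvec P Q = Rvec (k * P) (cnj k * Q)" using T0_action[OF c(2)] by metis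
  have "fam b z = fam (\<lambda>g. (of_real c * k) * a g) z" for z
    unfolding c(3) fam_scale unfolding fam_def k(2) Rvec_ops by (simp add: scaleR_conv_of_real mult.assoc)
  then have "fam b = fam (\<lambda>g. (of_real c * k) * a g)" by auto
  from fam_inj[OF this] show "\<exists>k. k \<noteq> 0 \<and> (\<forall>g\<in>F. b g = k * a g)"
    using c(1) k(1) by (intro exI[of _ "of_real c * k"]) auto
next
  assume "\<exists>k. k \<noteq> 0 \<and> (\<forall>g\<in>F. b g = k * a g)"
  then obtain k where k: "k \<noteq> 0" "\<And>g. g \<in> F \<Longrightarrow> b g = k * a g" by blast
  \<comment> \<open>Polar decomposition: the modulus of \<open>k\<close> is the dilation, and its
    phase is the element of the torus.\<close>
  define e where "e = k / of_real (cmod k)"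
  define r where "r = cmod k"
  have e: "cmod e = 1" "k = of_real r * e" and r: "r > 0" using k(1) by (auto simp: e_def r_def norm_divide)
  have "fam b z = fam (\<lambda>g. k * a g) z" for z using fam_cong[of b "\<lambda>g. k * a g"] k(2) by simp
  then have "fam b z = Rvec (of_real r * e * famP a z) (of_real r * cnj e * famQ a z)" for z
    unfolding fam_scale e(2) by simp
  then have "fam b z = r *\<^sub>R (matrix (torus_rot e) *v fam a z)" for z
    unfolding matrix_torus_rot torus_rot_def Rvec_ops(3) unfolding scaleR_conv_of_real
    by (simp add: fam_def mult.assoc)
  then show "(fam a, fam b) \<in> HSL_equiv \<Gamma> \<beta>0"
    using assms torus_rot_T0[OF e(1)] r unfolding HSL_equiv_def by blast
qed

lemma HSL_E:
  assumes "f \<in> HSL \<Gamma> \<beta>0"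
  obtains a where "f = fam a" "\<exists>g\<in>F. a g \<noteq> 0"
  using HSL_imp_fam[OF assms] assms fam_HSL_iff by auto

lemma equiv_HSL: "equiv (HSL \<Gamma> \<beta>0) (HSL_equiv \<Gamma> \<beta>0)"
proof (rule equivI)
  show sub: "HSL_equiv \<Gamma> \<beta>0 \<subseteq> HSL \<Gamma> \<beta>0 \<times> HSL \<Gamma> \<beta>0" by (auto simp: HSL_equiv_def)
  have "(f, f) \<in> HSL_equiv \<Gamma> \<beta>0" if h: "f \<in> HSL \<Gamma> \<beta>0" for f
  proof -
    obtain a where a: "f = fam a" using HSL_imp_fam[OF h] by blast
    show ?thesis unfolding a by (subst HSL_equiv_iff) (use h a in \<open>auto intro: exI[of _ 1]\<close>)
  qed
  then show "refl_on (HSL \<Gamma> \<beta>0) (HSL_equiv \<Gamma> \<beta>0)" using sub by (auto simp: refl_on_def)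
  show "sym (HSL_equiv \<Gamma> \<beta>0)"
  proof (rule symI)
    fix f h assume fh: "(f, h) \<in> HSL_equiv \<Gamma> \<beta>0"
    then have m: "f \<in> HSL \<Gamma> \<beta>0" "h \<in> HSL \<Gamma> \<beta>0" using sub by auto
    obtain a b where ab: "f = fam a" "h = fam b" using HSL_imp_fam m by metis
    note m = m[unfolded ab]
    obtain k where "k \<noteq> 0" "\<forall>g\<in>F. b g = k * a g" using fh HSL_equiv_iff[OF m] unfolding ab by blast
    then have "\<exists>k. k \<noteq> 0 \<and> (\<forall>g\<in>F. a g = k * b g)" by (intro exI[of _ "1 / k"]) auto
    then show "(h, f) \<in> HSL_equiv \<Gamma> \<beta>0" unfolding ab HSL_equiv_iff[OF m(2,1)] .
  qed
  show "trans (HSL_equiv \<Gamma> \<beta>0)"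
  proof (rule transI)
    fix f h j assume fh: "(f, h) \<in> HSL_equiv \<Gamma> \<beta>0" and hj: "(h, j) \<in> HSL_equiv \<Gamma> \<beta>0"
    then have m: "f \<in> HSL \<Gamma> \<beta>0" "h \<in> HSL \<Gamma> \<beta>0" "j \<in> HSL \<Gamma> \<beta>0" using sub by auto
    obtain a b c where ab: "f = fam a" "h = fam b" "j = fam c" using HSL_imp_fam m by metis
    note m = m[unfolded ab]
    obtain k where k: "k \<noteq> 0" "\<forall>g\<in>F. b g = k * a g" using fh HSL_equiv_iff[OF m(1,2)] unfolding ab by blast
    obtain l where l: "l \<noteq> 0" "\<forall>g\<in>F. c g = l * b g" using hj HSL_equiv_iff[OF m(2,3)] unfolding ab by blast
    have "\<exists>k. k \<noteq> 0 \<and> (\<forall>g\<in>F. c g = k * a g)" using k l by (intro exI[of _ "l * k"]) auto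
    then show "(f, j) \<in> HSL_equiv \<Gamma> \<beta>0" unfolding ab HSL_equiv_iff[OF m(1,3)] .
  qed
qed

text \<open>A translation multiplies the mode at \<open>sh g\<close> by
  \<open>echar (sh g) p\<close>, and the rotation by -\<beta>(p)/2 removes the half shift, leaving
  \<open>echar g p\<close>. Subtracting f(p) preserves the normalisation at 0.\<close>

lemma rebase_fam: "rebase \<beta>0 p (fam a) = fam (\<lambda>g. a g * echar g p)"
proof
  fix z
  have e: "echar (- (\<beta>0 / 2)) p * echar (sh g) p = echar g p" for g
    by (simp add: echar_add[symmetric])
  have d: "echar (- (\<beta>0 / 2)) p * (echar (sh g) (z + p) - 1 - (echar (sh g) p - 1)) =
    echar g p * (echar (sh g) z - 1)" for g
    unfolding e[of g, symmetric] by (simp add: echar_add_right algebra_simps)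
  have "echar (- (\<beta>0 / 2)) p * (famP a (z + p) - famP a p) = famP (\<lambda>g. a g * echar g p) z"
    unfolding famP_def sum_subtractf[symmetric] sum_distrib_left
  proof (rule sum.cong[OF refl])
    fix g
    have "echar (- (\<beta>0 / 2)) p * (a g / cnj (sh g) *
      (echar (sh g) (z + p) - 1) - a g / cnj (sh g) * (echar (sh g) p - 1)) =
      a g / cnj (sh g) * (echar (- (\<beta>0 / 2)) p * (echar (sh g) (z + p) - 1 - (echar (sh g) p - 1)))"
      by (simp only: right_diff_distrib mult.left_commute)
    then show "echar (- (\<beta>0 / 2)) p * (a g / cnj (sh g) *
      (echar (sh g) (z + p) - 1) - a g / cnj (sh g) * (echar (sh g) p - 1)) =
      a g * echar g p / cnj (sh g) * (echar (sh g) z - 1)" unfolding d by simp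
  qed
  moreover have "echar (- (\<beta>0 / 2)) p * (famQ a (z + p) - famQ a p) = famQ (\<lambda>g. a g * echar g p) z"
    unfolding famQ_def sum_subtractf[symmetric] sum_distrib_left
  proof (rule sum.cong[OF refl])
    fix g
    have "echar (- (\<beta>0 / 2)) p * (- \<i> * cnj (a (- g)) / sh g *
      (echar (sh g) (z + p) - 1) - - \<i> * cnj (a (- g)) / sh g * (echar (sh g) p - 1)) =
      - \<i> * cnj (a (- g)) / sh g * (echar (- (\<beta>0 / 2)) p * (echar (sh g) (z + p) - 1 - (echar (sh g) p - 1)))"
      by (simp only: right_diff_distrib mult.left_commute)
    note h1 = this
    have h2: "cnj (a (- g) * echar (- g) p) = cnj (a (- g)) * echar g p" by (simp add: echar_minus)
    show "echar (- (\<beta>0 / 2)) p * (- \<i> * cnj (a (- g)) / sh g *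
      (echar (sh g) (z + p) - 1) - - \<i> * cnj (a (- g)) / sh g * (echar (sh g) p - 1)) =
      - \<i> * cnj (a (- g) * echar (- g) p) / sh g * (echar (sh g) z - 1)"
      unfolding h1 h2 d by (simp add: mult_ac)
  qed
  ultimately show "rebase \<beta>0 p (fam a) z = fam (\<lambda>g. a g * echar g p) z"
    unfolding rebase_def fam_def Rvec_ops expJ_Rvec cis_beta by simp
qed

section \<open>Fourier coefficients of u\<close>

text \<open>Up to sign, the coefficients of the conjugate of \<mu> times \<open>modeB a\<close>.
  Conjugation exchanges g and -g, which is the source of the symmetry of \<Delta>_f.\<close>

definition coB :: "(complex \<Rightarrow> complex) \<Rightarrow> complex \<Rightarrow> complex"
  where "coB a g = cnj (a (- g)) * cnj (node \<beta>0 g) * cnj \<mu>"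

lemma modeA_coB: "modeA (coB a) z = - cnj (\<mu> * modeB a z)"
proof -
  have "cnj (modeB a z) = (\<Sum>g\<in>F. cnj (a (- g)) * cnj (node \<beta>0 (- g)) * cnj (echar (- g) z))"
    unfolding sum_freqs_minus[of "\<lambda>g. cnj (a g) * cnj (node \<beta>0 g) * cnj (echar g z)"]
    by (simp add: modeB_def cnj_sum)
  then have "- cnj (\<mu> * modeB a z) = (\<Sum>g\<in>F.
    - (cnj \<mu> * (cnj (a (- g)) * cnj (node \<beta>0 (- g)) * cnj (echar (- g) z))))"
    by (simp only: complex_cnj_mult sum_distrib_left sum_negf)
  also have "\<dots> = modeA (coB a) z" unfolding modeA_def coB_def
    by (intro sum.cong refl) (simp add: echar_minus mult_ac)
  finally show ?thesis ..
qed

lemma mu_times_cnj: "\<mu> * cnj \<mu> = 1" by simp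

lemma cnj_modeA: "cnj (modeA a z) = (\<Sum>g\<in>F. node \<beta>0 g * \<mu> * coB a g * echar g z)"
proof -
  have "cnj (modeA a z) = (\<Sum>g\<in>F. cnj (a (- g)) * cnj (echar (- g) z))"
    unfolding sum_freqs_minus[of "\<lambda>g. cnj (a g) * cnj (echar g z)"] by (simp add: modeA_def cnj_sum)
  also have "\<dots> = (\<Sum>g\<in>F. node \<beta>0 g * \<mu> * coB a g * echar g z)"
  proof (rule sum.cong[OF refl])
    fix g assume g: "g \<in> F"
    have n: "node \<beta>0 g * cnj (node \<beta>0 g) = 1"
      using norm_node[OF g] complex_norm_square[of "node \<beta>0 g"] by simp
    have "node \<beta>0 g * \<mu> * coB a g * echar g z =
      (node \<beta>0 g * cnj (node \<beta>0 g)) * (\<mu> * cnj \<mu>) * cnj (a (- g)) * echar g z"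
      unfolding coB_def by (simp only: mult_ac)
    then show "cnj (a (- g)) * cnj (echar (- g) z) = node \<beta>0 g * \<mu> * coB a g * echar g z"
      unfolding n mu_times_cnj by (simp add: echar_minus)
  qed
  finally show ?thesis .
qed

lemma echar_halves: "echar (- (\<beta>0 / 2)) z * echar (\<beta>0 / 2) z = 1"
  "echar (- (\<beta>0 / 2)) z * echar \<beta>0 z = echar (\<beta>0 / 2) z"
  "echar (\<beta>0 / 2) z * cnj (echar (\<beta>0 / 2) z) = 1"
  "echar (\<beta>0 / 2) z * cnj (echar \<beta>0 z) = cnj (echar (\<beta>0 / 2) z)"
  unfolding echar_minus[symmetric] echar_add[symmetric] by simp_all

lemma expJ_half: "expJ (- beta \<beta>0 z / 2) (Wvec c1 c2 c3 c4) =
    Wvec (echar (- (\<beta>0 / 2)) z * c1) (echar (- (\<beta>0 / 2)) z * c2)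
      (echar (\<beta>0 / 2) z * c3) (echar (\<beta>0 / 2) z * c4)"
  unfolding expJ_Wvec cis_beta ..

text \<open>The half rotation cancels the half shifts, leaving the pure modes of g. In the zbar part
  each mode gains its node and \<mu>, and the coordinates on which J is -i change sign; this is the
  sign \<epsilon> in the equation for x.\<close>

lemma expJ_d_z_fam:
  "expJ (- beta \<beta>0 z / 2) (d_z (fam a) z) =
    (pi * \<i>) *s (\<Sum>g\<in>F. echar g z *s Wvec (a g) (- \<i> * coB a g) (coB a g) (- \<i> * a g))"
  "expJ (- beta \<beta>0 z / 2) (d_zbar (fam a) z) =
    (pi * \<i>) *s (\<Sum>g\<in>F. (node \<beta>0 g * \<mu> * echar g z) *s Wvec (a g) (- \<i> * coB a g) (- coB a g) (\<i> * a g))"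
proof -
  define A where "A = modeA a z"
  define B where "B = modeA (coB a) z"
  define e where "e = echar (\<beta>0 / 2) z"
  define e' where "e' = echar (- (\<beta>0 / 2)) z"
  define E where "E = echar \<beta>0 z"
  have ee: "e' * e = 1" "e' * E = e" "e * cnj e = 1" "e * cnj E = cnj e" "e' = cnj e"
    using echar_halves[of z] by (simp_all add: e_def e'_def E_def echar_minus)
  have B: "\<mu> * modeB a z = - cnj B" using arg_cong[OF modeA_coB[of a z], of cnj] by (simp add: B_def)
  have s1: "(\<Sum>g\<in>F. echar g z *s Wvec (a g) (- \<i> * coB a g) (coB a g) (- \<i> * a g)) =
    Wvec A (- \<i> * B) B (- \<i> * A)"
    unfolding Wvec_smult Wvec_sum A_def B_def modeA_def Wvec_eq_iff
    by (auto simp: sum_distrib_left intro!: sum.cong)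
  have s2: "(\<Sum>g\<in>F. (node \<beta>0 g * \<mu> * echar g z) *s Wvec (a g) (- \<i> * coB a g) (- coB a g) (\<i> * a g)) =
     Wvec (- cnj B) (- \<i> * cnj A) (- cnj A) (- \<i> * cnj B)"
  proof -
    have cB: "- cnj B = (\<Sum>g\<in>F. node \<beta>0 g * \<mu> * echar g z * a g)"
      unfolding B[symmetric] modeB_def sum_distrib_left by (intro sum.cong) (auto simp: mult_ac)
    have cA: "cnj A = (\<Sum>g\<in>F. node \<beta>0 g * \<mu> * echar g z * coB a g)"
      unfolding A_def cnj_modeA by (intro sum.cong) (auto simp: mult_ac)
    have "- \<i> * cnj B = \<i> * (- cnj B)" by simp
    then show ?thesis unfolding Wvec_smult Wvec_sum Wvec_eq_iff
      by (auto simp only: cB cA sum_distrib_left sum_negf[symmetric]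
        mult_minus_left mult_minus_right mult.left_commute[of _ \<i>])
  qed
  have E1: "e' * (- \<i> * E * cnj x) = - \<i> * (e * cnj x)" "e * cnj (\<i> * E * cnj x) = - \<i> * (e' * x)"
    "e' * (\<i> * E * cnj x) = \<i> * (e * cnj x)" "e * cnj (- \<i> * E * cnj x) = \<i> * (e' * x)" for x
  proof -
    have "e' * (- \<i> * E * cnj x) = - \<i> * ((e' * E) * cnj x)" by (simp add: mult_ac)
    then show "e' * (- \<i> * E * cnj x) = - \<i> * (e * cnj x)" unfolding ee(2) .
    have "e * cnj (\<i> * E * cnj x) = - \<i> * ((e * cnj E) * x)" by (simp add: mult_ac)
    then show "e * cnj (\<i> * E * cnj x) = - \<i> * (e' * x)" unfolding ee(4) ee(5)[symmetric] .
    have "e' * (\<i> * E * cnj x) = \<i> * ((e' * E) * cnj x)" by (simp add: mult_ac)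
    then show "e' * (\<i> * E * cnj x) = \<i> * (e * cnj x)" unfolding ee(2) .
    have "e * cnj (- \<i> * E * cnj x) = \<i> * ((e * cnj E) * x)" by (simp add: mult_ac)
    then show "e * cnj (- \<i> * E * cnj x) = \<i> * (e' * x)" unfolding ee(4) ee(5)[symmetric] .
  qed
  define p where "p = pi * \<i> * e * A"
  define p' where "p' = pi * \<i> * e * \<mu> * modeB a z"
  have p: "e' * p = pi * \<i> * A" "e * cnj p = - (pi * \<i> * cnj A)"
  proof -
    have "e' * p = (e' * e) * (pi * \<i> * A)" "e * cnj p = (e * cnj e) * (- (pi * \<i> * cnj A))"
      by (simp_all add: p_def mult_ac)
    then show "e' * p = pi * \<i> * A" "e * cnj p = - (pi * \<i> * cnj A)" unfolding ee(1) ee(3) by simp_all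
  qed
  have p'e: "p' = pi * \<i> * e * (- cnj B)" unfolding p'_def B[symmetric] by (simp add: mult_ac)
  have p': "e' * p' = pi * \<i> * (- cnj B)" "e * cnj p' = pi * \<i> * B"
  proof -
    have "e' * p' = (e' * e) * (pi * \<i> * (- cnj B))" "e * cnj p' = (e * cnj e) * (pi * \<i> * B)"
      by (simp_all add: p'e mult_ac)
    then show "e' * p' = pi * \<i> * (- cnj B)" "e * cnj p' = pi * \<i> * B" unfolding ee(1) ee(3) by simp_all
  qed
  show "expJ (- beta \<beta>0 z / 2) (d_z (fam a) z) =
    (pi * \<i>) *s (\<Sum>g\<in>F. echar g z *s Wvec (a g) (- \<i> * coB a g) (coB a g) (- \<i> * a g))"
    unfolding s1 fam_d_z expJ_half
    unfolding e_def[symmetric] e'_def[symmetric] E_def[symmetric] A_def[symmetric]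
    unfolding p_def[symmetric] p'_def[symmetric] E1 p p' Wvec_smult Wvec_eq_iff by simp
  show "expJ (- beta \<beta>0 z / 2) (d_zbar (fam a) z) =
    (pi * \<i>) *s (\<Sum>g\<in>F. (node \<beta>0 g * \<mu> * echar g z) *s Wvec (a g) (- \<i> * coB a g) (- coB a g) (\<i> * a g))"
    unfolding s2 fam_d_z expJ_half
    unfolding e_def[symmetric] e'_def[symmetric] E_def[symmetric] A_def[symmetric]
    unfolding p_def[symmetric] p'_def[symmetric] E1 p p' Wvec_smult Wvec_eq_iff by simp
qed

lemma fourier_coeff_fam:
  assumes "d \<in> F"
  shows "fourier_coeff \<Gamma> (u_of \<beta>0 (fam a)) d = (pi * \<i>) *s Wvec (a d) (- \<i> * coB a d) (coB a d) (- \<i> * a d)"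
proof -
  define w where "w = (SOME w. lattice_basis \<Gamma> (fst w) (snd w))"
  have b: "lattice_basis \<Gamma> (fst w) (snd w)"
    unfolding w_def by (rule someI_ex) (use basis_ex in \<open>metis fst_conv snd_conv\<close>)
  define v where "v g = (pi * \<i>) *s Wvec (a g) (- \<i> * coB a g) (coB a g) (- \<i> * a g)" for g
  have int: "((\<lambda>x. (echar (- sh d) (par (fst w) (snd w) x) * echar (sh g) (par (fst w) (snd w) x)) *s v g)
     has_integral (if d = g then v g else 0)) usq" if g: "g \<in> F" for g
  proof -
    have "((\<lambda>x. echar (- sh d) (par (fst w) (snd w) x) * echar (sh g) (par (fst w) (snd w) x))
       has_integral (if d = g then 1 else 0)) usq"
      using integrable_integral[OF fc_integrable[OF continuous_echar, of "sh d" "fst w" "snd w" "sh g"]]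
        fc_echar[OF b sh_dual[OF assms] sh_dual[OF g]] by (simp add: fc_def)
    moreover have "bounded_linear (\<lambda>c. c *s v g)"
      by (intro linear_conv_bounded_linear[THEN iffD1] linearI)
        (auto simp: vec_eq_iff algebra_simps)
    ultimately have "((\<lambda>c. c *s v g) \<circ> (\<lambda>x. echar (- sh d) (par (fst w) (snd w) x) *
      echar (sh g) (par (fst w) (snd w) x))
       has_integral (if d = g then 1 else 0) *s v g) usq"
      by (rule has_integral_linear)
    then show ?thesis by (simp add: o_def if_distrib[of "\<lambda>c. c *s v g"] cong: if_cong)
  qed
  have u: "echar (- d) z *s u_of \<beta>0 (fam a) z = (\<Sum>g\<in>F. (echar (- sh d) z * echar (sh g) z) *s v g)" for z
  proof -
    \<comment> \<open>Neither d nor g need be in the dual lattice; shifting both by \<beta>0/2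
      leaves the product unchanged and makes orthogonality of lattice characters applicable.\<close>
    have "echar (- sh d) z * echar (sh g) z = echar (- d) z * echar g z" for g
      unfolding echar_add[symmetric] by simp
    then show ?thesis unfolding u_of_def expJ_d_z_fam v_def
      by (simp add: vec_eq_iff sum_distrib_left mult_ac)
  qed
  have "((\<lambda>x. echar (- d) (par (fst w) (snd w) x) *s u_of \<beta>0 (fam a) (par (fst w) (snd w) x)) has_integral
      (\<Sum>g\<in>F. if d = g then v g else 0)) usq"
    unfolding u by (intro has_integral_sum fin_freqs int)
  then have "((\<lambda>x. echar (- d) (par (fst w) (snd w) x) *s u_of \<beta>0 (fam a) (par (fst w) (snd w) x))
    has_integral v d) usq"
    using assms fin_freqs by simp
  then show ?thesis
    unfolding fourier_coeff_def w_def[symmetric] v_def[symmetric] Let_def case_prod_unfold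
    by (simp add: par_def integral_unique)
qed

lemma Delta_of_fam: "Delta_of \<Gamma> \<beta>0 (fam a) = {g \<in> F. a g \<noteq> 0 \<or> a (- g) \<noteq> 0}"
proof -
  have "fourier_coeff \<Gamma> (u_of \<beta>0 (fam a)) g \<noteq> 0 \<longleftrightarrow> a g \<noteq> 0 \<or> a (- g) \<noteq> 0" if g: "g \<in> F" for g
    unfolding fourier_coeff_fam[OF g] Wvec_smult Wvec_0[symmetric] Wvec_eq_iff
    using freqs_nz(2)[OF g] by (auto simp: coB_def node_def)
  then show ?thesis unfolding Delta_of_def by auto
qed

lemma admissible_Delta_of:
  assumes "\<exists>g\<in>F. a g \<noteq> 0"
  shows "admissible \<Gamma> \<beta>0 (Delta_of \<Gamma> \<beta>0 (fam a))"
  unfolding admissible_def Delta_of_fam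
proof (intro conjI)
  have m: "- g \<in> {g \<in> F. a g \<noteq> 0 \<or> a (- g) \<noteq> 0}" if "g \<in> {g \<in> F. a g \<noteq> 0 \<or> a (- g) \<noteq> 0}" for g
    using that freqs_minus by auto
  show "uminus ` {g \<in> F. a g \<noteq> 0 \<or> a (- g) \<noteq> 0} = {g \<in> F. a g \<noteq> 0 \<or> a (- g) \<noteq> 0}"
  proof
    show "{g \<in> F. a g \<noteq> 0 \<or> a (- g) \<noteq> 0} \<subseteq> uminus ` {g \<in> F. a g \<noteq> 0 \<or> a (- g) \<noteq> 0}"
      using m by (metis (no_types, lifting) image_eqI minus_minus subsetI)
  qed (use m in auto)
qed (use assms in auto)

text \<open>The coordinates of f_z are nonzero multiples of P_z and of cnj P_zbar, each occurring
  twice because of the HSL equation.\<close>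

lemma d_z_fam_eq_0_iff: "d_z (fam a) z = 0 \<longleftrightarrow> modeA a z = 0 \<and> modeB a z = 0"
  unfolding fam_d_z Wvec_0[symmetric] Wvec_eq_iff by auto

end

section \<open>Spectral data of an immersion\<close>

lemma poly_eq_sum_upto:
  fixes p :: "'a::comm_semiring_1 poly"
  assumes "degree p \<le> d"
  shows "poly p x = (\<Sum>k\<le>d. coeff p k * x ^ k)"
proof -
  have "(\<Sum>k\<le>degree p. coeff p k * x ^ k) = (\<Sum>k\<le>d. coeff p k * x ^ k)"
    using assms by (intro sum.mono_neutral_left) (auto simp: coeff_eq_0)
  then show ?thesis by (simp add: poly_altdef)
qed

lemma node_poly_remove:
  assumes "finite S" "s \<in> S"
  shows "poly (node_poly S) l = (l - s) * poly (node_poly (S - {s})) l"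
  using assms by (simp add: node_poly_def prod.remove[of S s] left_diff_distrib)

lemma degree_node_poly: "finite S \<Longrightarrow> degree (node_poly S) = card S"
  unfolding node_poly_def by (subst degree_prod_eq_sum_degree) auto

lemma node_poly_eq_div_poly: "finite S \<Longrightarrow> node_poly S = div_poly (mset_set (Fin ` S))"
proof (induction S rule: finite_induct)
  case empty
  then show ?case by (simp add: node_poly_def div_poly_def)
next
  case (insert s S)
  have "Fin s \<notin> Fin ` S" using insert by auto
  then show ?case using insert by (simp add: node_poly_def div_poly_def)
qed

text \<open>A polynomial in \<open>\<lambda>\<close> solving the homogeneous equation vanishes since its leading coefficient does.\<close>

lemma homogeneous_solution_eq_0:
  fixes c :: "nat \<Rightarrow> complex \<Rightarrow> complex ^ 4"
  assumes b: "b \<noteq> 0" and c: "\<And>k. k \<le> d \<Longrightarrow> smooth_on UNIV (c k)"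
    and eq: "\<And>l z. l \<noteq> 0 \<Longrightarrow> \<exists>x'. ((\<lambda>z. \<Sum>k\<le>d. l ^ k *s c k z) has_derivative x') (at z) \<and>
      (\<forall>v. x' v + (pi / 2 * (inverse l * cnj b * v + l * b * cnj v)) *s Jop (\<Sum>k\<le>d. l ^ k *s c k z) = 0)"
    and k: "k \<le> d"
  shows "c k z = 0"
proof -
  define c' where "c' k z = frechet_derivative (c k) (at z)" for k z
  have c': "(c k has_derivative c' k z) (at z)" if "k \<le> d" for k z
    unfolding c'_def by (rule smooth_onD(1)[OF c[OF that]])
  have blm: "bounded_linear ((*s) (t::complex) :: complex ^ 4 \<Rightarrow> _)" for t
    by (intro linear_conv_bounded_linear[THEN iffD1] linearI) (auto simp: vec_eq_iff algebra_simps)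
  have Jsum: "Jop (\<Sum>k\<in>A. l ^ k *s c k z) = (\<Sum>k\<in>A. l ^ k *s Jop (c k z))" for A l z
  proof -
    have Jop_lin: "Jop (x + y) = Jop x + Jop y" "Jop (t *s x) = t *s Jop x"
      "Jop 0 = 0" for x y :: "complex ^ 4" and t
      by (auto simp: Jop_def vec_eq_iff forall_4)
    show ?thesis by (induction A rule: infinite_finite_induct) (auto simp: Jop_lin)
  qed
  have main: "(\<Sum>k\<le>d. l ^ k *s (c' k z v)) +
    (pi / 2 * (inverse l * cnj b * v + l * b * cnj v)) *s (\<Sum>k\<le>d. l ^ k *s Jop (c k z)) = 0"
    if l0: "l \<noteq> 0" for l z v
  proof -
    have "((\<lambda>z. \<Sum>k\<le>d. l ^ k *s c k z) has_derivative (\<lambda>v. \<Sum>k\<le>d. l ^ k *s (c' k z v))) (at z)"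
      by (intro has_derivative_sum bounded_linear.has_derivative[OF blm] c') auto
    moreover obtain x' where x': "((\<lambda>z. \<Sum>k\<le>d. l ^ k *s c k z) has_derivative x') (at z)"
      "x' v + (pi / 2 * (inverse l * cnj b * v + l * b * cnj v)) *s Jop (\<Sum>k\<le>d. l ^ k *s c k z) = 0"
      using eq[OF l0] by blast
    ultimately have "x' = (\<lambda>v. \<Sum>k\<le>d. l ^ k *s (c' k z v))" using has_derivative_unique by blast
    with x'(2) show ?thesis unfolding Jsum by simp
  qed
  have step: "c n z = 0" if n: "n \<le> d" and above: "\<And>k z. n < k \<Longrightarrow> k \<le> d \<Longrightarrow> c k z = 0" for n z
  proof -
    have c'0: "c' k z v = 0" if "n < k" "k \<le> d" for k z v
    proof -
      have "c k = (\<lambda>_. 0)" by (intro ext above that)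
      then have "(c k has_derivative (\<lambda>_. 0)) (at z)" by simp
      then have "c' k z = (\<lambda>_. 0)" using c'[OF that(2)] has_derivative_unique by blast
      then show ?thesis by simp
    qed
    have J00: "Jop (0 :: complex ^ 4) = 0" by (simp add: Jop_def vec_eq_iff forall_4)
    have "Jop (c n z) $ i = 0" for i
    proof -
      \<comment> \<open>The i-th coordinate of \<lambda> times the equation in the direction v = 1.
        Only b \<lambda> J c_n \<lambda>^n reaches degree n + 2 after this multiplication, since the
        derivative terms stop at degree n + 1.\<close>
      define P where "P = (\<Sum>k\<le>n. monom (c' k z 1 $ i) (Suc k)) +
        smult (pi / 2) (\<Sum>k\<le>n. monom (cnj b * Jop (c k z) $ i) k + monom (b * Jop (c k z) $ i) (k + 2))"
      have "poly P l = 0" if l: "l \<noteq> 0" for l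
      proof -
        have up: "(\<Sum>k\<le>d. f k) = (\<Sum>k\<le>n. f k)" if "\<And>k. n < k \<Longrightarrow> k \<le> d \<Longrightarrow> f k = 0" for f :: "nat \<Rightarrow> complex"
          using n that by (intro sum.mono_neutral_right) auto
        have J0: "Jop (c k z) $ i = 0" if "n < k" "k \<le> d" for k
          unfolding above[OF that] J00 by simp
        have "(\<Sum>k\<le>d. l ^ k * (c' k z 1 $ i)) +
          (pi / 2 * (inverse l * cnj b + l * b)) * (\<Sum>k\<le>d. l ^ k * Jop (c k z) $ i) = 0"
          using arg_cong[OF main[OF l, of z 1], of "\<lambda>x. x $ i"] by simp
        then have "(\<Sum>k\<le>n. l ^ k * (c' k z 1 $ i)) +
          (pi / 2 * (inverse l * cnj b + l * b)) * (\<Sum>k\<le>n. l ^ k * Jop (c k z) $ i) = 0"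
          by (subst (asm) (1 2) up) (auto simp: c'0 J0)
        then have "l * ((\<Sum>k\<le>n. l ^ k * (c' k z 1 $ i)) +
          (pi / 2 * (inverse l * cnj b + l * b)) * (\<Sum>k\<le>n. l ^ k * Jop (c k z) $ i)) = 0"
          by simp
        moreover have "l * (pi / 2 * (inverse l * cnj b + l * b)) = pi / 2 * (cnj b + l * l * b)"
          using l by (simp add: field_simps)
        ultimately have "l * (\<Sum>k\<le>n. l ^ k * (c' k z 1 $ i)) +
          pi / 2 * ((cnj b + l * l * b) * (\<Sum>k\<le>n. l ^ k * Jop (c k z) $ i)) = 0"
          by (simp add: distrib_left mult.assoc[symmetric])
        then show ?thesis unfolding P_def
          by (simp add: poly_sum poly_monom sum_distrib_left sum.distrib[symmetric]
            algebra_simps power2_eq_square)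
      qed
      then have "UNIV - {0} \<subseteq> {l. poly P l = 0}" by auto
      moreover have "infinite (UNIV - {0::complex})" using infinite_UNIV_char_0 by simp
      ultimately have "P = 0" using poly_roots_finite finite_subset by blast
      then have "coeff P (n + 2) = 0" by simp
      moreover have "coeff P (n + 2) = pi / 2 * (b * Jop (c n z) $ i)"
      proof -
        have 1: "(\<Sum>k\<le>n. coeff (monom (c' k z 1 $ i) (Suc k)) (n + 2)) = 0" by (intro sum.neutral) auto
        have "(\<Sum>k\<le>n. coeff (monom (cnj b * Jop (c k z) $ i) k +
          monom (b * Jop (c k z) $ i) (k + 2)) (n + 2)) =
           (\<Sum>k\<le>n. if k = n then b * Jop (c n z) $ i else 0)"
          by (intro sum.cong) auto
        with 1 show ?thesis by (simp add: P_def coeff_sum)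
      qed
      ultimately show ?thesis using b by simp
    qed
    then have "Jop (c n z) = 0" by (simp add: vec_eq_iff)
    then have "Jop (Jop (c n z)) = 0" by (simp add: Jop_def vec_eq_iff forall_4)
    then show ?thesis by (simp add: Jop_Jop)
  qed
  \<comment> \<open>Descending induction on the degree, starting from the formal top
    coefficient.\<close>
  have "\<forall>z. c (d - j) z = 0" if "j \<le> d" for j
    using that
  proof (induction j rule: less_induct)
    case (less j)
    show ?case
    proof
      fix z
      show "c (d - j) z = 0"
      proof (rule step)
        fix k z assume "d - j < k" "k \<le> d"
        then show "c k z = 0" using less.IH[of "d - k"] less.prems by auto
      qed simp
    qed
  qed
  from this[of "d - k"] k show ?thesis by simp
qed

context hsl_setting
begin

text \<open>Two solutions have the same right side, so their difference, padded to a common degree,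
  solves the homogeneous equation. This gives the description \<open>x_of\<close> its
  meaning.\<close>

lemma is_x_unique:
  assumes "is_x \<Gamma> \<beta>0 f x" "is_x \<Gamma> \<beta>0 f y"
  shows "x = y"
proof -
  obtain d c where dc: "\<And>k. k \<le> d \<Longrightarrow> smooth_on UNIV (c k)" "\<And>l z. x l z = (\<Sum>k\<le>d. l ^ k *s c k z)"
    using assms(1) unfolding is_x_def by blast
  obtain e g where eg: "\<And>k. k \<le> e \<Longrightarrow> smooth_on UNIV (g k)" "\<And>l z. y l z = (\<Sum>k\<le>e. l ^ k *s g k z)"
    using assms(2) unfolding is_x_def by blast
  define m where "m = max d e"
  define b where "b k z = (if k \<le> d then c k z else 0) + (if k \<le> e then - g k z else 0)" for k z
  have diff: "x l z - y l z = (\<Sum>k\<le>m. l ^ k *s b k z)" for l z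
  proof -
    have "x l z = (\<Sum>k\<le>m. l ^ k *s (if k \<le> d then c k z else 0))"
      unfolding dc(2) m_def by (rule sum.mono_neutral_cong_left) auto
    moreover have "- y l z = (\<Sum>k\<le>m. l ^ k *s (if k \<le> e then - g k z else 0))"
      unfolding eg(2) m_def sum_negf[symmetric] by (rule sum.mono_neutral_cong_left) (auto simp: vec_eq_iff)
    ultimately have "x l z + - y l z = (\<Sum>k\<le>m. l ^ k *s b k z)"
      by (simp only: b_def sum.distrib[symmetric] vector_add_ldistrib)
    then show ?thesis by simp
  qed
  have "smooth_on UNIV (b k)" for k
  proof -
    have neg: "smooth_on UNIV (\<lambda>z. - h z)" if "smooth_on UNIV h" for h :: "complex \<Rightarrow> complex ^ 4"
    proof -
      have "Ck_on n UNIV h \<Longrightarrow> Ck_on n UNIV (\<lambda>z. - h z)" for n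
      proof (induction n arbitrary: h)
        case (Suc n)
        have d: "((\<lambda>z. - h z) has_derivative (\<lambda>v. - frechet_derivative h (at x) v)) (at x)" for x
          using Suc.prems by (intro has_derivative_minus) (simp add: frechet_derivative_works)
        then have "frechet_derivative (\<lambda>z. - h z) (at x) = (\<lambda>v. - frechet_derivative h (at x) v)" for x
          by (rule frechet_derivative_at[symmetric])
        with Suc d show ?case by (auto simp: differentiable_def)
      qed (simp add: continuous_on_minus)
      with that show ?thesis by (simp add: smooth_on_def)
    qed
    have "smooth_on UNIV (\<lambda>z. if k \<le> d then c k z else 0)" "smooth_on UNIV (\<lambda>z. if k \<le> e then - g k z else 0)"
      using dc(1)[of k] neg[OF eg(1)[of k]] smooth_on_const[of "0 :: complex ^ 4"]
      by (cases "k \<le> d"; cases "k \<le> e"; simp)+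
    then show ?thesis unfolding b_def[abs_def] by (rule smooth_on_add)
  qed
  moreover have "\<exists>x'. ((\<lambda>z. \<Sum>k\<le>m. l ^ k *s b k z) has_derivative x') (at z) \<and>
      (\<forall>v. x' v + (pi / 2 * (inverse l * cnj \<beta>0 * v + l * \<beta>0 * cnj v)) *s Jop (\<Sum>k\<le>m. l ^ k *s b k z) = 0)"
    if l: "l \<noteq> 0" for l z
  proof -
    obtain x' where x': "(x l has_derivative x') (at z)"
        "\<And>v. x' v + (pi / 2 * (inverse l * cnj \<beta>0 * v + l * \<beta>0 * cnj v)) *s Jop (x l z)
               = poly (node_poly (nodes \<beta>0 (Delta_of \<Gamma> \<beta>0 f))) l
                   *s expJ (- beta \<beta>0 z / 2) (v *s d_z f z + (l * cnj v) *s d_zbar f z)"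
      using assms(1) l unfolding is_x_def by blast
    obtain y' where y': "(y l has_derivative y') (at z)"
        "\<And>v. y' v + (pi / 2 * (inverse l * cnj \<beta>0 * v + l * \<beta>0 * cnj v)) *s Jop (y l z)
               = poly (node_poly (nodes \<beta>0 (Delta_of \<Gamma> \<beta>0 f))) l
                   *s expJ (- beta \<beta>0 z / 2) (v *s d_z f z + (l * cnj v) *s d_zbar f z)"
      using assms(2) l unfolding is_x_def by blast
    have "((\<lambda>z. \<Sum>k\<le>m. l ^ k *s b k z) has_derivative (\<lambda>v. x' v - y' v)) (at z)"
      unfolding diff[symmetric] by (rule has_derivative_diff[OF x'(1) y'(1)])
    moreover have lin: "(x' v - y' v) + t *s Jop (x l z - y l z) =
      (x' v + t *s Jop (x l z)) - (y' v + t *s Jop (y l z))" for v t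
      by (simp add: vec_eq_iff forall_4 Jop_def algebra_simps)
    have "(x' v - y' v) + (pi / 2 * (inverse l * cnj \<beta>0 * v + l * \<beta>0 * cnj v)) *s Jop (x l z - y l z) =
      0" for v
      by (simp only: lin x'(2) y'(2) diff_self)
    ultimately show ?thesis unfolding diff[symmetric] by blast
  qed
  ultimately have "b k z = 0" if "k \<le> m" for k z
    using homogeneous_solution_eq_0[OF \<beta>0_nz, of m b] that by blast
  then have "x l z - y l z = 0" for l z unfolding diff by simp
  then show ?thesis by (simp add: fun_eq_iff)
qed

section \<open>The solution x of a given immersion and its divisor\<close>

context
  fixes a :: "complex \<Rightarrow> complex"
  assumes a_nz: "\<exists>g\<in>F. a g \<noteq> 0"
begin

abbreviation "\<Delta> \<equiv> Delta_of \<Gamma> \<beta>0 (fam a)"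
abbreviation "S \<equiv> nodes \<beta>0 \<Delta>"

lemma adm: "admissible \<Gamma> \<beta>0 \<Delta>" by (rule admissible_Delta_of[OF a_nz])

lemma Delta_facts: "finite \<Delta>" "finite S" "card S = card \<Delta>" "card \<Delta> > 0" "\<Delta> \<subseteq> F"
  "\<And>g. g \<in> \<Delta> \<Longrightarrow> node \<beta>0 g \<in> S" "\<And>g. g \<in> \<Delta> \<Longrightarrow> - node \<beta>0 g \<in> S"
proof -
  show "finite \<Delta>" "finite S" "card S = card \<Delta>" "card \<Delta> > 0" by (fact admissible_facts[OF adm])+
  show "\<Delta> \<subseteq> F" using adm unfolding admissible_def by blast
  show 1: "node \<beta>0 g \<in> S" if "g \<in> \<Delta>" for g using that by (simp add: nodes_def)
  then show "- node \<beta>0 g \<in> S" if "g \<in> \<Delta>" for g using that nodes_minus_iff[OF adm] by simp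
qed

lemma Delta_zero: "g \<in> F - \<Delta> \<Longrightarrow> a g = 0 \<and> coB a g = 0"
  unfolding Delta_of_fam coB_def by auto

text \<open>These are \<lambda> p_\<Delta> divided by \<lambda> + s and by \<lambda> - s, the
  factors belonging to the J-eigenvalues i and -i. The factor \<lambda> makes x vanish at 0.\<close>

definition qplus :: "complex \<Rightarrow> complex poly" where "qplus g = pCons 0 (node_poly (S - {- node \<beta>0 g}))"
definition qminus :: "complex \<Rightarrow> complex poly" where "qminus g = pCons 0 (node_poly (S - {node \<beta>0 g}))"
text \<open>Found from the dz-part of the equation: for a mode with node s and sign \<epsilon> its
  coefficient is \<pi> i \<open>cnj \<beta>0\<close> (\<lambda> + \<epsilon> s) / (2 s \<lambda>),
  because the conjugate of s is 1/s.\<close>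

definition kap :: "complex \<Rightarrow> complex" where "kap g = 2 * node \<beta>0 g / cnj \<beta>0"

lemma degree_q: "g \<in> \<Delta> \<Longrightarrow> degree (qplus g) \<le> card \<Delta>" "g \<in> \<Delta> \<Longrightarrow> degree (qminus g) \<le> card \<Delta>"
  using Delta_facts by (auto simp: qplus_def qminus_def degree_node_poly
    degree_pCons_eq_if card_Diff_singleton)

text \<open>
  The coefficient of a Fourier mode in the equation for \<open>x\<close>, with \<open>s\<close> the node of the frequency;
  \<open>\<epsilon> = \<plusminus>1\<close> according to the eigenvalue \<open>\<plusminus>\<i>\<close> of \<open>J\<close>.
\<close>

lemma mode_equation:
  fixes \<epsilon> :: complex
  assumes e: "\<epsilon> * \<epsilon> = 1" and l: "l \<noteq> 0" and g: "g \<in> F"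
  defines "s \<equiv> node \<beta>0 g"
  shows "2 * pi * \<i> * of_real (g \<bullet> v) * (kap g * c * (l * q))
      + (pi / 2 * (inverse l * cnj \<beta>0 * v + l * \<beta>0 * cnj v)) * (\<epsilon> * \<i> * (kap g * c * (l * q)))
    = (pi * \<i>) * ((l + \<epsilon> * s) * q) * (v * c + l * cnj v * (s * \<mu> * (\<epsilon> * c)))"
proof -
  have n: "s * cnj s = 1" using norm_node[OF g] complex_norm_square[of s] by (simp add: s_def)
  have g2: "g = s * \<beta>0 / 2" by (simp add: s_def node_def)
  have gv: "2 * complex_of_real (g \<bullet> v) = (cnj s * cnj \<beta>0 * v + s * \<beta>0 * cnj v) / 2"
    unfolding of_real_inner_complex by (subst (1 2) g2) simp
  define B where "B = cnj \<beta>0"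
  have B: "B \<noteq> 0" by (simp add: B_def)
  have "2 * pi * \<i> * of_real (g \<bullet> v) * (kap g * c * (l * q))
      + (pi / 2 * (inverse l * B * v + l * \<beta>0 * cnj v)) * (\<epsilon> * \<i> * (kap g * c * (l * q))) =
    (pi * \<i> * c * q) * ((s * l / B) * ((cnj s * B * v + s * \<beta>0 * cnj v) +
      \<epsilon> * (inverse l * B * v + l * \<beta>0 * cnj v)))"
  proof -
    have 1: "2 * pi * \<i> * of_real (g \<bullet> v) = pi * \<i> * (2 * complex_of_real (g \<bullet> v))" by simp
    have "pi * \<i> * (G / 2) * (2 * s / B * c * (l * q)) + (pi / 2 * H) * (\<epsilon> * \<i> * (2 * s / B * c * (l * q)))
      = (pi * \<i> * c * q) * ((s * l / B) * (G + \<epsilon> * H))" for G H :: complex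
      by (simp add: field_simps add_divide_distrib)
    then show ?thesis unfolding 1 gv kap_def s_def[symmetric] B_def[symmetric] .
  qed
  also have "(s * l / B) * ((cnj s * B * v + s * \<beta>0 * cnj v) + \<epsilon> * (inverse l * B * v + l * \<beta>0 * cnj v)) =
     (l * (s * cnj s) + \<epsilon> * s) * v + (s + \<epsilon> * l) * (s * l * (\<beta>0 / B)) * cnj v"
    using B l by (simp add: field_simps)
  also have "\<dots> = (l + \<epsilon> * s) * v + (\<epsilon> * (l + \<epsilon> * s)) * (s * l * \<mu>) * cnj v"
  proof -
    \<comment> \<open>The dzbar-part contains the same linear factor as the dz-part, so one and the
      same coefficient solves both.\<close>
    have "s + \<epsilon> * l = \<epsilon> * (l + \<epsilon> * s)" using e by (simp add: algebra_simps mult.assoc[symmetric])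
    then show ?thesis unfolding n B_def by simp
  qed
  finally show ?thesis unfolding B_def by (simp add: algebra_simps)
qed

definition xvec :: "complex \<Rightarrow> complex \<Rightarrow> complex ^ 4"
  where "xvec g l = Wvec (kap g * a g * poly (qplus g) l) (- \<i> * (kap g * coB a g * poly (qplus g) l))
     (kap g * coB a g * poly (qminus g) l) (- \<i> * (kap g * a g * poly (qminus g) l))"

definition xsol :: "complex \<Rightarrow> complex \<Rightarrow> complex ^ 4"
  where "xsol l z = (\<Sum>g\<in>\<Delta>. echar g z *s xvec g l)"

lemma xvec_equation:
  assumes l: "l \<noteq> 0" and g: "g \<in> \<Delta>"
  shows "(2 * pi * \<i> * of_real (g \<bullet> v)) *s xvec g l
      + (pi / 2 * (inverse l * cnj \<beta>0 * v + l * \<beta>0 * cnj v)) *s Jop (xvec g l)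
    = (pi * \<i> * poly (node_poly S) l) *s (v *s Wvec (a g) (- \<i> * coB a g) (coB a g) (- \<i> * a g)
        + (l * cnj v * (node \<beta>0 g * \<mu>)) *s Wvec (a g) (- \<i> * coB a g) (- coB a g) (\<i> * a g))"
proof -
  have gF: "g \<in> F" using Delta_facts(5) g by blast
  define s where "s = node \<beta>0 g"
  define T where "T = complex_of_real (pi / 2) * (inverse l * cnj \<beta>0 * v + l * \<beta>0 * cnj v)"
  define G where "G = complex_of_real (2 * pi) * \<i> * of_real (g \<bullet> v)"
  define m where "m = complex_of_real pi * \<i>"
  define R where "R c e = v * c + l * cnj v * (s * \<mu> * (e * c))" for c e :: complex
  define p where "p = poly (node_poly S) l"
  define X where "X c = kap g * c * poly (qplus g) l" for c
  define Y where "Y c = kap g * c * poly (qminus g) l" for c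
  have X: "G * X c + T * (\<i> * X c) = m * p * R c 1" for c
  proof -
    have "p = (l + 1 * s) * poly (node_poly (S - {- s})) l"
      using node_poly_remove[OF Delta_facts(2) Delta_facts(7)[OF g]] by (simp add: p_def s_def)
    then show ?thesis
      using mode_equation[of 1 l g v c "poly (node_poly (S - {- s})) l", OF _ l gF]
      by (simp add: X_def G_def T_def m_def R_def s_def qplus_def)
  qed
  have Y: "G * Y c + T * (- \<i> * Y c) = m * p * R c (- 1)" for c
  proof -
    have "p = (l + - 1 * s) * poly (node_poly (S - {s})) l"
      using node_poly_remove[OF Delta_facts(2) Delta_facts(6)[OF g]] by (simp add: p_def s_def)
    then show ?thesis
      using mode_equation[of "- 1" l g v c "poly (node_poly (S - {s})) l", OF _ l gF]
      by (simp add: Y_def G_def T_def m_def R_def s_def qminus_def)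
  qed
  have xv: "xvec g l = Wvec (X (a g)) (- \<i> * X (coB a g)) (Y (coB a g)) (- \<i> * Y (a g))"
    by (simp add: xvec_def X_def Y_def)
  have X2: "G * (- \<i> * X c) + T * (\<i> * (- \<i> * X c)) = - \<i> * (m * p * R c 1)" for c
    unfolding X[symmetric] by (simp only: distrib_left mult.left_commute)
  have Y2: "G * (- \<i> * Y c) + T * (- \<i> * (- \<i> * Y c)) = - \<i> * (m * p * R c (- 1))" for c
    unfolding Y[symmetric] by (simp only: distrib_left mult.left_commute)
  show ?thesis
    unfolding G_def[symmetric] T_def[symmetric] p_def[symmetric] m_def[symmetric] s_def[symmetric] xv
      Jop_Wvec Wvec_smult Wvec_add X Y X2 Y2 Wvec_eq_iff
    by (simp add: R_def algebra_simps)
qed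

lemma xsol_is_x: "is_x \<Gamma> \<beta>0 (fam a) xsol"
  unfolding is_x_def
proof (intro conjI allI impI)
  define c where "c k z = (\<Sum>g\<in>\<Delta>. echar g z *s Wvec (kap g * a g *
    coeff (qplus g) k) (- \<i> * (kap g * coB a g * coeff (qplus g) k))
     (kap g * coB a g * coeff (qminus g) k) (- \<i> * (kap g * a g * coeff (qminus g) k)))" for k z
  have blm: "bounded_linear (\<lambda>t::complex. t *s (w :: complex ^ 4))" for w
    by (intro linear_conv_bounded_linear[THEN iffD1] linearI) (auto simp: vec_eq_iff algebra_simps)
  have "smooth_on UNIV (c k)" for k
    unfolding c_def[abs_def] by (intro smooth_on_sum smooth_on_echar[OF blm])
  moreover have "xsol l z = (\<Sum>k\<le>card \<Delta>. l ^ k *s c k z)" for l z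
  proof -
    have "xvec g l = (\<Sum>k\<le>card \<Delta>. l ^ k *s Wvec (kap g * a g * coeff (qplus g) k) (- \<i> *
      (kap g * coB a g * coeff (qplus g) k))
     (kap g * coB a g * coeff (qminus g) k) (- \<i> * (kap g * a g * coeff (qminus g) k)))" if "g \<in> \<Delta>" for g
      unfolding xvec_def poly_eq_sum_upto[OF degree_q(1)[OF that]] poly_eq_sum_upto[OF degree_q(2)[OF that]]
        Wvec_smult Wvec_sum Wvec_eq_iff sum_distrib_left
      by (intro conjI sum.cong) (simp_all add: mult_ac)
    then have "xsol l z = (\<Sum>g\<in>\<Delta>. \<Sum>k\<le>card \<Delta>.
      l ^ k *s (echar g z *s Wvec (kap g * a g * coeff (qplus g) k)
        (- \<i> * (kap g * coB a g * coeff (qplus g) k))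
     (kap g * coB a g * coeff (qminus g) k) (- \<i> * (kap g * a g * coeff (qminus g) k))))"
      unfolding xsol_def by (intro sum.cong refl) (simp add: vec_eq_iff sum_distrib_left mult_ac)
    also have "\<dots> = (\<Sum>k\<le>card \<Delta>. l ^ k *s c k z)"
      by (subst sum.swap) (simp add: c_def vec_eq_iff sum_distrib_left mult.assoc)
    finally show ?thesis .
  qed
  ultimately show "\<exists>d c. (\<forall>k\<le>d. smooth_on UNIV (c k)) \<and> (\<forall>l z. xsol l z = (\<Sum>k\<le>d. l ^ k *s c k z))" by blast
  fix l z :: complex assume l: "l \<noteq> 0"
  define x' where "x' v = (\<Sum>g\<in>\<Delta>. (2 * pi * \<i> * of_real (g \<bullet> v) * echar g z) *s xvec g l)" for v
  have der: "(xsol l has_derivative x') (at z)"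
    unfolding xsol_def[abs_def] x'_def[abs_def]
    by (intro has_derivative_sum bounded_linear.has_derivative[OF blm echar_has_derivative])
  have "x' v + (pi / 2 * (inverse l * cnj \<beta>0 * v + l * \<beta>0 * cnj v)) *s Jop (xsol l z)
    = poly (node_poly S) l *s expJ (- beta \<beta>0 z / 2) (v *s d_z (fam a) z +
      (l * cnj v) *s d_zbar (fam a) z)" for v
  proof -
    define T where "T = complex_of_real (pi / 2) * (inverse l * cnj \<beta>0 * v + l * \<beta>0 * cnj v)"
    define p where "p = poly (node_poly S) l"
    define U where "U g = Wvec (a g) (- \<i> * coB a g) (coB a g) (- \<i> * a g)" for g
    define V where "V g = Wvec (a g) (- \<i> * coB a g) (- coB a g) (\<i> * a g)" for g
    have Jop_lin: "Jop (x + y) = Jop x + Jop y" "Jop (t *s x) = t *s Jop x"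
      "Jop 0 = 0" for x y :: "complex ^ 4" and t
      by (auto simp: Jop_def vec_eq_iff forall_4)
    have Jsum: "Jop (\<Sum>g\<in>A. f g) = (\<Sum>g\<in>A. Jop (f g))" for A and f :: "complex \<Rightarrow> complex ^ 4"
      by (induction A rule: infinite_finite_induct) (auto simp: Jop_lin)
    have expJ_lin: "expJ t (r *s x + r' *s y) = r *s expJ t x + r' *s expJ t y"
      for t r r' and x y :: "complex ^ 4"
      unfolding expJ_eq Jop_lin by (simp add: vec_eq_iff algebra_simps)
    \<comment> \<open>The derivatives of f are sums over all frequencies, while x involves only
      \<Delta>; off \<Delta> both \<open>a\<close> and \<open>coB a\<close> vanish.\<close>
    have restrict: "(\<Sum>g\<in>F. f g *s U g) = (\<Sum>g\<in>\<Delta>. f g *s U g)" "(\<Sum>g\<in>F. f g *s V g) = (\<Sum>g\<in>\<Delta>. f g *s V g)" for f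
      using Delta_zero Delta_facts(5) fin_freqs
      by (auto intro!: sum.mono_neutral_right simp: U_def V_def Wvec_0)
    have "x' v + T *s Jop (xsol l z) = (\<Sum>g\<in>\<Delta>. echar g z *s ((2 * pi * \<i> * of_real (g \<bullet> v)) *s xvec g l +
      T *s Jop (xvec g l)))"
      unfolding x'_def xsol_def Jsum Jop_lin
      by (simp add: vec_eq_iff sum_distrib_left sum.distrib[symmetric] algebra_simps)
    also have "\<dots> = (\<Sum>g\<in>\<Delta>. echar g z *s ((pi * \<i> * p) *s (v *s U g + (l * cnj v * (node \<beta>0 g * \<mu>)) *s V g)))"
      unfolding T_def p_def U_def V_def by (intro sum.cong refl arg_cong[of _ _ "(*s) _"] xvec_equation l)
    also have "\<dots> = p *s (v *s ((pi * \<i>) *s (\<Sum>g\<in>\<Delta>. echar g z *s U g))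
       + (l * cnj v) *s ((pi * \<i>) *s (\<Sum>g\<in>\<Delta>. (node \<beta>0 g * \<mu> * echar g z) *s V g)))"
    proof -
      have e: "e *s ((m * p) *s (v *s x + (lv * n) *s y)) =
        p *s (v *s (m *s (e *s x))) + p *s (lv *s (m *s ((n * e) *s y)))"
        for e m lv n :: complex and x y :: "complex ^ 4"
        by (simp add: vec_eq_iff algebra_simps)
      have ds: "t *s (\<Sum>g\<in>A. f g) = (\<Sum>g\<in>A. t *s f g)" for t :: complex and A and f :: "complex \<Rightarrow> complex ^ 4"
        by (simp add: vec_eq_iff sum_distrib_left)
      show ?thesis unfolding e unfolding sum.distrib vector_add_ldistrib ds ..
    qed
    also have "\<dots> = p *s expJ (- beta \<beta>0 z / 2) (v *s d_z (fam a) z + (l * cnj v) *s d_zbar (fam a) z)"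
      unfolding expJ_lin expJ_d_z_fam U_def[symmetric] V_def[symmetric] restrict ..
    finally show ?thesis unfolding T_def p_def .
  qed
  with der show "\<exists>x'. (xsol l has_derivative x') (at z) \<and>
      (\<forall>v. x' v + (pi / 2 * (inverse l * cnj \<beta>0 * v + l * \<beta>0 * cnj v)) *s Jop (xsol l z)
        = poly (node_poly S) l *s expJ (- beta \<beta>0 z / 2) (v *s d_z (fam a) z +
          (l * cnj v) *s d_zbar (fam a) z))"
    by blast
qed

lemma x_of_fam: "x_of \<Gamma> \<beta>0 (fam a) = xsol"
  unfolding x_of_def using xsol_is_x is_x_unique by blast

text \<open>The division by \<open>sqrt 2\<close> turns the first coordinate of \<open>Wvec\<close>
  into the coefficient of v_1; the factor \<lambda> of \<open>qplus\<close> is gone, as in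
  \<lambda>^-1 chi_1.\<close>

definition hpoly :: "complex poly"
  where "hpoly = (\<Sum>g\<in>\<Delta>. smult (kap g * a g / of_real (sqrt 2)) (node_poly (S - {- node \<beta>0 g})))"

lemma chi1_poly_fam: "chi1_poly \<Gamma> \<beta>0 (fam a) = hpoly"
  unfolding chi1_poly_def x_of_fam
proof (rule the_equality)
  have W: "Wvec c1 c2 c3 c4 = (c1 / of_real (sqrt 2)) *s v1 + (c2 / of_real (sqrt 2)) *s v2
      + (c3 / of_real (sqrt 2)) *s v3 + (c4 / of_real (sqrt 2)) *s v4" for c1 c2 c3 c4
    unfolding v_Wvec Wvec_smult Wvec_add by simp
  have x0: "\<exists>c2 c3 c4. xsol l 0 = Wvec (of_real (sqrt 2) * (l * poly hpoly l)) c2 c3 c4" for l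
  proof -
    have "of_real (sqrt 2) * (l * poly hpoly l) = (\<Sum>g\<in>\<Delta>. kap g * a g * poly (qplus g) l)"
      unfolding hpoly_def poly_sum sum_distrib_left by (intro sum.cong) (auto simp: qplus_def)
    then show ?thesis unfolding xsol_def xvec_def Wvec_smult Wvec_sum by (auto simp: Wvec_eq_iff)
  qed
  show "\<forall>l. \<exists>c2 c3 c4. xsol l 0 = (l * poly hpoly l) *s v1 + c2 *s v2 + c3 *s v3 + c4 *s v4"
  proof
    fix l
    obtain c2 c3 c4 where "xsol l 0 = Wvec (of_real (sqrt 2) * (l * poly hpoly l)) c2 c3 c4" using x0 by blast
    then show "\<exists>c2 c3 c4. xsol l 0 = (l * poly hpoly l) *s v1 + c2 *s v2 + c3 *s v3 + c4 *s v4"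
      unfolding W[of "of_real (sqrt 2) * (l * poly hpoly l)"] by (simp, blast)
  qed
  fix h assume h: "\<forall>l. \<exists>c2 c3 c4. xsol l 0 = (l * poly h l) *s v1 + c2 *s v2 + c3 *s v3 + c4 *s v4"
  have "poly (pCons 0 h) l = poly (pCons 0 hpoly) l" for l
  proof -
    obtain c2 c3 c4 where "xsol l 0 = (l * poly h l) *s v1 + c2 *s v2 + c3 *s v3 + c4 *s v4" using h by blast
    then have "xsol l 0 = Wvec (l * poly h l * of_real (sqrt 2)) (c2 *
      of_real (sqrt 2)) (c3 * of_real (sqrt 2)) (c4 * of_real (sqrt 2))"
      unfolding v_Wvec Wvec_smult Wvec_add by simp
    moreover obtain d2 d3 d4 where "xsol l 0 = Wvec (of_real (sqrt 2) * (l * poly hpoly l)) d2 d3 d4"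
      using x0 by blast
    ultimately have "l * poly h l * of_real (sqrt 2) = of_real (sqrt 2) * (l * poly hpoly l)"
      by (simp only: Wvec_eq_iff)
    then show ?thesis by simp
  qed
  then have "poly (pCons 0 h) = poly (pCons 0 hpoly)" by (rule ext)
  then have "pCons 0 h = pCons 0 hpoly" by (simp only: poly_eq_poly_eq_iff)
  then show "h = hpoly" by simp
qed

lemma poly_node_poly: "poly (node_poly T) x = (\<Prod>s\<in>T. x - s)"
  by (simp add: node_poly_def poly_prod)

text \<open>Every summand for another frequency still contains the factor \<lambda> +
  \<open>node \<beta>0 g\<close>, so evaluating at this root isolates one Fourier
  coefficient.\<close>

lemma hpoly_at_node:
  assumes g: "g \<in> \<Delta>"
  shows "poly hpoly (- node \<beta>0 g) = kap g * a g / of_real (sqrt 2) * (\<Prod>s\<in>S - {- node \<beta>0 g}. - node \<beta>0 g - s)"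
proof -
  have "poly (node_poly (S - {- node \<beta>0 g'})) (- node \<beta>0 g) = 0" if g': "g' \<in> \<Delta>" "g' \<noteq> g" for g'
  proof -
    have "- node \<beta>0 g \<noteq> - node \<beta>0 g'" using inj_node[of UNIV] that by (auto simp: inj_on_def)
    then show ?thesis using Delta_facts(2,7) g by (subst poly_node_poly_eq_0_iff) auto
  qed
  then have "poly hpoly (- node \<beta>0 g) = (\<Sum>g'\<in>\<Delta>. if g' = g then
      kap g * a g / of_real (sqrt 2) * poly (node_poly (S - {- node \<beta>0 g})) (- node \<beta>0 g) else 0)"
    unfolding hpoly_def poly_sum by (intro sum.cong) auto
  then show ?thesis using g Delta_facts(1) by (simp add: poly_node_poly)
qed

lemma prod_nodes_nz: "finite T \<Longrightarrow> (\<Prod>s\<in>T - {x}. x - s) \<noteq> (0 :: complex)"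
  by auto

lemma hpoly_at_node_eq_0: "g \<in> \<Delta> \<Longrightarrow> poly hpoly (- node \<beta>0 g) = 0 \<longleftrightarrow> a g = 0"
  using hpoly_at_node[of g] prod_nodes_nz[OF Delta_facts(2), of "- node \<beta>0 g"]
    Delta_facts(5) freqs_nz(2)[of g]
  by (auto simp: kap_def node_def)

lemma hpoly_facts: "hpoly \<noteq> 0" "degree hpoly \<le> card \<Delta> - 1"
proof -
  obtain g where "g \<in> F" "a g \<noteq> 0" using a_nz by blast
  then have "g \<in> \<Delta>" by (simp add: Delta_of_fam)
  then show "hpoly \<noteq> 0" using hpoly_at_node_eq_0[of g] \<open>a g \<noteq> 0\<close> by auto
  show "degree hpoly \<le> card \<Delta> - 1" unfolding hpoly_def
    using Delta_facts by (intro degree_sum_le order_trans[OF degree_smult_le])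
      (auto simp: degree_node_poly card_Diff_singleton)
qed

abbreviation "Ediv \<equiv> div_of (card \<Delta> - 1) hpoly"

lemma spectral_data_fam: "spectral_data \<Gamma> \<beta>0 (fam a) = triple \<beta>0 \<Delta> Ediv"
  by (simp add: spectral_data_def Let_def chi1_poly_fam)

lemma Ediv_mem: "Fin s \<in># Ediv \<longleftrightarrow> poly hpoly s = 0"
  using hpoly_facts(1) count_div_of(1)[OF hpoly_facts(1), of "card \<Delta> - 1" s] order_root[of hpoly s]
  by (metis count_greater_zero_iff not_gr_zero)

text \<open>A node of \<Delta> is a zero exactly if the coefficient at the opposite frequency
  vanishes, and for g in \<Delta> the coefficients at g and -g are not both 0.\<close>

lemma Ediv_eff: "Ediv \<in> eff_divs \<beta>0 \<Delta>"
  unfolding eff_divs_def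
proof (intro CollectI conjI ballI impI)
  show "size Ediv = card \<Delta> - 1" by (rule size_div_of[OF hpoly_facts])
  fix s assume s: "s \<in> nodes \<beta>0 \<Delta>" "Fin s \<in># Ediv"
  then obtain g where g: "g \<in> \<Delta>" "s = - node \<beta>0 g"
  proof -
    obtain g where "g \<in> \<Delta>" "- s = node \<beta>0 g" using s(1) nodes_minus_iff[OF adm, of s]
      unfolding nodes_def by auto
    then show ?thesis using that by (metis minus_minus)
  qed
  have mg: "- g \<in> \<Delta>" using g(1) freqs_minus by (auto simp: Delta_of_fam)
  have "a g = 0" using s(2) hpoly_at_node_eq_0[OF g(1)] g(2) Ediv_mem by blast
  then have "a (- g) \<noteq> 0" using g(1) by (simp add: Delta_of_fam)
  then show "Fin (- s) \<notin># Ediv" using hpoly_at_node_eq_0[OF mg] g(2) Ediv_mem by simp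
qed

lemma spectral_data_mem: "spectral_data \<Gamma> \<beta>0 (fam a) \<in> spectral_triples \<Gamma> \<beta>0"
  using adm Ediv_eff unfolding spectral_triples_def spectral_data_fam by blast

definition hfull :: "complex poly" where "hfull = hpoly * node_poly (nodes \<beta>0 F - S)"

lemma hfull_nz: "hfull \<noteq> 0"
  by (simp add: hfull_def hpoly_facts)

lemma poly_line_spectral_data: "poly_line \<Gamma> \<beta>0 (spectral_data \<Gamma> \<beta>0 (fam a)) = line smult hfull"
proof -
  have fin: "finite (nodes \<beta>0 F - S)" using finite_all_nodes by simp
  have t: "total_div \<Gamma> \<beta>0 (spectral_data \<Gamma> \<beta>0 (fam a)) = full_div \<Delta> Ediv"
    unfolding spectral_data_fam by (rule total_div_triple[OF adm Ediv_eff])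
  have "order x (div_poly (full_div \<Delta> Ediv)) = order x hfull" for x
  proof -
    have "order x hfull = order x hpoly + order x (node_poly (nodes \<beta>0 F - S))"
      using hfull_nz unfolding hfull_def by (rule order_mult)
    also have "\<dots> = count Ediv (Fin x) + count (mset_set (Fin ` (nodes \<beta>0 F - S))) (Fin x)"
      unfolding node_poly_eq_div_poly[OF fin] order_div_poly count_div_of(1)[OF hpoly_facts(1)] ..
    finally show ?thesis unfolding order_div_poly full_div_def by simp
  qed
  then obtain c where c: "c \<noteq> 0" "div_poly (full_div \<Delta> Ediv) = smult c hfull"
    using proportional_if_same_orders[OF div_poly_nonzero hfull_nz] by metis
  have "poly_line \<Gamma> \<beta>0 (spectral_data \<Gamma> \<beta>0 (fam a)) = line smult (div_poly (full_div \<Delta> Ediv))"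
    using poly_line_eq[of "spectral_data \<Gamma> \<beta>0 (fam a)"] size_full_div[OF adm Ediv_eff] unfolding t by simp
  also have "\<dots> = line smult hfull" using line_smult_eq_iff[OF hfull_nz] c by metis
  finally show ?thesis .
qed

text \<open>Multiplying by the missing nodes gives one formula for all frequencies: inside \<Delta>
  it completes the product over nodes, outside both sides are 0.\<close>

lemma hfull_at_node:
  assumes g: "g \<in> F"
  shows "poly hfull (- node \<beta>0 g) = kap g * a g / of_real (sqrt 2) *
    (\<Prod>s\<in>nodes \<beta>0 F - {- node \<beta>0 g}. - node \<beta>0 g - s)"
proof (cases "g \<in> \<Delta>")
  case True
  have sub: "S \<subseteq> nodes \<beta>0 F" by (rule admissible_facts(7)[OF adm])
  have "nodes \<beta>0 F - {- node \<beta>0 g} = (S - {- node \<beta>0 g}) \<union> (nodes \<beta>0 F - S)"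
    using sub Delta_facts(7)[OF True] by auto
  then have "(\<Prod>s\<in>nodes \<beta>0 F - {- node \<beta>0 g}. - node \<beta>0 g - s) =
      (\<Prod>s\<in>S - {- node \<beta>0 g}. - node \<beta>0 g - s) * (\<Prod>s\<in>nodes \<beta>0 F - S. - node \<beta>0 g - s)"
    using finite_all_nodes Delta_facts(2) by (simp only:) (rule prod.union_disjoint; auto)
  then show ?thesis unfolding hfull_def poly_mult hpoly_at_node[OF True] poly_node_poly by simp
next
  case False
  have "- node \<beta>0 g \<notin> S"
    using False nodes_minus_iff[OF adm] inj_node[of UNIV] by (auto simp: nodes_def inj_on_def)
  moreover have "- node \<beta>0 g \<in> nodes \<beta>0 F"
    using g nodes_minus_iff[OF admissible_freqs] by (auto simp: nodes_def)
  ultimately have "poly (node_poly (nodes \<beta>0 F - S)) (- node \<beta>0 g) = 0"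
    using finite_all_nodes by (subst poly_node_poly_eq_0_iff) auto
  then show ?thesis using Delta_zero[of g] g False by (simp add: hfull_def)
qed

end

end

section \<open>Spectral data in projective coordinates\<close>

context hsl_frequencies
begin

definition fam_coords :: "(complex \<Rightarrow> complex) \<Rightarrow> complex ^ 'n"
  where "fam_coords a = (\<chi> j. nd j * (\<Prod>m\<in>UNIV - {j}. nd j - nd m) * a (- \<gamma> j))"

lemma nodes_eq_range: "nodes \<beta>0 F = range nd"
proof -
  have "F = range \<gamma>" using bij_\<gamma> by (simp add: bij_betw_def)
  then show ?thesis by (auto simp: nodes_def nd_def)
qed

lemma Phi_spectral_data:
  assumes a: "\<exists>g\<in>F. a g \<noteq> 0"
  shows "Phi \<Gamma> \<beta>0 \<gamma> (spectral_data \<Gamma> \<beta>0 (fam a)) = line (*s) (fam_coords a)"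
proof -
  \<comment> \<open>The factor common to all coordinates: \<open>kap (- \<gamma> j)\<close> is
    \<open>- 2 * nd j / cnj \<beta>0\<close>, and \<open>sqrt 2\<close> comes from the length of v_1
    in \<open>Wvec\<close> coordinates.\<close>
  have "eval_nodes (hfull a) = (- 2 / (cnj \<beta>0 * of_real (sqrt 2))) *s fam_coords a"
  proof (subst vec_eq_iff, rule allI)
    fix j
    have g: "- \<gamma> j \<in> F" using bij_\<gamma> freqs_minus by (auto simp: bij_betw_def)
    have n: "- node \<beta>0 (- \<gamma> j) = nd j" by (simp add: nd_def)
    have "nodes \<beta>0 F - {nd j} = nd ` (UNIV - {j})" unfolding nodes_eq_range
      using inj_nd by (auto simp: inj_on_def)
    then have "(\<Prod>s\<in>nodes \<beta>0 F - {nd j}. nd j - s) = (\<Prod>m\<in>UNIV - {j}. nd j - nd m)"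
      by (simp add: prod.reindex inj_on_subset[OF inj_nd])
    then have "poly (hfull a) (nd j) = kap (- \<gamma> j) * a (- \<gamma> j) / of_real (sqrt 2) *
      (\<Prod>m\<in>UNIV - {j}. nd j - nd m)"
      using hfull_at_node[OF a g] unfolding n by simp
    then show "eval_nodes (hfull a) $ j = ((- 2 / (cnj \<beta>0 * of_real (sqrt 2))) *s fam_coords a) $ j"
      by (simp add: eval_nodes_def fam_coords_def kap_def[OF a] nd_def)
  qed
  moreover have "- 2 / (cnj \<beta>0 * complex_of_real (sqrt 2)) \<noteq> 0" by simp
  ultimately have "line (*s) (eval_nodes (hfull a)) = line (*s) (fam_coords a)"
    by (simp only: line_scale not_False_eq_True)
  then show ?thesis using Phi_eq[OF poly_line_spectral_data[OF a] hfull_nz[OF a]] by (simp only:)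
qed

definition wt :: "'n \<Rightarrow> complex"
  where "wt j = nd j * (\<Prod>m\<in>UNIV - {j}. nd j - nd m)"

lemma gam_F: "\<gamma> j \<in> F" "- \<gamma> j \<in> F"
  using bij_\<gamma> freqs_minus by (auto simp: bij_betw_def)

lemma wt_nz: "wt j \<noteq> 0"
proof -
  have "nd j \<noteq> nd m" if "m \<noteq> j" for m using inj_nd that by (auto simp: inj_on_def)
  moreover have "nd j \<noteq> 0" using freqs_nz(2)[OF gam_F(1)] by (simp add: nd_def node_def)
  ultimately show ?thesis by (auto simp: wt_def)
qed

lemma fam_coords_nth: "fam_coords a $ j = wt j * a (- \<gamma> j)"
  by (simp add: fam_coords_def wt_def)

lemma F_E: "g \<in> F \<Longrightarrow> \<exists>j. g = - \<gamma> j"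
proof -
  assume "g \<in> F"
  then have "- g \<in> range \<gamma>" using freqs_minus bij_\<gamma> by (auto simp: bij_betw_def)
  then show ?thesis by (metis imageE minus_minus)
qed

lemma fam_coords_scale_iff: "fam_coords b = k *s fam_coords a \<longleftrightarrow> (\<forall>g\<in>F. b g = k * a g)"
proof
  assume *: "fam_coords b = k *s fam_coords a"
  show "\<forall>g\<in>F. b g = k * a g"
  proof
    fix g assume "g \<in> F"
    then obtain j where j: "g = - \<gamma> j" using F_E by blast
    have "wt j * b (- \<gamma> j) = wt j * (k * a (- \<gamma> j))"
      using arg_cong[OF *, of "\<lambda>v. v$j"] by (simp add: fam_coords_nth mult_ac)
    then show "b g = k * a g" using wt_nz[of j] j by simp
  qed
qed (simp add: vec_eq_iff fam_coords_nth gam_F)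

lemma fam_coords_nz: "(\<exists>g\<in>F. a g \<noteq> 0) \<Longrightarrow> fam_coords a \<noteq> 0"
  using fam_coords_scale_iff[of a 0 a] by auto

lemma fam_coords_surj: "\<exists>a. fam_coords a = t"
proof
  define a where "a g = (t $ inv \<gamma> (- g)) / wt (inv \<gamma> (- g))" for g
  have "inj \<gamma>" using bij_\<gamma> by (simp add: bij_betw_def)
  then show "fam_coords a = t" using wt_nz by (simp add: vec_eq_iff fam_coords_nth a_def)
qed

abbreviation "sd \<equiv> spectral_data \<Gamma> \<beta>0"
abbreviation "ST \<equiv> spectral_triples \<Gamma> \<beta>0"
abbreviation "\<Phi> \<equiv> Phi \<Gamma> \<beta>0 \<gamma>"

lemma Phi_inj: "\<sigma> \<in> ST \<Longrightarrow> \<sigma>' \<in> ST \<Longrightarrow> \<Phi> \<sigma> = \<Phi> \<sigma>' \<Longrightarrow> \<sigma> = \<sigma>'"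
  using bij_Phi unfolding bij_betw_def inj_on_def by blast

lemma Phi_line: "\<sigma> \<in> ST \<Longrightarrow> \<exists>t. t \<noteq> 0 \<and> \<Phi> \<sigma> = line (*s) t"
  using bij_Phi unfolding bij_betw_def proj_space_def by blast

lemma Phi_surj: "t \<noteq> 0 \<Longrightarrow> \<exists>\<sigma>\<in>ST. \<Phi> \<sigma> = line (*s) t"
proof -
  assume "t \<noteq> 0"
  then have "line (*s) t \<in> CP" by (simp add: proj_space_def)
  then show ?thesis using bij_Phi unfolding bij_betw_def by (metis imageE)
qed

lemma spectral_data_eq_iff:
  assumes a: "\<exists>g\<in>F. a g \<noteq> 0" and b: "\<exists>g\<in>F. b g \<noteq> 0"
  shows "sd (fam a) = sd (fam b) \<longleftrightarrow> (fam a, fam b) \<in> HSL_equiv \<Gamma> \<beta>0"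
proof -
  have "sd (fam a) = sd (fam b) \<longleftrightarrow> \<Phi> (sd (fam a)) = \<Phi> (sd (fam b))"
    using Phi_inj[OF spectral_data_mem[OF a] spectral_data_mem[OF b]] by metis
  also have "\<dots> \<longleftrightarrow> (\<exists>k. k \<noteq> 0 \<and> fam_coords b = k *s fam_coords a)"
    unfolding Phi_spectral_data[OF a] Phi_spectral_data[OF b] by (rule line_eq_iff[OF fam_coords_nz[OF a]])
  also have "\<dots> \<longleftrightarrow> (fam a, fam b) \<in> HSL_equiv \<Gamma> \<beta>0"
    using HSL_equiv_iff[OF fam_in_HSL[OF a] fam_in_HSL[OF b]] by (simp add: fam_coords_scale_iff)
  finally show ?thesis .
qed

lemma spectral_data_cong_iff:
  assumes "f \<in> HSL \<Gamma> \<beta>0" "h \<in> HSL \<Gamma> \<beta>0"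
  shows "sd f = sd h \<longleftrightarrow> (f, h) \<in> HSL_equiv \<Gamma> \<beta>0"
proof -
  obtain a where a: "f = fam a" "\<exists>g\<in>F. a g \<noteq> 0" using HSL_E[OF assms(1)] .
  obtain b where b: "h = fam b" "\<exists>g\<in>F. b g \<noteq> 0" using HSL_E[OF assms(2)] .
  show ?thesis unfolding a(1) b(1) by (rule spectral_data_eq_iff[OF a(2) b(2)])
qed

lemma spectral_data_in: "f \<in> HSL \<Gamma> \<beta>0 \<Longrightarrow> sd f \<in> ST"
  using HSL_E spectral_data_mem by metis

lemma spectral_data_surj: "\<sigma> \<in> ST \<Longrightarrow> \<exists>f\<in>HSL \<Gamma> \<beta>0. sd f = \<sigma>"
proof -
  assume \<sigma>: "\<sigma> \<in> ST"
  obtain t where t: "t \<noteq> 0" "\<Phi> \<sigma> = line (*s) t" using Phi_line[OF \<sigma>] by blast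
  obtain a where a: "fam_coords a = t" using fam_coords_surj by blast
  have nz: "\<exists>g\<in>F. a g \<noteq> 0"
  proof (rule ccontr)
    assume "\<not> (\<exists>g\<in>F. a g \<noteq> 0)"
    then have "fam_coords a = 0 *s fam_coords a" unfolding fam_coords_scale_iff by simp
    then show False using a t(1) by simp
  qed
  have "\<Phi> (sd (fam a)) = \<Phi> \<sigma>" unfolding Phi_spectral_data[OF nz] a t(2) ..
  then have "sd (fam a) = \<sigma>" by (rule Phi_inj[OF spectral_data_mem[OF nz] \<sigma>])
  then show ?thesis using fam_in_HSL[OF nz] by blast
qed

lemma spectral_data_respects: "sd respects (HSL_equiv \<Gamma> \<beta>0)"
proof (rule congruentI)
  fix f h assume fh: "(f, h) \<in> HSL_equiv \<Gamma> \<beta>0"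
  then have "f \<in> HSL \<Gamma> \<beta>0" "h \<in> HSL \<Gamma> \<beta>0" by (auto simp: HSL_equiv_def)
  with fh show "sd f = sd h" by (simp add: spectral_data_cong_iff)
qed

lemma bij_spectral_data:
  "bij_betw (\<lambda>C. the_elem (sd ` C)) (HSL \<Gamma> \<beta>0 // HSL_equiv \<Gamma> \<beta>0) ST"
proof -
  have el: "the_elem (sd ` (HSL_equiv \<Gamma> \<beta>0 `` {f})) = sd f" if f: "f \<in> HSL \<Gamma> \<beta>0" for f
  proof -
    have "(f, f) \<in> HSL_equiv \<Gamma> \<beta>0" using spectral_data_cong_iff[OF f f] by simp
    then have "sd ` (HSL_equiv \<Gamma> \<beta>0 `` {f}) = {sd f}"
      using spectral_data_respects unfolding congruent_def by fastforce
    then show ?thesis by simp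
  qed
  show ?thesis unfolding bij_betw_def
  proof
    show "inj_on (\<lambda>C. the_elem (sd ` C)) (HSL \<Gamma> \<beta>0 // HSL_equiv \<Gamma> \<beta>0)"
    proof (rule inj_onI)
      fix C D assume C: "C \<in> HSL \<Gamma> \<beta>0 // HSL_equiv \<Gamma> \<beta>0" and D: "D \<in> HSL \<Gamma> \<beta>0 // HSL_equiv \<Gamma> \<beta>0"
        and eq: "the_elem (sd ` C) = the_elem (sd ` D)"
      obtain f where f: "f \<in> HSL \<Gamma> \<beta>0" "C = HSL_equiv \<Gamma> \<beta>0 `` {f}" using C by (rule quotientE)
      obtain h where h: "h \<in> HSL \<Gamma> \<beta>0" "D = HSL_equiv \<Gamma> \<beta>0 `` {h}" using D by (rule quotientE)
      have "sd f = sd h" using eq el[OF f(1)] el[OF h(1)] f(2) h(2) by simp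
      then have "(f, h) \<in> HSL_equiv \<Gamma> \<beta>0" using spectral_data_cong_iff[OF f(1) h(1)] by simp
      then show "C = D" unfolding f(2) h(2) by (rule equiv_class_eq[OF equiv_HSL])
    qed
    show "(\<lambda>C. the_elem (sd ` C)) ` (HSL \<Gamma> \<beta>0 // HSL_equiv \<Gamma> \<beta>0) = ST"
    proof (intro set_eqI iffI)
      fix \<sigma> assume "\<sigma> \<in> (\<lambda>C. the_elem (sd ` C)) ` (HSL \<Gamma> \<beta>0 // HSL_equiv \<Gamma> \<beta>0)"
      then show "\<sigma> \<in> ST" using el spectral_data_in by (auto elim!: quotientE)
    next
      fix \<sigma> assume "\<sigma> \<in> ST"
      then obtain f where f: "f \<in> HSL \<Gamma> \<beta>0" "sd f = \<sigma>" using spectral_data_surj by blast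
      then show "\<sigma> \<in> (\<lambda>C. the_elem (sd ` C)) ` (HSL \<Gamma> \<beta>0 // HSL_equiv \<Gamma> \<beta>0)"
        using el[OF f(1)] quotientI[OF f(1), of "HSL_equiv \<Gamma> \<beta>0"] by (metis image_eqI)
    qed
  qed
qed

section \<open>The action of the base point\<close>

definition shift :: "complex \<Rightarrow> complex ^ 'n \<Rightarrow> complex ^ 'n"
  where "shift p t = (\<chi> j. echar (- \<gamma> j) p * t$j)"

text \<open>Transported through \<Phi> from a diagonal action on lines. This needs no representative
  immersion and puts smoothness in evidence; compatibility with \<open>rebase\<close> is then
  something to prove.\<close>

definition act :: "complex \<Rightarrow> spectral_triple \<Rightarrow> spectral_triple"
  where "act p \<sigma> = inv_into ST \<Phi> (shift p ` \<Phi> \<sigma>)"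

lemma shift_line: "shift p ` line (*s) t = line (*s) (shift p t)"
proof -
  have "shift p (c *s t) = c *s shift p t" for c by (simp add: shift_def vec_eq_iff)
  then show ?thesis by (auto simp: line_def image_image)
qed

lemma shift_nz: "t \<noteq> 0 \<Longrightarrow> shift p t \<noteq> 0"
  by (auto simp: shift_def vec_eq_iff)

lemma act_props:
  assumes "\<sigma> \<in> ST" "\<Phi> \<sigma> = line (*s) t" "t \<noteq> 0"
  shows "act p \<sigma> \<in> ST" "\<Phi> (act p \<sigma>) = line (*s) (shift p t)"
proof -
  have "line (*s) (shift p t) \<in> \<Phi> ` ST" using Phi_surj[OF shift_nz[OF assms(3)]] by (metis image_eqI)
  then have "inv_into ST \<Phi> (line (*s) (shift p t)) \<in> ST"
    "\<Phi> (inv_into ST \<Phi> (line (*s) (shift p t))) = line (*s) (shift p t)"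
    by (rule inv_into_into, rule f_inv_into_f)
  then show "act p \<sigma> \<in> ST" "\<Phi> (act p \<sigma>) = line (*s) (shift p t)"
    unfolding act_def assms(2) shift_line by auto
qed

lemma act_eqI:
  assumes "\<sigma> \<in> ST" "\<Phi> \<sigma> = line (*s) t" "t \<noteq> 0" "\<sigma>' \<in> ST" "\<Phi> \<sigma>' = line (*s) (shift p t)"
  shows "act p \<sigma> = \<sigma>'"
  using Phi_inj[OF act_props(1)[OF assms(1-3)] assms(4)] act_props(2)[OF assms(1-3)] assms(5) by metis

lemma act_0: "\<sigma> \<in> ST \<Longrightarrow> act 0 \<sigma> = \<sigma>"
proof -
  assume \<sigma>: "\<sigma> \<in> ST"
  then obtain t where t: "t \<noteq> 0" "\<Phi> \<sigma> = line (*s) t" using Phi_line by blast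
  have "shift 0 t = t" by (simp add: shift_def vec_eq_iff)
  then show ?thesis using act_eqI[OF \<sigma> t(2,1) \<sigma>] t(2) by simp
qed

lemma act_add: "\<sigma> \<in> ST \<Longrightarrow> act (p + p') \<sigma> = act p (act p' \<sigma>)"
proof -
  assume \<sigma>: "\<sigma> \<in> ST"
  then obtain t where t: "t \<noteq> 0" "\<Phi> \<sigma> = line (*s) t" using Phi_line by blast
  note 1 = act_props[OF \<sigma> t(2,1), of p']
  note 2 = act_props[OF 1 shift_nz[OF t(1)], of p]
  have "shift p (shift p' t) = shift (p + p') t" by (simp add: shift_def vec_eq_iff echar_add_right mult_ac)
  then show ?thesis using act_eqI[OF \<sigma> t(2,1) 2(1), of "p + p'"] 2(2) by simp
qed

text \<open>A lattice vector need not act by 1 on the coordinates, since the frequencies are half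
  shifted. But its factor is the same for every j, so the line is unchanged.\<close>

lemma act_lattice: "\<sigma> \<in> ST \<Longrightarrow> w \<in> \<Gamma> \<Longrightarrow> act (p + w) \<sigma> = act p \<sigma>"
proof -
  assume \<sigma>: "\<sigma> \<in> ST" and w: "w \<in> \<Gamma>"
  then obtain t where t: "t \<noteq> 0" "\<Phi> \<sigma> = line (*s) t" using Phi_line by blast
  note 1 = act_props[OF \<sigma> t(2,1), of p]
  obtain w1 w2 where b: "lattice_basis \<Gamma> w1 w2" using basis_ex .
  have "echar (- \<gamma> j) w = echar (- (\<beta>0 / 2)) w" for j
  proof -
    have "echar (sh (- \<gamma> j)) (0 + w) = echar (sh (- \<gamma> j)) 0" by (rule echar_dual[OF b sh_dual[OF gam_F(2)] w])
    moreover have "echar (- (\<beta>0 / 2)) w * echar (sh (- \<gamma> j)) w = echar (- \<gamma> j) w"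
      unfolding echar_add[symmetric] by simp
    ultimately show ?thesis by simp
  qed
  then have "shift (p + w) t = echar (- (\<beta>0 / 2)) w *s shift p t"
    by (simp add: shift_def vec_eq_iff echar_add_right mult_ac)
  then have "\<Phi> (act p \<sigma>) = line (*s) (shift (p + w) t)" using 1(2) by (simp add: line_scale)
  then show ?thesis by (rule act_eqI[OF \<sigma> t(2,1) 1(1)])
qed

lemma rebase_HSL:
  assumes "f \<in> HSL \<Gamma> \<beta>0"
  shows "rebase \<beta>0 p f \<in> HSL \<Gamma> \<beta>0" "act p (sd f) = sd (rebase \<beta>0 p f)"
proof -
  obtain a where a: "f = fam a" "\<exists>g\<in>F. a g \<noteq> 0" using HSL_E[OF assms] .
  have b: "\<exists>g\<in>F. a g * echar g p \<noteq> 0" using a(2) by simp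
  show "rebase \<beta>0 p f \<in> HSL \<Gamma> \<beta>0" unfolding a(1) rebase_fam by (rule fam_in_HSL[OF b])
  have "fam_coords (\<lambda>g. a g * echar g p) = shift p (fam_coords a)"
    by (simp add: vec_eq_iff shift_def fam_coords_nth mult_ac)
  then show "act p (sd f) = sd (rebase \<beta>0 p f)"
    unfolding a(1) rebase_fam using Phi_spectral_data[OF b]
    by (intro act_eqI[OF spectral_data_mem[OF a(2)] Phi_spectral_data[OF a(2)]
      fam_coords_nz[OF a(2)] spectral_data_mem[OF b]]) simp
qed

lemma has_derivative_vec_lambda:
  fixes f :: "'m::finite \<Rightarrow> 'v::real_normed_vector \<Rightarrow> complex"
  assumes "\<And>i. (f i has_derivative f' i) (at x)"
  shows "((\<lambda>x. \<chi> i. f i x) has_derivative (\<lambda>v. \<chi> i. f' i v)) (at x)"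
proof -
  have ax: "(\<chi> i. y i) = (\<Sum>i\<in>UNIV. axis i (y i))" for y :: "'m \<Rightarrow> complex"
    by (simp add: vec_eq_iff axis_def)
  have "bounded_linear (axis i :: complex \<Rightarrow> complex ^ 'm)" for i
    by (rule linear_conv_bounded_linear[THEN iffD1]) (auto intro!: linearI simp: vec_eq_iff axis_def)
  then have "((\<lambda>x. axis i (f i x)) has_derivative (\<lambda>v. axis i (f' i v))) (at x)" for i
    by (rule bounded_linear.has_derivative) (rule assms)
  then show ?thesis unfolding ax by (rule has_derivative_sum)
qed

text \<open>The family \<open>K\<close> of maps, affine in each coordinate of t and multiplied by a
  character, contains \<open>shift\<close> and all its directional derivatives; so one induction
  over the family yields every order.\<close>

lemma smooth_shift:
  assumes U: "open U"
  shows "smooth_on U (\<lambda>x::complex \<times> (complex ^ 'n). shift (fst x) (snd x))"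
proof -
  define K :: "('n \<Rightarrow> complex) \<Rightarrow> ('n \<Rightarrow> complex) \<Rightarrow> complex \<times> (complex ^ 'n) \<Rightarrow> complex ^ 'n"
    where "K \<alpha> b x = (\<chi> j. (\<alpha> j * snd x $ j + b j) * echar (- \<gamma> j) (fst x))" for \<alpha> b x
  define \<alpha>' where "\<alpha>' \<alpha> v j = \<alpha> j * (2 * pi * \<i> * of_real ((- \<gamma> j) \<bullet> fst v))"
    for \<alpha> :: "'n \<Rightarrow> complex" and v :: "complex \<times> (complex ^ 'n)" and j
  define b' where "b' \<alpha> b v j = \<alpha> j * snd v $ j + b j * (2 * pi * \<i> * of_real ((- \<gamma> j) \<bullet> fst v))"
    for \<alpha> b :: "'n \<Rightarrow> complex" and v :: "complex \<times> (complex ^ 'n)" and j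
  have der: "(K \<alpha> b has_derivative (\<lambda>v. K (\<alpha>' \<alpha> v) (b' \<alpha> b v) x)) (at x)" for \<alpha> b x
  proof -
    have "((\<lambda>x::complex \<times> (complex ^ 'n). (\<alpha> j * snd x $ j + b j) * echar (- \<gamma> j) (fst x)) has_derivative
       (\<lambda>v. (\<alpha>' \<alpha> v j * snd x $ j + b' \<alpha> b v j) * echar (- \<gamma> j) (fst x))) (at x)" for j
    proof -
      have 1: "((\<lambda>x::complex \<times> (complex ^ 'n). \<alpha> j * snd x $ j +
        b j) has_derivative (\<lambda>v. \<alpha> j * snd v $ j)) (at x)"
      proof -
        have "bounded_linear (\<lambda>v::complex \<times> (complex ^ 'n). \<alpha> j * snd v $ j)"
          by (intro bounded_linear_compose[OF bounded_linear_mult_right]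
            bounded_linear_compose[OF bounded_linear_vec_nth bounded_linear_snd])
        from has_derivative_add[OF bounded_linear_imp_has_derivative[OF this] has_derivative_const]
          show ?thesis by simp
      qed
      have 2: "((\<lambda>x::complex \<times> (complex ^ 'n). echar (- \<gamma> j) (fst x)) has_derivative
        (\<lambda>v. (2 * pi * \<i> * of_real ((- \<gamma> j) \<bullet> fst v)) * echar (- \<gamma> j) (fst x))) (at x)"
        using has_derivative_compose[OF bounded_linear_imp_has_derivative[OF bounded_linear_fst]
          echar_has_derivative] .
      show ?thesis
        by (rule has_derivative_eq_rhs[OF has_derivative_mult[OF 1 2]])
          (simp add: \<alpha>'_def b'_def algebra_simps)
    qed
    then show ?thesis unfolding K_def[abs_def] K_def by (rule has_derivative_vec_lambda)
  qed
  have "Ck_on n U (K \<alpha> b)" for n \<alpha> b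
  proof (induction n arbitrary: \<alpha> b)
    case 0
    show ?case using has_derivative_continuous[OF der] by (auto intro: continuous_at_imp_continuous_on)
  next
    case (Suc n)
    have "frechet_derivative (K \<alpha> b) (at x) = (\<lambda>v. K (\<alpha>' \<alpha> v) (b' \<alpha> b v) x)" for x
      using frechet_derivative_at[OF der] by metis
    moreover have "K \<alpha> b differentiable at x" for x
      using der unfolding differentiable_def by blast
    ultimately show ?case using Suc by simp
  qed
  moreover have "(\<lambda>x. shift (fst x) (snd x)) = K (\<lambda>_. 1) (\<lambda>_. 0)"
    by (auto simp: K_def shift_def fun_eq_iff vec_eq_iff mult.commute)
  ultimately show ?thesis using U by (simp add: smooth_on_def)
qed

lemma smooth_act: "smooth_proj_family (\<lambda>p P. \<Phi> (act p (inv_into ST \<Phi> P)))"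
  unfolding smooth_proj_family_def
proof (intro allI impI)
  fix p and t :: "complex ^ 'n" assume "t \<noteq> 0"
  define U where "U = (UNIV :: complex set) \<times> (- {0 :: complex ^ 'n})"
  have "open U" unfolding U_def by (intro open_Times) auto
  have "t' \<noteq> 0 \<and> shift p' t' \<noteq> 0 \<and> \<Phi> (act p' (inv_into ST \<Phi> (line (*s) t'))) = line (*s) (shift p' t')"
    if "(p', t') \<in> U" for p' t'
  proof -
    have t': "t' \<noteq> 0" using that by (simp add: U_def)
    then have "line (*s) t' \<in> \<Phi> ` ST" using Phi_surj by (metis image_eqI)
    then have "inv_into ST \<Phi> (line (*s) t') \<in> ST" "\<Phi> (inv_into ST \<Phi> (line (*s) t')) = line (*s) t'"
      by (rule inv_into_into, rule f_inv_into_f)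
    from act_props(2)[OF this t'] show ?thesis using t' shift_nz by blast
  qed
  moreover have "(p, t) \<in> U" using \<open>t \<noteq> 0\<close> by (simp add: U_def)
  ultimately show "\<exists>U H. (p, t) \<in> U \<and> smooth_on U H \<and>
      (\<forall>(p', t')\<in>U. t' \<noteq> 0 \<and> H (p', t') \<noteq> 0 \<and>
        \<Phi> (act p' (inv_into ST \<Phi> (line (*s) t'))) = line (*s) (H (p', t')))"
    using smooth_shift[OF \<open>open U\<close>] by (intro exI[of _ U] exI[of _ "\<lambda>x. shift (fst x) (snd x)"]) auto
qed

section \<open>Branch points and the two hyperplanes\<close>

lemma line_mem_hyperplane:
  assumes "t \<noteq> 0" "\<And>c v. L (c *s v) = c * L v"
  shows "line (*s) t \<in> {line (*s) v | v. v \<noteq> 0 \<and> L v = (0 :: complex)} \<longleftrightarrow> L t = 0"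
proof
  assume "line (*s) t \<in> {line (*s) v | v. v \<noteq> 0 \<and> L v = 0}"
  then obtain v where v: "v \<noteq> 0" "L v = 0" "line (*s) v = line (*s) t" by auto
  then obtain c where "t = c *s v" using line_eq_iff[OF v(1)] by blast
  then show "L t = 0" using assms(2) v(2) by simp
qed (use assms in blast)

text \<open>The weights of the hyperplanes are, up to the sign from N - 1 reversed differences, the
  inverses of the products in the coordinates; after cancellation a plain Fourier sum is
  left.\<close>

lemma sum_fam_coords:
  "(\<Sum>j\<in>UNIV. (\<Prod>m\<in>UNIV - {j}. 1 / (nd m - nd j)) * (fam_coords b $ j * k j)) =
    (- 1) ^ (CARD('n) - 1) * (\<Sum>j\<in>UNIV. nd j * b (- \<gamma> j) * k j)"
proof -
  have "(\<Prod>m\<in>UNIV - {j}. 1 / (nd m - nd j)) * (fam_coords b $ j * k j) =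
    (- 1) ^ (CARD('n) - 1) * (nd j * b (- \<gamma> j) * k j)" for j
  proof -
    have "1 / (nd m - nd j) * (nd j - nd m) = - 1" if "m \<in> UNIV - {j}" for m
    proof -
      have "nd m - nd j \<noteq> 0" using inj_nd that by (auto simp: inj_on_def)
      then show ?thesis by (simp add: divide_eq_minus_1_iff)
    qed
    then have "(\<Prod>m\<in>UNIV - {j}. 1 / (nd m - nd j)) * (\<Prod>m\<in>UNIV - {j}. nd j - nd m) = (\<Prod>m\<in>UNIV - {j}. - 1)"
      unfolding prod.distrib[symmetric] by (rule prod.cong[OF refl])
    also have "\<dots> = (- 1) ^ (CARD('n) - 1)" by (simp add: card_Diff_singleton)
    finally have e: "(\<Prod>m\<in>UNIV - {j}. 1 / (nd m - nd j)) * (\<Prod>m\<in>UNIV - {j}. nd j - nd m) =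
      (- 1) ^ (CARD('n) - 1)" .
    have "(\<Prod>m\<in>UNIV - {j}. 1 / (nd m - nd j)) * (fam_coords b $ j * k j) =
      ((\<Prod>m\<in>UNIV - {j}. 1 / (nd m - nd j)) * (\<Prod>m\<in>UNIV - {j}. nd j - nd m)) * (nd j * b (- \<gamma> j) * k j)"
      unfolding fam_coords_nth wt_def by (simp only: mult_ac)
    then show ?thesis unfolding e .
  qed
  then show ?thesis by (simp only: sum_distrib_left)
qed

lemma sum_gam: "(\<Sum>j\<in>UNIV. h (- \<gamma> j)) = (\<Sum>g\<in>F. h g)"
  using sum.reindex_bij_betw[OF bij_\<gamma>, of "\<lambda>g. h (- g)"] sum_freqs_minus[of h] by simp

lemma branch_point_iff:
  assumes "f \<in> HSL \<Gamma> \<beta>0"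
  shows "d_z f p = 0 \<longleftrightarrow> \<Phi> (sd (rebase \<beta>0 p f)) \<in> Theta_inf \<beta>0 \<gamma> \<inter> Theta_zero \<beta>0 \<gamma>"
proof -
  obtain a where a: "f = fam a" "\<exists>g\<in>F. a g \<noteq> 0" using HSL_E[OF assms] .
  define b where "b g = a g * echar g p" for g
  have bnz: "\<exists>g\<in>F. b g \<noteq> 0" using a(2) by (simp add: b_def)
  have "rebase \<beta>0 p f = fam b" unfolding a(1) rebase_fam b_def ..
  then have P: "\<Phi> (sd (rebase \<beta>0 p f)) = line (*s) (fam_coords b)" by (simp add: Phi_spectral_data[OF bnz])
  define L1 where "L1 t = (\<Sum>j\<in>UNIV. (\<Prod>m\<in>UNIV - {j}. 1 / (nd m - nd j)) * t$j)" for t :: "complex ^ 'n"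
  define L0 where "L0 t = (\<Sum>j\<in>UNIV. (\<Prod>m\<in>UNIV - {j}. 1 / (nd m - nd j)) * (t$j / nd j))"
    for t :: "complex ^ 'n"
  have T: "Theta_inf \<beta>0 \<gamma> = {line (*s) v | v. v \<noteq> 0 \<and> L1 v = 0}" "Theta_zero \<beta>0 \<gamma> =
    {line (*s) v | v. v \<noteq> 0 \<and> L0 v = 0}"
    unfolding Theta_inf_def Theta_zero_def L1_def L0_def nd_def by (rule refl)+
  have lin: "L1 (c *s v) = c * L1 v" "L0 (c *s v) = c * L0 v" for c v
    unfolding L1_def L0_def sum_distrib_left by (rule sum.cong; simp)+
  have nd0: "nd j \<noteq> 0" for j using freqs_nz(2)[OF gam_F(1)] by (simp add: nd_def node_def)
  \<comment> \<open>In \<Theta>_\<infinity> the factor s_j of the coordinates survives and gives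
    \<open>modeB\<close>; in \<Theta>_0 it is cancelled by 1/s_j and gives \<open>modeA\<close>. The
    characters at \<open>p\<close> hidden in \<open>b\<close> evaluate these sums at
    \<open>p\<close>.\<close>
  have "L1 (fam_coords b) = (- 1) ^ (CARD('n) - 1) * (\<Sum>j\<in>UNIV. nd j * b (- \<gamma> j))"
    using sum_fam_coords[of b "\<lambda>_. 1"] by (simp add: L1_def)
  also have "(\<Sum>j\<in>UNIV. nd j * b (- \<gamma> j)) = (\<Sum>j\<in>UNIV. - (node \<beta>0 (- \<gamma> j) * b (- \<gamma> j)))"
    by (simp add: nd_def node_def)
  also have "\<dots> = (\<Sum>g\<in>F. - (node \<beta>0 g * b g))"
    by (rule sum_gam)
  also have "\<dots> = - modeB a p"
    unfolding modeB_def b_def sum_negf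
    by (intro arg_cong[of _ _ uminus] sum.cong) (simp_all add: mult_ac)
  finally have 1: "L1 (fam_coords b) = 0 \<longleftrightarrow> modeB a p = 0" by simp
  have "L0 (fam_coords b) = (- 1) ^ (CARD('n) - 1) * (\<Sum>j\<in>UNIV. b (- \<gamma> j))"
    using sum_fam_coords[of b "\<lambda>j. 1 / nd j"] nd0 by (simp add: L0_def)
  also have "(\<Sum>j\<in>UNIV. b (- \<gamma> j)) = modeA a p"
    unfolding modeA_def b_def by (rule sum_gam[of "\<lambda>g. a g * echar g p"])
  finally have 0: "L0 (fam_coords b) = 0 \<longleftrightarrow> modeA a p = 0" by simp
  have "\<Phi> (sd (rebase \<beta>0 p f)) \<in> Theta_inf \<beta>0 \<gamma> \<inter> Theta_zero \<beta>0 \<gamma> \<longleftrightarrow> modeB a p = 0 \<and> modeA a p = 0"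
    unfolding P T Int_iff line_mem_hyperplane[OF fam_coords_nz[OF bnz] lin(1)]
      line_mem_hyperplane[OF fam_coords_nz[OF bnz] lin(2)] 0 1 ..
  then show ?thesis unfolding a(1) d_z_fam_eq_0_iff by blast
qed

end

theorem theorem1p1:
  fixes \<Gamma> :: "complex set" and \<beta>0 :: complex and \<gamma> :: "'n::finite \<Rightarrow> complex"
  assumes "is_lattice \<Gamma>"
    and "\<beta>0 \<in> dual_lattice \<Gamma>"
    and "freqs \<Gamma> \<beta>0 \<noteq> {}"
    and "bij_betw \<gamma> UNIV (freqs \<Gamma> \<beta>0)"
  shows
    "(bij_betw (total_div \<Gamma> \<beta>0) (spectral_triples \<Gamma> \<beta>0) {D. size D = card (freqs \<Gamma> \<beta>0) - 1}
      \<and> bij_betw (poly_line \<Gamma> \<beta>0) (spectral_triples \<Gamma> \<beta>0) (proj_space smult (polys \<Gamma> \<beta>0))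
      \<and> bij_betw (Phi \<Gamma> \<beta>0 \<gamma>) (spectral_triples \<Gamma> \<beta>0) CP
      \<and> proj_isomorphism smult (polys \<Gamma> \<beta>0) (*s) UNIV
          (Phi \<Gamma> \<beta>0 \<gamma> \<circ> inv_into (spectral_triples \<Gamma> \<beta>0) (poly_line \<Gamma> \<beta>0)))
     \<and>
     (equiv (HSL \<Gamma> \<beta>0) (HSL_equiv \<Gamma> \<beta>0)
      \<and> (spectral_data \<Gamma> \<beta>0) respects (HSL_equiv \<Gamma> \<beta>0)
      \<and> bij_betw (\<lambda>C. the_elem (spectral_data \<Gamma> \<beta>0 ` C))
          (HSL \<Gamma> \<beta>0 // HSL_equiv \<Gamma> \<beta>0) (spectral_triples \<Gamma> \<beta>0))
     \<and>
     (\<exists>act :: complex \<Rightarrow> spectral_triple \<Rightarrow> spectral_triple.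
        (\<forall>p. \<forall>\<sigma>\<in>spectral_triples \<Gamma> \<beta>0. act p \<sigma> \<in> spectral_triples \<Gamma> \<beta>0)
      \<and> (\<forall>\<sigma>\<in>spectral_triples \<Gamma> \<beta>0. act 0 \<sigma> = \<sigma>)
      \<and> (\<forall>p p'. \<forall>\<sigma>\<in>spectral_triples \<Gamma> \<beta>0. act (p + p') \<sigma> = act p (act p' \<sigma>))
      \<and> (\<forall>p. \<forall>\<omega>\<in>\<Gamma>. \<forall>\<sigma>\<in>spectral_triples \<Gamma> \<beta>0. act (p + \<omega>) \<sigma> = act p \<sigma>)
      \<and> (\<forall>p. \<forall>f\<in>HSL \<Gamma> \<beta>0. rebase \<beta>0 p f \<in> HSL \<Gamma> \<beta>0
            \<and> act p (spectral_data \<Gamma> \<beta>0 f) = spectral_data \<Gamma> \<beta>0 (rebase \<beta>0 p f))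
      \<and> smooth_proj_family (\<lambda>p P. Phi \<Gamma> \<beta>0 \<gamma>
            (act p (inv_into (spectral_triples \<Gamma> \<beta>0) (Phi \<Gamma> \<beta>0 \<gamma>) P))))
     \<and>
     (\<forall>f\<in>HSL \<Gamma> \<beta>0. \<forall>p.
        d_z f p = 0 \<longleftrightarrow>
        Phi \<Gamma> \<beta>0 \<gamma> (spectral_data \<Gamma> \<beta>0 (rebase \<beta>0 p f)) \<in> Theta_inf \<beta>0 \<gamma> \<inter> Theta_zero \<beta>0 \<gamma>)"
proof -
  have fin: "finite (freqs \<Gamma> \<beta>0)" using bij_betw_finite[OF assms(4)] by simp
  interpret hsl_frequencies \<Gamma> \<beta>0 \<gamma> by unfold_locales (fact assms fin)+
  have "act p \<sigma> \<in> spectral_triples \<Gamma> \<beta>0" if "\<sigma> \<in> spectral_triples \<Gamma> \<beta>0" for p \<sigma>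
    using Phi_line[OF that] act_props(1)[OF that] by blast
  then show ?thesis
    by (intro conjI exI[of _ act] allI ballI bij_total_div bij_poly_line bij_Phi proj_isomorphism_Phi
        equiv_HSL spectral_data_respects bij_spectral_data act_0 act_add act_lattice rebase_HSL
        smooth_act branch_point_iff)
qed

end
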